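(* Let $d\ge1$, $2\le p<\infty$, let $\mathcal{O}\subset\mathbb{R}^d$ be a bounded smooth domain, and let $u_0\in L^p(\mathcal{O})\cap H_0^1(\mathcal{O})\cap\mathcal{M}$. Suppose $u\in C([0,\infty);L^p(\mathcal{O})\cap H_0^1(\mathcal{O})\cap\mathcal{M})$ is the unique strong solution (as defined in the context) of $$\frac{\partial u}{\partial t}=\Delta u-|u|^{p-2}u+\big(\|\nabla u\|_{L^2(\mathcal{O})}^2+\|u\|_{L^p(\mathcal{O})}^p\big)u,\qquad u(0)=u_0,\qquad u|_{\partial\mathcal{O}}=0,$$ such that $\frac{\partial u}{\partial t}\in L^2(0,\infty;L^2(\mathcal{O}))$. Then there exists a sequence of times $\{\tau_n\}_{n\in\mathbb{N}}$ with $\lim_{n\to\infty}\tau_n=\infty$ such that, as $n\to\infty$, $$u(\tau_n)\to u_\infty\ \text{ in } L^p(\mathcal{O})\cap H_0^1(\mathcal{O}),\qquad \mathcal{S}(u(\tau_n))\to\mathcal{S}(u_\infty)\ \text{ in }\mathbb{R},$$ where $\mathcal{S}(u)=\|\nabla u\|_{L^2(\mathcal{O})}^2+\|u\|_{L^p(\mathcal{O})}^p$ and $u_\infty\in\mathcal{M}$ solves $$\Delta u_\infty-|u_\infty|^{p-2}u_\infty+\mathcal{S}(u_\infty)u_\infty=0\quad\text{in } L^{\frac{p}{p-1}}(\mathcal{O})+H^{-1}(\mathcal{O}).$$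
   Context: Notation: $(\cdot,\cdot)$ is the inner product of $L^2(\mathcal{O})$ (real-valued functions), and $\mathcal{M}=\{u\in L^2(\mathcal{O}):\|u\|_{L^2(\mathcal{O})}=1\}$. $A=-\Delta$ is the Dirichlet Laplacian with $D(A)=H^2(\mathcal{O})\cap H_0^1(\mathcal{O})$. The space $L^p(\mathcal{O})\cap H_0^1(\mathcal{O})$ has norm $\max\{\|u\|_{L^p(\mathcal{O})},\|\nabla u\|_{L^2(\mathcal{O})}\}$, and $L^{\frac{p}{p-1}}(\mathcal{O})+H^{-1}(\mathcal{O})$ is the dual of this intersection space. Strong solution: put $\mathscr{G}(u)=\Delta u-|u|^{p-2}u+(\|\nabla u\|_{L^2(\mathcal{O})}^2+\|u\|_{L^p(\mathcal{O})}^p)u$. A function $u\in C([0,T];L^p(\mathcal{O})\cap H_0^1(\mathcal{O})\cap\mathcal{M})\cap L^2(0,T;D(A))\cap L^{2p-2}(0,T;L^{2p-2}(\mathcal{O}))$ is a strong solution on $[0,T]$ iff (i) the weak time derivative $\frac{\partial u}{\partial t}$ and $\mathscr{G}(u)$ belong to $L^2(0,T;L^2(\mathcal{O}))$; (ii) $\int_0^T\big(\frac{\partial u(t)}{\partial t}-\mathscr{G}(u(t)),\varphi(t)\big)\,dt=0$ for all $\varphi\in L^2(0,T;L^2(\mathcal{O}))$; (iii) $u(0)=u_0$ in $L^2(\mathcal{O})$. A function on $[0,\infty)$ is a strong solution if its restriction to $[0,T]$ is a strong solution on $[0,T]$ for every $T>0$. For each $u_0\in L^p(\mathcal{O})\cap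 H_0^1(\mathcal{O})\cap\mathcal{M}$ the paper establishes that a unique strong solution on $[0,\infty)$ exists. *)

theory Defs
  imports "HOL-Analysis.Analysis"
begin

text \<open>
  Elements of function spaces over \<open>\<Omega>\<close> are represented by functions \<open>'a \<Rightarrow> real\<close>, elements of
  spaces of vector-valued functions by \<open>real \<Rightarrow> 'a \<Rightarrow> real\<close>. Almost everywhere equal functions
  are not identified: the norms below are seminorms on representatives, and every
  predicate is invariant under a change of representative.
\<close>

section \<open>Smooth functions and smooth domains\<close>

definition partial_deriv :: "'a \<Rightarrow> ('a::euclidean_space \<Rightarrow> real) \<Rightarrow> 'a \<Rightarrow> real" where
  "partial_deriv b f x = frechet_derivative f (at x) b"

fun Ck :: "nat \<Rightarrow> ('a::euclidean_space \<Rightarrow> real) \<Rightarrow> bool" where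
  "Ck 0 f \<longleftrightarrow> continuous_on UNIV f"
| "Ck (Suc k) f \<longleftrightarrow>
     (\<forall>x. f differentiable (at x)) \<and> (\<forall>b\<in>Basis. Ck k (partial_deriv b f))"

definition smooth :: "('a::euclidean_space \<Rightarrow> real) \<Rightarrow> bool" where
  "smooth f \<longleftrightarrow> (\<forall>k. Ck k f)"

definition test_functions :: "'a::euclidean_space set \<Rightarrow> ('a \<Rightarrow> real) set" where
  "test_functions \<Omega> =
     {\<phi>. smooth \<phi> \<and> (\<exists>K. compact K \<and> K \<subseteq> \<Omega> \<and> (\<forall>x. x \<notin> K \<longrightarrow> \<phi> x = 0))}"

text \<open>
  Near each boundary point, after relabelling (\<open>e\<close>) and reorienting (\<open>\<sigma>\<close>) the coordinate axes,
  \<open>\<Omega>\<close> is the region above the graph of a smooth function of the other \<open>d - 1\<close> coordinates.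
  That function is \<open>\<gamma>\<close> restricted to the hyperplane orthogonal to \<open>e\<close>; a function on the
  hyperplane is smooth iff it is such a restriction.
\<close>

definition smooth_boundary :: "'a::euclidean_space set \<Rightarrow> bool" where
  "smooth_boundary \<Omega> \<longleftrightarrow>
     (\<forall>z\<in>frontier \<Omega>. \<exists>r>0. \<exists>e\<in>Basis. \<exists>\<sigma>\<in>{1, -1::real}. \<exists>\<gamma>. smooth \<gamma> \<and>
        \<Omega> \<inter> ball z r = {x \<in> ball z r. \<sigma> * (x \<bullet> e) > \<gamma> (x - (x \<bullet> e) *\<^sub>R e)})"

definition bounded_smooth_domain :: "'a::euclidean_space set \<Rightarrow> bool" where
  "bounded_smooth_domain \<Omega> \<longleftrightarrow>
     open \<Omega> \<and> connected \<Omega> \<and> \<Omega> \<noteq> {} \<and> bounded \<Omega> \<and> smooth_boundary \<Omega>"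

section \<open>Lebesgue and Sobolev spaces\<close>

definition Lp :: "real \<Rightarrow> 'a::euclidean_space set \<Rightarrow> ('a \<Rightarrow> real) set" where
  "Lp q \<Omega> = {f \<in> borel_measurable (lebesgue_on \<Omega>).
               integrable (lebesgue_on \<Omega>) (\<lambda>x. \<bar>f x\<bar> powr q)}"

definition Lp_norm :: "real \<Rightarrow> 'a::euclidean_space set \<Rightarrow> ('a \<Rightarrow> real) \<Rightarrow> real" where
  "Lp_norm q \<Omega> f = (LINT x|lebesgue_on \<Omega>. \<bar>f x\<bar> powr q) powr (1 / q)"

definition L2_inner :: "'a::euclidean_space set \<Rightarrow> ('a \<Rightarrow> real) \<Rightarrow> ('a \<Rightarrow> real) \<Rightarrow> real" where
  "L2_inner \<Omega> f g = (LINT x|lebesgue_on \<Omega>. f x * g x)"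

definition L2_sphere :: "'a::euclidean_space set \<Rightarrow> ('a \<Rightarrow> real) set" where
  "L2_sphere \<Omega> = {f \<in> Lp 2 \<Omega>. Lp_norm 2 \<Omega> f = 1}"

definition locally_integrable :: "'a::euclidean_space set \<Rightarrow> ('a \<Rightarrow> real) \<Rightarrow> bool" where
  "locally_integrable \<Omega> f \<longleftrightarrow> (\<forall>K. compact K \<and> K \<subseteq> \<Omega> \<longrightarrow> f absolutely_integrable_on K)"

definition has_weak_partial ::
  "'a::euclidean_space set \<Rightarrow> 'a \<Rightarrow> ('a \<Rightarrow> real) \<Rightarrow> ('a \<Rightarrow> real) \<Rightarrow> bool" where
  "has_weak_partial \<Omega> b f g \<longleftrightarrow>
     locally_integrable \<Omega> f \<and> locally_integrable \<Omega> g \<and>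
     (\<forall>\<phi>\<in>test_functions \<Omega>.
        (LINT x|lebesgue_on \<Omega>. f x * partial_deriv b \<phi> x) =
        - (LINT x|lebesgue_on \<Omega>. g x * \<phi> x))"

text \<open>
  The weak derivative is determined up to a null set, and only used where it exists.
\<close>

definition weak_partial :: "'a::euclidean_space set \<Rightarrow> 'a \<Rightarrow> ('a \<Rightarrow> real) \<Rightarrow> 'a \<Rightarrow> real" where
  "weak_partial \<Omega> b f = (SOME g. has_weak_partial \<Omega> b f g)"

definition H1 :: "'a::euclidean_space set \<Rightarrow> ('a \<Rightarrow> real) set" where
  "H1 \<Omega> = {f \<in> Lp 2 \<Omega>. \<forall>b\<in>Basis. \<exists>g\<in>Lp 2 \<Omega>. has_weak_partial \<Omega> b f g}"

definition H2 :: "'a::euclidean_space set \<Rightarrow> ('a \<Rightarrow> real) set" where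
  "H2 \<Omega> = {f \<in> H1 \<Omega>. \<forall>b\<in>Basis. weak_partial \<Omega> b f \<in> H1 \<Omega>}"

definition grad_inner :: "'a::euclidean_space set \<Rightarrow> ('a \<Rightarrow> real) \<Rightarrow> ('a \<Rightarrow> real) \<Rightarrow> real" where
  "grad_inner \<Omega> f g =
     (LINT x|lebesgue_on \<Omega>. (\<Sum>b\<in>Basis. weak_partial \<Omega> b f x * weak_partial \<Omega> b g x))"

definition grad_norm :: "'a::euclidean_space set \<Rightarrow> ('a \<Rightarrow> real) \<Rightarrow> real" where
  "grad_norm \<Omega> f = sqrt (LINT x|lebesgue_on \<Omega>. (\<Sum>b\<in>Basis. (weak_partial \<Omega> b f x)\<^sup>2))"

definition H1_norm :: "'a::euclidean_space set \<Rightarrow> ('a \<Rightarrow> real) \<Rightarrow> real" where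
  "H1_norm \<Omega> f = sqrt ((Lp_norm 2 \<Omega> f)\<^sup>2 + (grad_norm \<Omega> f)\<^sup>2)"

definition H01 :: "'a::euclidean_space set \<Rightarrow> ('a \<Rightarrow> real) set" where
  "H01 \<Omega> = {f \<in> H1 \<Omega>. \<exists>\<phi>. (\<forall>n::nat. \<phi> n \<in> test_functions \<Omega>) \<and>
                        (\<lambda>n. H1_norm \<Omega> (\<lambda>x. \<phi> n x - f x)) \<longlonglongrightarrow> 0}"

definition laplacian :: "'a::euclidean_space set \<Rightarrow> ('a \<Rightarrow> real) \<Rightarrow> 'a \<Rightarrow> real" where
  "laplacian \<Omega> f x = (\<Sum>b\<in>Basis. weak_partial \<Omega> b (weak_partial \<Omega> b f) x)"

text \<open>The domain of the Dirichlet Laplacian, with the graph norm.\<close>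

definition DA :: "'a::euclidean_space set \<Rightarrow> ('a \<Rightarrow> real) set" where
  "DA \<Omega> = H2 \<Omega> \<inter> H01 \<Omega>"

definition DA_norm :: "'a::euclidean_space set \<Rightarrow> ('a \<Rightarrow> real) \<Rightarrow> real" where
  "DA_norm \<Omega> f = sqrt ((Lp_norm 2 \<Omega> f)\<^sup>2 + (Lp_norm 2 \<Omega> (laplacian \<Omega> f))\<^sup>2)"

definition LpH01 :: "real \<Rightarrow> 'a::euclidean_space set \<Rightarrow> ('a \<Rightarrow> real) set" where
  "LpH01 p \<Omega> = Lp p \<Omega> \<inter> H01 \<Omega>"

definition LpH01_norm :: "real \<Rightarrow> 'a::euclidean_space set \<Rightarrow> ('a \<Rightarrow> real) \<Rightarrow> real" where
  "LpH01_norm p \<Omega> f = max (Lp_norm p \<Omega> f) (grad_norm \<Omega> f)"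

section \<open>Spaces of vector-valued functions\<close>

text \<open>
  In this section \<open>X\<close> is the carrier and \<open>N\<close> the norm of a space of functions on \<open>\<Omega>\<close>. The
  definitions follow \<open>has_bochner_integral\<close>, which requires a type of class
  \<open>real_normed_vector\<close> and so does not apply to spaces that depend on \<open>\<Omega>\<close> and \<open>p\<close>.
\<close>

definition continuous_into ::
  "('a \<Rightarrow> real) set \<Rightarrow> (('a \<Rightarrow> real) \<Rightarrow> real) \<Rightarrow> real set \<Rightarrow> (real \<Rightarrow> 'a \<Rightarrow> real) \<Rightarrow> bool" where
  "continuous_into X N J u \<longleftrightarrow>
     (\<forall>t\<in>J. u t \<in> X) \<and>
     (\<forall>t\<in>J. ((\<lambda>s. N (\<lambda>x. u s x - u t x)) \<longlongrightarrow> 0) (at t within J))"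

definition bochner_simple ::
  "real measure \<Rightarrow> ('a \<Rightarrow> real) set \<Rightarrow> (real \<Rightarrow> 'a \<Rightarrow> real) \<Rightarrow> bool" where
  "bochner_simple M X s \<longleftrightarrow>
     simple_function M s \<and> s ` space M \<subseteq> X \<and>
     emeasure M {t \<in> space M. s t \<noteq> (\<lambda>x. 0)} \<noteq> \<infinity>"

definition simple_integral_in :: "real measure \<Rightarrow> (real \<Rightarrow> 'a \<Rightarrow> real) \<Rightarrow> 'a \<Rightarrow> real" where
  "simple_integral_in M s x = (\<Sum>y\<in>s ` space M. measure M {t \<in> space M. s t = y} * y x)"

definition strongly_measurable ::
  "real measure \<Rightarrow> ('a \<Rightarrow> real) set \<Rightarrow> (('a \<Rightarrow> real) \<Rightarrow> real) \<Rightarrow> (real \<Rightarrow> 'a \<Rightarrow> real) \<Rightarrow> bool" where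
  "strongly_measurable M X N v \<longleftrightarrow>
     (AE t in M. v t \<in> X) \<and>
     (\<exists>s. (\<forall>n::nat. bochner_simple M X (s n)) \<and>
          (AE t in M. (\<lambda>n. N (\<lambda>x. s n t x - v t x)) \<longlonglongrightarrow> 0))"

definition has_bochner_integral_in ::
  "real measure \<Rightarrow> ('a \<Rightarrow> real) set \<Rightarrow> (('a \<Rightarrow> real) \<Rightarrow> real) \<Rightarrow>
   (real \<Rightarrow> 'a \<Rightarrow> real) \<Rightarrow> ('a \<Rightarrow> real) \<Rightarrow> bool" where
  "has_bochner_integral_in M X N v h \<longleftrightarrow>
     strongly_measurable M X N v \<and> h \<in> X \<and>
     (\<exists>s. (\<forall>n::nat. bochner_simple M X (s n)) \<and>
          (\<lambda>n. \<integral>\<^sup>+t. ennreal (N (\<lambda>x. s n t x - v t x)) \<partial>M) \<longlonglongrightarrow> 0 \<and>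
          (\<lambda>n. N (\<lambda>x. simple_integral_in M (s n) x - h x)) \<longlonglongrightarrow> 0)"

definition bochner_Lq ::
  "real \<Rightarrow> real set \<Rightarrow> ('a \<Rightarrow> real) set \<Rightarrow> (('a \<Rightarrow> real) \<Rightarrow> real) \<Rightarrow> (real \<Rightarrow> 'a \<Rightarrow> real) set" where
  "bochner_Lq q J X N =
     {v. strongly_measurable (lebesgue_on J) X N v \<and>
         integrable (lebesgue_on J) (\<lambda>t. N (v t) powr q)}"

abbreviation L2L2 :: "real set \<Rightarrow> 'a::euclidean_space set \<Rightarrow> (real \<Rightarrow> 'a \<Rightarrow> real) set" where
  "L2L2 J \<Omega> \<equiv> bochner_Lq 2 J (Lp 2 \<Omega>) (Lp_norm 2 \<Omega>)"

text \<open>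
  \<open>v\<close> is the weak time derivative of \<open>u\<close> on the open interval \<open>J\<close>: the \<open>L\<^sup>2\<close>-valued Bochner
  integrals satisfy \<open>\<integral> \<eta>' u dt = - \<integral> \<eta> v dt\<close> for all scalar test functions \<open>\<eta>\<close> on \<open>J\<close>.
\<close>

definition has_weak_time_deriv ::
  "'a::euclidean_space set \<Rightarrow> real set \<Rightarrow> (real \<Rightarrow> 'a \<Rightarrow> real) \<Rightarrow> (real \<Rightarrow> 'a \<Rightarrow> real) \<Rightarrow> bool" where
  "has_weak_time_deriv \<Omega> J u v \<longleftrightarrow>
     (\<forall>\<eta>\<in>test_functions J. \<exists>h.
        has_bochner_integral_in (lebesgue_on J) (Lp 2 \<Omega>) (Lp_norm 2 \<Omega>)
          (\<lambda>t x. deriv \<eta> t * u t x) h \<and>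
        has_bochner_integral_in (lebesgue_on J) (Lp 2 \<Omega>) (Lp_norm 2 \<Omega>)
          (\<lambda>t x. \<eta> t * v t x) (\<lambda>x. - h x))"

section \<open>The equation\<close>

definition S_fun :: "real \<Rightarrow> 'a::euclidean_space set \<Rightarrow> ('a \<Rightarrow> real) \<Rightarrow> real" where
  "S_fun p \<Omega> w = (grad_norm \<Omega> w)\<^sup>2 + Lp_norm p \<Omega> w powr p"

definition G_op :: "real \<Rightarrow> 'a::euclidean_space set \<Rightarrow> ('a \<Rightarrow> real) \<Rightarrow> 'a \<Rightarrow> real" where
  "G_op p \<Omega> w x = laplacian \<Omega> w x - \<bar>w x\<bar> powr (p - 2) * w x + S_fun p \<Omega> w * w x"

definition strong_solution_on ::
  "real \<Rightarrow> 'a::euclidean_space set \<Rightarrow> ('a \<Rightarrow> real) \<Rightarrow> real \<Rightarrow> (real \<Rightarrow> 'a \<Rightarrow> real) \<Rightarrow> bool" where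
  "strong_solution_on p \<Omega> u0 T u \<longleftrightarrow>
     continuous_into (LpH01 p \<Omega> \<inter> L2_sphere \<Omega>) (LpH01_norm p \<Omega>) {0..T} u \<and>
     u \<in> bochner_Lq 2 {0<..<T} (DA \<Omega>) (DA_norm \<Omega>) \<and>
     u \<in> bochner_Lq (2 * p - 2) {0<..<T} (Lp (2 * p - 2) \<Omega>) (Lp_norm (2 * p - 2) \<Omega>) \<and>
     (\<exists>v. has_weak_time_deriv \<Omega> {0<..<T} u v \<and>
          v \<in> L2L2 {0<..<T} \<Omega> \<and>
          (\<lambda>t. G_op p \<Omega> (u t)) \<in> L2L2 {0<..<T} \<Omega> \<and>
          (\<forall>\<phi>\<in>L2L2 {0<..<T} \<Omega>.
             (LINT t|lebesgue_on {0<..<T}.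
                L2_inner \<Omega> (\<lambda>x. v t x - G_op p \<Omega> (u t) x) (\<phi> t)) = 0)) \<and>
     (AE x in lebesgue_on \<Omega>. u 0 x = u0 x)"

definition strong_solution ::
  "real \<Rightarrow> 'a::euclidean_space set \<Rightarrow> ('a \<Rightarrow> real) \<Rightarrow> (real \<Rightarrow> 'a \<Rightarrow> real) \<Rightarrow> bool" where
  "strong_solution p \<Omega> u0 u \<longleftrightarrow> (\<forall>T>0. strong_solution_on p \<Omega> u0 T u)"

definition unique_strong_solution ::
  "real \<Rightarrow> 'a::euclidean_space set \<Rightarrow> ('a \<Rightarrow> real) \<Rightarrow> (real \<Rightarrow> 'a \<Rightarrow> real) \<Rightarrow> bool" where
  "unique_strong_solution p \<Omega> u0 u \<longleftrightarrow>
     strong_solution p \<Omega> u0 u \<and>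
     (\<forall>w. strong_solution p \<Omega> u0 w \<longrightarrow> (\<forall>t\<ge>0. AE x in lebesgue_on \<Omega>. w t x = u t x))"

text \<open>
  \<open>L\<^bsup>p/(p-1)\<^esup> + H\<^sup>-\<^sup>1\<close> is the dual of \<open>L\<^sup>p \<inter> H\<^sub>0\<^sup>1\<close>, so its elements are functionals on the latter
  space and an equation between them is an equation of their values on all of it. A function
  \<open>g\<close> acts by \<open>\<phi> \<mapsto> \<integral> g \<phi>\<close> (that is, by \<open>L2_inner \<Omega> g\<close>), and \<open>\<Delta> w\<close>, for \<open>w\<close> in \<open>H\<^sub>0\<^sup>1\<close>, by
  \<open>\<phi> \<mapsto> - \<integral> \<nabla> w \<cdot> \<nabla> \<phi>\<close>.
\<close>

definition dual_laplacian ::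
  "'a::euclidean_space set \<Rightarrow> ('a \<Rightarrow> real) \<Rightarrow> ('a \<Rightarrow> real) \<Rightarrow> real" where
  "dual_laplacian \<Omega> w \<phi> = - grad_inner \<Omega> w \<phi>"

definition solves_stationary :: "real \<Rightarrow> 'a::euclidean_space set \<Rightarrow> ('a \<Rightarrow> real) \<Rightarrow> bool" where
  "solves_stationary p \<Omega> w \<longleftrightarrow>
     (\<forall>\<phi>\<in>LpH01 p \<Omega>.
        dual_laplacian \<Omega> w \<phi> - L2_inner \<Omega> (\<lambda>x. \<bar>w x\<bar> powr (p - 2) * w x) \<phi>
          + S_fun p \<Omega> w * L2_inner \<Omega> w \<phi> = 0)"

end

theory Submission
  imports Defs "HOL-Complex_Analysis.Great_Picard"
begin

text \<open>
  The energy \<open>E(w) = \<parallel>\<nabla>w\<parallel>\<^sup>2 / 2 + \<parallel>w\<parallel>\<^sub>p\<^sup>p / p\<close> is convex, and the equation says that its derivative at \<open>u(t)\<close>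
  is \<open>S(u) u - \<partial>\<^sub>t u\<close>. On the unit sphere \<open>(u(t), u(t) - u(s)) = \<parallel>u(t) - u(s)\<parallel>\<^sup>2 / 2\<close>, so convexity gives
  \<open>E(u(t)) - E(u(s)) \<le> S(u(t)) \<parallel>u(t) - u(s)\<parallel>\<^sup>2 / 2 + \<parallel>\<partial>\<^sub>t u(t)\<parallel> \<parallel>u(t) - u(s)\<parallel>\<close> for almost every \<open>t\<close> and all \<open>s < t\<close>.
  Summed over a fine partition, with \<open>\<parallel>u(t) - u(s)\<parallel>\<^sup>2 \<le> (t - s) \<integral>\<parallel>\<partial>\<^sub>t u\<parallel>\<^sup>2\<close>, this bounds the energy uniformly
  in time. Choose \<open>\<tau>\<^sub>n \<rightarrow> \<infinity>\<close> with \<open>\<parallel>\<partial>\<^sub>t u(\<tau>\<^sub>n)\<parallel> \<rightarrow> 0\<close>. By Rellich's theorem a subsequence of \<open>u(\<tau>\<^sub>n)\<close> is Cauchy in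
  \<open>L\<^sup>2\<close>, and testing the difference of two equations with the difference of the solutions turns this
  into the Cauchy property in \<open>L\<^sup>p \<inter> H\<^sub>0\<^sup>1\<close>, because \<open>w \<mapsto> |w|\<^bsup>p-2\<^esup>w\<close> is strongly monotone. The limit is
  critical by Minty's argument.
\<close>

section \<open>Smooth bump functions\<close>

text \<open>The natural route, the energy identity dE/dt = - |u_t|^2, would require a chain rule for
  the energy along a curve whose derivative exists only weakly in L2. The one-sided convexity
  estimate avoids it: the equation is used only at the later time of each pair, and any good time
  will do. Its price is the term with the factor S(u(t)), for which no bound is known in advance. On
  a fixed interval continuity gives some bound K. Since |u(t) - u(s)|^2 is at most the time step
  times a piece of the dissipation, a mesh finer than 1 / K absorbs K, and the final bound depends
  neither on K nor on the length of the interval. The second obstacle is that p is arbitrary, so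
  that compactness is available only in L2; the strong monotonicity of both parts of the energy
  derivative compensates for this. Statements about functions of time with values in L2 are reduced
  to scalar ones by pairing with a fixed element of L2. One fundamental lemma of the calculus of
  variations then serves for weak derivatives in space and in time.\<close>

lemma partial_deriv_eq:
  "(f has_derivative f') (at x) \<Longrightarrow> partial_deriv b f x = f' b"
  unfolding partial_deriv_def by (metis frechet_derivative_at)

lemma Ck_Suc_imp_Ck: "Ck (Suc k) f \<Longrightarrow> Ck k f"
proof (induction k arbitrary: f)
  case 0
  then show ?case
    by (auto intro!: differentiable_imp_continuous_on simp: differentiable_on_def
        intro: differentiable_at_withinI)
next
  case (Suc k)
  show ?case using Suc.prems Suc.IH by (metis Ck.simps(2))
qed

lemma smooth_differentiable: "smooth f \<Longrightarrow> f differentiable (at x)"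
  unfolding smooth_def by (metis Ck.simps(2))

lemma smooth_partial_deriv: "smooth f \<Longrightarrow> b \<in> Basis \<Longrightarrow> smooth (partial_deriv b f)"
  unfolding smooth_def by (metis Ck.simps(2))

lemma smooth_continuous_on: "smooth f \<Longrightarrow> continuous_on UNIV f"
  unfolding smooth_def by (metis Ck.simps(1))

lemma smooth_has_derivative: "smooth f \<Longrightarrow> (f has_derivative frechet_derivative f (at x)) (at x)"
  using smooth_differentiable frechet_derivative_works by blast

lemma frechet_derivative_sum_partial_deriv:
  fixes f :: "'a::euclidean_space \<Rightarrow> real"
  assumes "f differentiable (at x)"
  shows "frechet_derivative f (at x) h = (\<Sum>b\<in>Basis. (h \<bullet> b) * partial_deriv b f x)"
proof -
  have l: "linear (frechet_derivative f (at x))"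
    using assms by (rule linear_frechet_derivative)
  have "frechet_derivative f (at x) h = frechet_derivative f (at x) (\<Sum>b\<in>Basis. (h \<bullet> b) *\<^sub>R b)"
    by (simp add: euclidean_representation)
  also have "\<dots> = (\<Sum>b\<in>Basis. (h \<bullet> b) * partial_deriv b f x)"
    unfolding partial_deriv_def using l by (simp add: linear_sum linear_scale)
  finally show ?thesis .
qed

lemma Ck_const: "Ck k (\<lambda>x. c)"
proof (induction k arbitrary: c)
  case (Suc k)
  have "partial_deriv b (\<lambda>x. c) = (\<lambda>x. 0)" for b :: 'a
    by (intro ext partial_deriv_eq[where f' = "\<lambda>_. 0"]) auto
  then show ?case using Suc by auto
qed auto

lemma Ck_add: "Ck k f \<Longrightarrow> Ck k g \<Longrightarrow> Ck k (\<lambda>x. f x + g x)"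
proof (induction k arbitrary: f g)
  case 0
  then show ?case by (auto intro: continuous_intros)
next
  case (Suc k)
  have d: "f differentiable (at x)" "g differentiable (at x)" for x
    using Suc.prems by auto
  have "partial_deriv b (\<lambda>x. f x + g x) = (\<lambda>x. partial_deriv b f x + partial_deriv b g x)" for b
  proof
    fix x
    have "((\<lambda>x. f x + g x) has_derivative
        (\<lambda>h. frechet_derivative f (at x) h + frechet_derivative g (at x) h)) (at x)"
      using d frechet_derivative_works by (blast intro: has_derivative_add)
    then show "partial_deriv b (\<lambda>x. f x + g x) x = partial_deriv b f x + partial_deriv b g x"
      by (subst partial_deriv_eq) (auto simp: partial_deriv_def)
  qed
  then show ?case using Suc d by (auto intro: differentiable_add)
qed

lemma Ck_mult: "Ck k f \<Longrightarrow> Ck k g \<Longrightarrow> Ck k (\<lambda>x. f x * g x)"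
proof (induction k arbitrary: f g)
  case 0
  then show ?case by (auto intro: continuous_intros)
next
  case (Suc k)
  have d: "f differentiable (at x)" "g differentiable (at x)" for x
    using Suc.prems by auto
  have "partial_deriv b (\<lambda>x. f x * g x) =
      (\<lambda>x. f x * partial_deriv b g x + partial_deriv b f x * g x)" for b
  proof
    fix x
    have "((\<lambda>x. f x * g x) has_derivative
        (\<lambda>h. f x * frechet_derivative g (at x) h + frechet_derivative f (at x) h * g x)) (at x)"
      using d frechet_derivative_works by (blast intro: has_derivative_mult)
    then show "partial_deriv b (\<lambda>x. f x * g x) x =
        f x * partial_deriv b g x + partial_deriv b f x * g x"
      by (subst partial_deriv_eq) (auto simp: partial_deriv_def)
  qed
  moreover have "Ck k f" "Ck k g" using Suc.prems Ck_Suc_imp_Ck by blast+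
  ultimately show ?case using Suc d by (auto intro!: Ck_add Suc.IH)
qed

lemma smooth_const: "smooth (\<lambda>x. c)"
  unfolding smooth_def by (simp add: Ck_const)

lemma smooth_mult: "smooth f \<Longrightarrow> smooth g \<Longrightarrow> smooth (\<lambda>x. f x * g x)"
  unfolding smooth_def by (blast intro: Ck_mult)

lemma smooth_diff: "smooth f \<Longrightarrow> smooth g \<Longrightarrow> smooth (\<lambda>x. f x - g x)"
  using Ck_add[of _ f "\<lambda>x. -1 * g x"] Ck_mult[OF Ck_const, of _ g "-1"]
  unfolding smooth_def by simp

lemma smooth_prod:
  "finite I \<Longrightarrow> (\<And>i. i \<in> I \<Longrightarrow> smooth (f i)) \<Longrightarrow> smooth (\<lambda>x. \<Prod>i\<in>I. f i x)"
  by (induction I rule: finite_induct) (auto intro: smooth_mult smooth_const)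

text \<open>For \<open>j = 0\<close> this is the classical flat function exp(-1/t), extended by 0.
  Dividing by powers of t closes the family under differentiation up to linear combinations, so one
  induction makes all members smooth.\<close>

definition psi :: "nat \<Rightarrow> real \<Rightarrow> real" where
  "psi j t = (if t > 0 then exp (- (1 / t)) / t ^ j else 0)"

text \<open>With s = 1/t the positive branch becomes s^j / exp s, which tends to 0 as s tends to
  infinity.\<close>

lemma psi_tendsto_0: "(psi j \<longlongrightarrow> 0) (at 0)"
proof (rule filterlim_split_at)
  have "((\<lambda>t. psi j t) \<longlongrightarrow> 0) (at_left 0)"
    by (rule tendsto_eventually) (auto simp: psi_def eventually_at_filter)
  then show "(psi j \<longlongrightarrow> 0) (at_left 0)" .
  have "((\<lambda>s. s ^ j / exp s) \<longlongrightarrow> (0::real)) at_top" by (rule tendsto_power_div_exp_0)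
  then have "((\<lambda>t. (inverse t) ^ j / exp (inverse t)) \<longlongrightarrow> (0::real)) (at_right 0)"
    by (rule filterlim_compose[OF _ filterlim_inverse_at_top_right])
  moreover have "\<forall>\<^sub>F t in at_right 0. (inverse t) ^ j / exp (inverse t) = psi j t"
    unfolding eventually_at_filter
    by (rule always_eventually) (auto simp: psi_def exp_minus divide_simps)
  ultimately show "(psi j \<longlongrightarrow> 0) (at_right 0)"
    by (rule Lim_transform_eventually)
qed

lemma psi_has_derivative:
  "(psi j has_real_derivative psi (j + 2) t - real j * psi (j + 1) t) (at t)"
proof -
  consider "t > 0" | "t < 0" | "t = 0" by linarith
  then show ?thesis
  proof cases
    case 1
    have "((\<lambda>t. exp (- (1 / t)) / t ^ j) has_real_derivative
        psi (j + 2) t - real j * psi (j + 1) t) (at t)"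
      using 1 by (auto intro!: derivative_eq_intros simp: psi_def field_simps power2_eq_square)
         (cases j; simp add: field_simps)
    moreover have "\<forall>\<^sub>F s in nhds t. psi j s = exp (- (1 / s)) / s ^ j"
      using eventually_nhds_in_open[of "{0<..}" t] 1
      by (auto elim!: eventually_mono simp: psi_def)
    ultimately show ?thesis by (subst DERIV_cong_ev) auto
  next
    case 2
    have "((\<lambda>t::real. 0) has_real_derivative psi (j + 2) t - real j * psi (j + 1) t) (at t)"
      using 2 by (auto simp: psi_def)
    moreover have "\<forall>\<^sub>F s in nhds t. psi j s = 0"
      using eventually_nhds_in_open[of "{..<0}" t] 2
      by (auto elim!: eventually_mono simp: psi_def)
    ultimately show ?thesis by (subst DERIV_cong_ev) auto
  next
    case 3
    \<comment> \<open>The difference quotient of \<open>psi j\<close> at 0 is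
      \<open>psi (Suc j)\<close>, so differentiability at 0 is the limit statement for the next
      index.\<close>
    have "((\<lambda>h. (psi j (0 + h) - psi j 0) / h) \<longlongrightarrow> 0) (at 0)"
      by (rule Lim_transform_eventually[OF psi_tendsto_0[of "Suc j"]])
         (auto simp: eventually_at_filter psi_def)
    then show ?thesis using 3 by (simp add: DERIV_def psi_def)
  qed
qed

text \<open>The induction on k keeps j arbitrary because differentiation raises j by one or two.
  Affine arguments are the ones that occur in the factors of a box bump.\<close>

lemma Ck_psi_affine: "Ck k (\<lambda>x. psi j (c + x \<bullet> v))"
proof (induction k arbitrary: j)
  case 0
  have "continuous_on UNIV (psi j)" for j
    using psi_has_derivative by (meson DERIV_isCont continuous_at_imp_continuous_on)
  then have "continuous_on UNIV (\<lambda>x. psi j (c + x \<bullet> v))"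
    by (rule continuous_on_compose2) (auto intro!: continuous_intros)
  then show ?case by simp
next
  case (Suc k)
  let ?d = "\<lambda>x. psi (j + 2) (c + x \<bullet> v) - real j * psi (j + 1) (c + x \<bullet> v)"
  have hd: "((\<lambda>x. psi j (c + x \<bullet> v)) has_derivative (\<lambda>h. (h \<bullet> v) * ?d x)) (at x)" for x
    by (rule has_derivative_eq_rhs[OF DERIV_compose_FDERIV[OF psi_has_derivative]])
       (auto intro!: derivative_eq_intros)
  have "partial_deriv b (\<lambda>x. psi j (c + x \<bullet> v)) = (\<lambda>x. (b \<bullet> v) * ?d x)" for b
    using partial_deriv_eq[OF hd] by blast
  moreover have "Ck k (\<lambda>x. (b \<bullet> v) * ?d x)" for b
    using Ck_add[OF Suc[of "j+2"] Ck_mult[OF Ck_const[of k "- real j"] Suc[of "j+1"]]]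
    by (intro Ck_mult Ck_const) simp
  ultimately show ?case
    using hd by (auto simp: differentiable_def)
qed

text \<open>Since \<open>psi 0 (n t) \<longlonglongrightarrow> 1\<close> for \<open>t > 0\<close>, these functions converge to the indicator of the box.\<close>

definition box_bump :: "nat \<Rightarrow> 'a \<Rightarrow> 'a \<Rightarrow> 'a::euclidean_space \<Rightarrow> real" where
  "box_bump n a b x = (\<Prod>i\<in>Basis. psi 0 (real n * ((x - a) \<bullet> i)) * psi 0 (real n * ((b - x) \<bullet> i)))"

lemma psi_0_bounds: "0 \<le> psi 0 t" "psi 0 t \<le> 1"
  by (auto simp: psi_def)

lemma psi_0_eq_0: "t \<le> 0 \<Longrightarrow> psi 0 t = 0"
  by (auto simp: psi_def)

lemma smooth_box_bump: "smooth (box_bump n a b)"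
proof -
  have "smooth (\<lambda>x. psi 0 (real n * ((x - a) \<bullet> i)) * psi 0 (real n * ((b - x) \<bullet> i)))" for i
    using Ck_psi_affine[of _ 0 "- (real n * (a \<bullet> i))" "real n *\<^sub>R i"]
      Ck_psi_affine[of _ 0 "real n * (b \<bullet> i)" "- (real n *\<^sub>R i)"]
    by (intro smooth_mult) (simp_all add: smooth_def inner_diff_left algebra_simps)
  then show ?thesis
    unfolding box_bump_def by (intro smooth_prod) auto
qed

lemma box_bump_bounds: "0 \<le> box_bump n a b x" "box_bump n a b x \<le> 1"
  unfolding box_bump_def
  by (auto intro!: prod_nonneg prod_le_1 mult_nonneg_nonneg mult_le_one psi_0_bounds)

lemma box_bump_outside: "x \<notin> box a b \<Longrightarrow> box_bump n a b x = 0"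
  unfolding box_bump_def mem_box
  by (force simp: inner_diff_left not_less intro!: psi_0_eq_0 mult_nonneg_nonpos)

lemma box_bump_tendsto: "(\<lambda>n. box_bump n a b x) \<longlonglongrightarrow> indicator (box a b) x"
proof (cases "x \<in> box a b")
  case True
  have 1: "(\<lambda>n. psi 0 (real n * t)) \<longlonglongrightarrow> 1" if "t > 0" for t
  proof -
    have "(\<lambda>n. exp (- (inverse (real n) * inverse t))) \<longlonglongrightarrow> exp (- (0 * inverse t))"
      by (intro tendsto_intros lim_inverse_n)
    moreover have "\<forall>\<^sub>F n in sequentially. exp (- (inverse (real n) * inverse t)) = psi 0 (real n * t)"
      using eventually_gt_at_top[of 0] by eventually_elim (use that in \<open>auto simp: psi_def field_simps\<close>)
    ultimately show ?thesis by (auto intro: Lim_transform_eventually)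
  qed
  have "(\<lambda>n. box_bump n a b x) \<longlonglongrightarrow> (\<Prod>i\<in>(Basis::'a set). 1 * 1)"
    unfolding box_bump_def
    using True by (intro tendsto_prod tendsto_mult 1) (auto simp: mem_box inner_diff_left)
  then show ?thesis using True by simp
qed (simp add: box_bump_outside)

lemma box_bump_test_function: "cbox a b \<subseteq> \<Omega> \<Longrightarrow> box_bump n a b \<in> test_functions \<Omega>"
  unfolding test_functions_def
  using smooth_box_bump box_bump_outside box_subset_cbox compact_cbox
  by (smt (verit, best) mem_Collect_eq subsetD)

section \<open>The fundamental lemma of the calculus of variations\<close>

text \<open>Boxes form an intersection-stable generator of the Borel sets. The sets over which g
  integrates to 0 are closed under countable disjoint unions, and under complements because the
  total integral vanishes, so Dynkin's theorem reaches every Borel set.\<close>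

lemma AE_eq_0_if_box_integrals_0:
  fixes g :: "'a::euclidean_space \<Rightarrow> real"
  assumes g[measurable]: "integrable lborel g"
    and z: "integral\<^sup>L lborel g = 0"
    and box: "\<And>a b. (LINT x|lborel. indicator (box a b) x * g x) = 0"
  shows "AE x in lborel. g x = 0"
proof (rule density_unique_real[OF g, of "\<lambda>_. 0"])
  show "integrable lborel (\<lambda>_::'a. 0::real)" by simp
  let ?G = "range (\<lambda>(a, b). box a b :: 'a set)"
  have gi: "integrable lborel (\<lambda>x. indicator A x * g x)" if "A \<in> sets lborel" for A
    using integrable_mult_indicator[OF that g] by simp
  have I: "Int_stable ?G"
    by (force simp: Int_stable_def box_Int_box image_iff)
  have G: "?G \<subseteq> Pow UNIV" by simp
  fix A assume "A \<in> sets (lborel :: 'a measure)"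
  then have "A \<in> sigma_sets UNIV ?G" by (simp add: borel_eq_box)
  from I G this
  have "(LINT x|lborel. indicator A x * g x) = 0"
  proof (induction rule: sigma_sets_induct_disjoint)
    case (basic A)
    then show ?case using box by auto
  next
    case (compl A)
    then have A: "A \<in> sets lborel" by (simp add: borel_eq_box)
    have "(LINT x|lborel. indicator (UNIV - A) x * g x) = (LINT x|lborel. g x - indicator A x * g x)"
      by (intro Bochner_Integration.integral_cong) (auto simp: indicator_def)
    also have "\<dots> = 0" using compl z g gi[OF A] by (subst Bochner_Integration.integral_diff) auto
    finally show ?case .
  next
    case (union A)
    then have A: "A i \<in> sets lborel" for i by (auto simp: borel_eq_box)
    have "(LINT x|lborel. indicator (\<Union>i. A i) x * g x) = (LINT x:(\<Union>i. A i)|lborel. g x)"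
      by (simp add: set_lebesgue_integral_def)
    also have "\<dots> = (\<Sum>i. (LINT x:(A i)|lborel. g x))"
      using A union(1) gi[of "\<Union>i. A i"] by (intro lebesgue_integral_countable_add)
        (auto simp: disjoint_family_on_def set_integrable_def)
    also have "\<dots> = 0" using union by (simp add: set_lebesgue_integral_def)
    finally show ?case .
  qed auto
  then show "(LINT x:A|lborel. g x) = (LINT x:A|lborel. 0)" by (simp add: set_lebesgue_integral_def)
qed

lemma AE_eq_0_if_box_integrals_0_lebesgue:
  fixes g :: "'a::euclidean_space \<Rightarrow> real"
  assumes g: "integrable lebesgue g"
    and z: "integral\<^sup>L lebesgue g = 0"
    and box: "\<And>a b. (LINT x|lebesgue. indicator (box a b) x * g x) = 0"
  shows "AE x in lebesgue. g x = 0"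
proof -
  obtain h where h[measurable]: "h \<in> borel_measurable lborel" and ae: "AE x in lborel. g x = h x"
    using g by (metis completion_ex_borel_measurable_real borel_measurable_integrable)
  have ae': "AE x in lebesgue. g x = h x" using ae by (rule AE_completion)
  have hl: "h \<in> borel_measurable lebesgue" using h by (simp add: measurable_completion)
  have "integrable lebesgue h"
    using g ae' hl by (subst integrable_cong_AE[of _ _ g]) auto
  then have hi: "integrable lborel h" by (simp add: integrable_completion)
  have "AE x in lborel. h x = 0"
  proof (rule AE_eq_0_if_box_integrals_0[OF hi])
    show "integral\<^sup>L lborel h = 0"
      using z integral_cong_AE[OF _ hl ae'] g by (simp add: integral_completion)
    fix a b :: 'a
    have m: "(\<lambda>x. indicator (box a b) x * g x) \<in> borel_measurable lebesgue"
       "(\<lambda>x. indicator (box a b) x * h x) \<in> borel_measurable lebesgue"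
      using borel_measurable_integrable[OF g] hl by (auto intro!: borel_measurable_times borel_measurable_indicator)
    have "(LINT x|lebesgue. indicator (box a b) x * g x) = (LINT x|lebesgue. indicator (box a b) x * h x)"
      by (rule integral_cong_AE[OF m]) (use ae' in auto)
    then show "(LINT x|lborel. indicator (box a b) x * h x) = 0"
      using box by (simp add: integral_completion)
  qed
  then have "AE x in lebesgue. h x = 0" by (rule AE_completion)
  with ae' show ?thesis by auto
qed

text \<open>Since g is integrable only on compact sets, it is first cut off to a closed box inside
  \<Omega>. There, bumps converging to indicators of smaller boxes show that all box integrals
  vanish. Countably many closed boxes cover \<Omega>.\<close>

lemma fundamental_lemma_variations:
  fixes g :: "'a::euclidean_space \<Rightarrow> real"
  assumes \<Omega>: "open \<Omega>" and g: "locally_integrable \<Omega> g"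
    and z: "\<And>\<phi>. \<phi> \<in> test_functions \<Omega> \<Longrightarrow> (LINT x|lebesgue_on \<Omega>. g x * \<phi> x) = 0"
  shows "AE x in lebesgue_on \<Omega>. g x = 0"
proof -
  have \<Omega>s: "\<Omega> \<in> sets lebesgue" using \<Omega> by auto
  have boxes: "AE x in lebesgue. x \<in> cbox a b \<longrightarrow> g x = 0" if ab: "cbox a b \<subseteq> \<Omega>" for a b
  proof -
    have gi: "integrable lebesgue (\<lambda>x. indicator (cbox a b) x * g x)"
      using g ab unfolding locally_integrable_def set_integrable_def by auto
    have lim: "(LINT x|lebesgue. indicator (box c d) x * g x) = 0" if cd: "cbox c d \<subseteq> cbox a b" for c d
    proof -
      let ?s = "\<lambda>n x. indicator \<Omega> x *\<^sub>R (g x * box_bump n c d x)"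
      have i0: "integral\<^sup>L lebesgue (?s n) = 0" for n
        using z[OF box_bump_test_function, of c d n] cd ab \<Omega>s
        by (simp add: integral_restrict_space)
      have bb: "box_bump n c d \<in> borel_measurable lebesgue" for n
        using smooth_continuous_on[OF smooth_box_bump, of n c d]
        by (intro measurable_completion) (simp add: borel_measurable_continuous_onI)
      have gm: "(\<lambda>x. indicator (cbox a b) x * g x) \<in> borel_measurable lebesgue"
        using gi by auto
      \<comment> \<open>The bump vanishes off \<open>box c d\<close>, so the cut-off to \<Omega> can
        be traded for the cut-off to \<open>cbox a b\<close>, where g is integrable. This provides
        the dominating function.\<close>
      have eqs: "?s n x = (indicator (cbox a b) x * g x) * box_bump n c d x" for n x
        using cd ab box_subset_cbox[of c d]
        by (cases "x \<in> box c d") (auto simp: box_bump_outside indicator_def)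
      have eqf: "indicator (box c d) x * g x = (indicator (cbox a b) x * g x) * indicator (box c d) x" for x
        using cd box_subset_cbox[of c d] by (auto simp: indicator_def)
      have "(\<lambda>n. integral\<^sup>L lebesgue (?s n)) \<longlonglongrightarrow> (LINT x|lebesgue. indicator (box c d) x * g x)"
      proof (rule integral_dominated_convergence)
        show "integrable lebesgue (\<lambda>x. norm (indicator (cbox a b) x * g x))"
          using gi by (rule integrable_norm)
        show "AE x in lebesgue. (\<lambda>n. ?s n x) \<longlonglongrightarrow> indicator (box c d) x * g x"
          unfolding eqs eqf by (intro AE_I2 tendsto_intros box_bump_tendsto)
        show "AE x in lebesgue. norm (?s n x) \<le> norm (indicator (cbox a b) x * g x)" for n
          unfolding eqs using box_bump_bounds[of n c d]
          by (intro AE_I2) (simp add: abs_mult mult_left_le)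
        show "?s n \<in> borel_measurable lebesgue" for n
          unfolding eqs using gm bb by measurable
        show "(\<lambda>x. indicator (box c d) x * g x) \<in> borel_measurable lebesgue"
          unfolding eqf by (intro borel_measurable_times gm borel_measurable_indicator) auto
      qed
      then show ?thesis unfolding i0 by (simp add: LIMSEQ_const_iff)
    qed
    have bi: "integrable lebesgue (\<lambda>x. indicator (box a b) x * g x)"
    proof -
      have "integrable lebesgue (\<lambda>x. indicator (box a b) x *\<^sub>R (indicator (cbox a b) x * g x))"
        using gi by (intro integrable_mult_indicator) auto
      then show ?thesis
        by (rule back_subst[where P = "integrable lebesgue"])
           (use box_subset_cbox[of a b] in \<open>auto simp: indicator_def fun_eq_iff\<close>)
    qed
    have "AE x in lebesgue. indicator (box a b) x * g x = 0"
    proof (rule AE_eq_0_if_box_integrals_0_lebesgue[OF bi])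
      show "(LINT x|lebesgue. indicator (box a b) x * g x) = 0" by (rule lim) simp
      fix c d :: 'a
      obtain c' d' where cd: "box c d \<inter> box a b = box c' d'" "cbox c d \<inter> cbox a b = cbox c' d'"
        using box_Int_box[of c d a b] Int_interval[of c d a b] by blast
      have "(LINT x|lebesgue. indicator (box c d) x * (indicator (box a b) x * g x)) =
            (LINT x|lebesgue. indicator (box c' d') x * g x)"
        using cd(1) by (intro Bochner_Integration.integral_cong) (auto simp: indicator_def)
      also have "\<dots> = 0" using cd(2) by (intro lim) auto
      finally show "(LINT x|lebesgue. indicator (box c d) x * (indicator (box a b) x * g x)) = 0" .
    qed
    moreover have "AE x in lebesgue. x \<notin> cbox a b - box a b"
      using negligible_frontier_interval[of a b]
      by (intro AE_not_in) (simp add: negligible_iff_null_sets)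
    ultimately show ?thesis by eventually_elim (auto simp: indicator_def)
  qed
  obtain D where D: "countable D" "D \<subseteq> Pow \<Omega>" "\<And>X. X \<in> D \<Longrightarrow> \<exists>a b. X = cbox a b" "\<Union>D = \<Omega>"
    using open_countable_Union_open_cbox[OF \<Omega>] by metis
  have "AE x in lebesgue. \<forall>X\<in>D. x \<in> X \<longrightarrow> g x = 0"
    unfolding AE_ball_countable[OF D(1)]
  proof
    fix X assume "X \<in> D"
    then obtain a b where "X = cbox a b" "X \<subseteq> \<Omega>" using D by blast
    then show "AE x in lebesgue. x \<in> X \<longrightarrow> g x = 0" using boxes by simp
  qed
  then have "AE x in lebesgue. x \<in> \<Omega> \<longrightarrow> g x = 0"
    using D(4) by (auto elim!: eventually_mono)
  then show ?thesis using \<Omega>s by (simp add: AE_restrict_space_iff)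
qed

section \<open>Lebesgue spaces\<close>

lemma abs_add_powr_le:
  fixes a b q :: real
  assumes "0 < q"
  shows "\<bar>a + b\<bar> powr q \<le> 2 powr q * (\<bar>a\<bar> powr q + \<bar>b\<bar> powr q)"
proof -
  have "\<bar>a + b\<bar> powr q \<le> (2 * max \<bar>a\<bar> \<bar>b\<bar>) powr q"
    using assms by (intro powr_mono2) auto
  also have "\<dots> = 2 powr q * (max \<bar>a\<bar> \<bar>b\<bar>) powr q"
    by (simp add: powr_mult)
  also have "\<dots> \<le> 2 powr q * (\<bar>a\<bar> powr q + \<bar>b\<bar> powr q)"
    by (intro mult_left_mono) (auto simp: max_def)
  finally show ?thesis .
qed

lemma powr_convex_combination:
  fixes a b q t :: real
  assumes "1 \<le> q" "0 \<le> a" "0 \<le> b" "0 \<le> t" "t \<le> 1"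
  shows "(t * a + (1 - t) * b) powr q \<le> t * a powr q + (1 - t) * b powr q"
proof -
  \<comment> \<open>Convexity of the power is used below for positive a and b only. When one of them
    vanishes, the claim comes down to s^q \<le> s on [0, 1].\<close>
  have z: "(s * c) powr q \<le> s * c powr q" if "0 \<le> s" "s \<le> 1" "0 \<le> c" for s c :: real
  proof -
    have "s powr q \<le> s"
      using that assms(1) powr_mono'[of 1 q s] by (cases "s = 0") auto
    then show ?thesis using that by (simp add: powr_mult mult_right_mono)
  qed
  show ?thesis
  proof (cases "a = 0 \<or> b = 0")
    case True
    then show ?thesis using z[of t a] z[of "1 - t" b] assms by auto
  next
    case False
    then have "a > 0" "b > 0" using assms by auto
    then show ?thesis
      using convex_onD[OF powr_convex[OF assms(1)], of "1 - t" a b] assms by auto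
  qed
qed

lemma Lp_measurable: "f \<in> Lp q \<Omega> \<Longrightarrow> f \<in> borel_measurable (lebesgue_on \<Omega>)"
  and Lp_integrable: "f \<in> Lp q \<Omega> \<Longrightarrow> integrable (lebesgue_on \<Omega>) (\<lambda>x. \<bar>f x\<bar> powr q)"
  by (auto simp: Lp_def)

lemma Lp_norm_nonneg [simp]: "0 \<le> Lp_norm q \<Omega> f"
  by (simp add: Lp_norm_def)

lemma Lp_norm_powr:
  "0 < q \<Longrightarrow> Lp_norm q \<Omega> f powr q = (LINT x|lebesgue_on \<Omega>. \<bar>f x\<bar> powr q)"
  by (simp add: Lp_norm_def powr_powr)

lemma Lp_norm_le_iff:
  "0 < q \<Longrightarrow> 0 \<le> C \<Longrightarrow>
   Lp_norm q \<Omega> f \<le> C \<longleftrightarrow> (LINT x|lebesgue_on \<Omega>. \<bar>f x\<bar> powr q) \<le> C powr q"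
  unfolding Lp_norm_powr[symmetric]
  by (meson Lp_norm_nonneg leD le_less_linear powr_less_mono2 powr_mono2 less_imp_le)

lemma nn_integral_Lp:
  "0 < q \<Longrightarrow> f \<in> Lp q \<Omega> \<Longrightarrow>
   (\<integral>\<^sup>+x. ennreal (\<bar>f x\<bar> powr q) \<partial>lebesgue_on \<Omega>) = ennreal (Lp_norm q \<Omega> f powr q)"
  by (subst nn_integral_eq_integral) (auto simp: Lp_integrable Lp_norm_powr)

text \<open>A bound on the nonnegative integral is what Fatou's lemma and Tonelli's theorem deliver;
  it yields integrability and the norm bound at once.\<close>

lemma Lp_memI:
  assumes "0 < q" "0 \<le> C" "f \<in> borel_measurable (lebesgue_on \<Omega>)"
    and le: "(\<integral>\<^sup>+x. ennreal (\<bar>f x\<bar> powr q) \<partial>lebesgue_on \<Omega>) \<le> ennreal (C powr q)"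
  shows "f \<in> Lp q \<Omega>" "Lp_norm q \<Omega> f \<le> C"
proof -
  have "integrable (lebesgue_on \<Omega>) (\<lambda>x. \<bar>f x\<bar> powr q)"
    using assms by (intro integrableI_nonneg) (auto intro: le_less_trans)
  then show f: "f \<in> Lp q \<Omega>" using assms(3) by (simp add: Lp_def)
  show "Lp_norm q \<Omega> f \<le> C"
    using le nn_integral_Lp[OF assms(1) f] assms
    by (simp add: Lp_norm_le_iff Lp_norm_powr[symmetric])
qed

lemma Lp_zero [simp]: "(\<lambda>x. 0) \<in> Lp q \<Omega>"
  by (simp add: Lp_def)

lemma Lp_norm_zero [simp]: "Lp_norm q \<Omega> (\<lambda>x. 0) = 0"
  by (simp add: Lp_norm_def)

lemma Lp_cmult: "f \<in> Lp q \<Omega> \<Longrightarrow> (\<lambda>x. c * f x) \<in> Lp q \<Omega>"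
  unfolding Lp_def by (auto simp: abs_mult powr_mult)

lemma Lp_add:
  assumes "0 < q" "f \<in> Lp q \<Omega>" "g \<in> Lp q \<Omega>"
  shows "(\<lambda>x. f x + g x) \<in> Lp q \<Omega>"
proof -
  note [measurable] = Lp_measurable[OF assms(2)] Lp_measurable[OF assms(3)]
  have "integrable (lebesgue_on \<Omega>) (\<lambda>x. 2 powr q * (\<bar>f x\<bar> powr q + \<bar>g x\<bar> powr q))"
    using assms by (auto simp: Lp_integrable)
  then have "integrable (lebesgue_on \<Omega>) (\<lambda>x. \<bar>f x + g x\<bar> powr q)"
    by (rule Bochner_Integration.integrable_bound) (use abs_add_powr_le[OF assms(1)] in auto)
  then show ?thesis by (simp add: Lp_def)
qed

lemma Lp_minus: "f \<in> Lp q \<Omega> \<Longrightarrow> (\<lambda>x. - f x) \<in> Lp q \<Omega>"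
  using Lp_cmult[of f q \<Omega> "-1"] by simp

lemma Lp_diff: "0 < q \<Longrightarrow> f \<in> Lp q \<Omega> \<Longrightarrow> g \<in> Lp q \<Omega> \<Longrightarrow> (\<lambda>x. f x - g x) \<in> Lp q \<Omega>"
  using Lp_add[OF _ _ Lp_minus] by fastforce

lemma Lp_sum:
  "0 < q \<Longrightarrow> (\<And>i. i \<in> I \<Longrightarrow> f i \<in> Lp q \<Omega>) \<Longrightarrow> (\<lambda>x. \<Sum>i\<in>I. f i x) \<in> Lp q \<Omega>"
  by (induction I rule: infinite_finite_induct) (auto intro: Lp_add)

lemma Lp_norm_cmult: "Lp_norm q \<Omega> (\<lambda>x. c * f x) = \<bar>c\<bar> * Lp_norm q \<Omega> f" if "0 < q"
  using that by (simp add: Lp_norm_def abs_mult powr_mult powr_powr integral_nonneg_AE)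

lemma Lp_norm_minus_commute: "Lp_norm q \<Omega> (\<lambda>x. f x - g x) = Lp_norm q \<Omega> (\<lambda>x. g x - f x)"
  by (simp add: Lp_norm_def abs_minus_commute)

lemma Lp_cong_AE:
  assumes "f \<in> Lp q \<Omega>" "g \<in> borel_measurable (lebesgue_on \<Omega>)" "AE x in lebesgue_on \<Omega>. f x = g x"
  shows "g \<in> Lp q \<Omega>" "Lp_norm q \<Omega> g = Lp_norm q \<Omega> f"
proof -
  note m [measurable] = Lp_measurable[OF assms(1)] assms(2)
  have ae: "AE x in lebesgue_on \<Omega>. \<bar>f x\<bar> powr q = \<bar>g x\<bar> powr q" using assms(3) by auto
  show "g \<in> Lp q \<Omega>"
    using integrable_cong_AE[OF _ _ ae] Lp_integrable[OF assms(1)] by (auto simp: Lp_def)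
  show "Lp_norm q \<Omega> g = Lp_norm q \<Omega> f"
    unfolding Lp_norm_def using integral_cong_AE[OF _ _ ae] by simp
qed

lemma Lp_norm_eq_0D:
  assumes "0 < q" "f \<in> Lp q \<Omega>" "Lp_norm q \<Omega> f = 0"
  shows "AE x in lebesgue_on \<Omega>. f x = 0"
proof -
  have "(LINT x|lebesgue_on \<Omega>. \<bar>f x\<bar> powr q) = 0"
    using assms by (simp add: Lp_norm_powr[symmetric])
  then have "AE x in lebesgue_on \<Omega>. \<bar>f x\<bar> powr q = 0"
    using Lp_integrable[OF assms(2)] by (subst (asm) integral_nonneg_eq_0_iff_AE) auto
  then show ?thesis by auto
qed

text \<open>Minkowski's inequality by convexity: if A and B exceed the two norms, (f + g) / (A + B)
  is a convex combination of f / A and g / B. Strict excess keeps the divisors positive when a norm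
  is 0, and it is removed at the end.\<close>

lemma Lp_norm_triangle:
  assumes q: "1 \<le> q" and f: "f \<in> Lp q \<Omega>" and g: "g \<in> Lp q \<Omega>"
  shows "Lp_norm q \<Omega> (\<lambda>x. f x + g x) \<le> Lp_norm q \<Omega> f + Lp_norm q \<Omega> g"
proof -
  let ?A = "Lp_norm q \<Omega> f" and ?B = "Lp_norm q \<Omega> g"
  have q0: "0 < q" using q by simp
  have key: "Lp_norm q \<Omega> (\<lambda>x. f x + g x) \<le> A + B" if A: "?A < A" and B: "?B < B" for A B
  proof -
    have pos: "0 < A" "0 < B" using A B Lp_norm_nonneg[of q \<Omega>] by (metis le_less_trans)+
    define t where "t = A / (A + B)"
    have t: "0 \<le> t" "t \<le> 1" "1 - t = B / (A + B)" using pos by (auto simp: t_def field_simps)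
    have pt: "\<bar>f x + g x\<bar> powr q \<le>
        (A + B) powr q * (t * (\<bar>f x\<bar> powr q / A powr q) + (1 - t) * (\<bar>g x\<bar> powr q / B powr q))" for x
    proof -
      have "\<bar>f x + g x\<bar> \<le> (A + B) * (t * (\<bar>f x\<bar> / A) + (1 - t) * (\<bar>g x\<bar> / B))"
        unfolding t(3) using pos by (simp add: t_def distrib_left)
      then have "\<bar>f x + g x\<bar> powr q \<le> ((A + B) * (t * (\<bar>f x\<bar> / A) + (1 - t) * (\<bar>g x\<bar> / B))) powr q"
        using q0 by (intro powr_mono2) auto
      also have "\<dots> = (A + B) powr q * (t * (\<bar>f x\<bar> / A) + (1 - t) * (\<bar>g x\<bar> / B)) powr q"
        by (rule powr_mult)
      also have "\<dots> \<le> (A + B) powr q * (t * (\<bar>f x\<bar> / A) powr q + (1 - t) * (\<bar>g x\<bar> / B) powr q)"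
        using pos t by (intro mult_left_mono powr_convex_combination[OF q]) auto
      finally show ?thesis using pos by (simp add: powr_divide)
    qed
    have "(LINT x|lebesgue_on \<Omega>. \<bar>f x + g x\<bar> powr q) \<le> (LINT x|lebesgue_on \<Omega>.
        (A + B) powr q * (t * (\<bar>f x\<bar> powr q / A powr q) + (1 - t) * (\<bar>g x\<bar> powr q / B powr q)))"
      using Lp_add[OF q0 f g] f g by (intro integral_mono pt) (auto simp: Lp_integrable)
    also have "\<dots> = (A + B) powr q * (t * (?A powr q / A powr q) + (1 - t) * (?B powr q / B powr q))"
      using f g q0 by (simp add: Lp_integrable Lp_norm_powr)
    also have "\<dots> \<le> (A + B) powr q * (t * 1 + (1 - t) * 1)"
      using t A B pos q0
      by (intro mult_left_mono add_mono) (auto simp: divide_le_eq intro!: powr_mono2)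
    finally show ?thesis using q0 pos by (subst Lp_norm_le_iff) auto
  qed
  show ?thesis
  proof (rule field_le_epsilon)
    fix e :: real assume "e > 0"
    then show "Lp_norm q \<Omega> (\<lambda>x. f x + g x) \<le> ?A + ?B + e"
      using key[of "?A + e / 2" "?B + e / 2"] by simp
  qed
qed

lemma Lp_norm_diff_triangle:
  assumes "1 \<le> q" "f \<in> Lp q \<Omega>" "g \<in> Lp q \<Omega>" "h \<in> Lp q \<Omega>"
  shows "Lp_norm q \<Omega> (\<lambda>x. f x - h x) \<le> Lp_norm q \<Omega> (\<lambda>x. f x - g x) + Lp_norm q \<Omega> (\<lambda>x. g x - h x)"
  using Lp_norm_triangle[OF assms(1), of "\<lambda>x. f x - g x" \<Omega> "\<lambda>x. g x - h x"] assms
  by (simp add: Lp_diff)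

lemma Lp_norm_abs_diff_le:
  assumes "1 \<le> q" "f \<in> Lp q \<Omega>" "g \<in> Lp q \<Omega>"
  shows "\<bar>Lp_norm q \<Omega> f - Lp_norm q \<Omega> g\<bar> \<le> Lp_norm q \<Omega> (\<lambda>x. f x - g x)"
  using Lp_norm_diff_triangle[OF assms(1,2,3), of "\<lambda>x. 0"]
    Lp_norm_diff_triangle[OF assms(1,3,2), of "\<lambda>x. 0"]
  by (simp add: Lp_norm_minus_commute[of _ _ g f])

text \<open>Riesz-Fischer. Along a subsequence with increments of norm at most 4^(-k), the q-th
  powers of the increments have summable integrals even after weighting with 2^(kq). Where the
  weighted sum is finite, the increments decay geometrically, so the subsequence converges there.
  Fatou's lemma turns the pointwise limit into a limit in norm.\<close>

lemma Lp_complete: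
  assumes q: "1 \<le> q" and f: "\<And>n. f n \<in> Lp q \<Omega>"
    and cau: "\<And>e. 0 < e \<Longrightarrow> \<exists>N. \<forall>m\<ge>N. \<forall>n\<ge>N. Lp_norm q \<Omega> (\<lambda>x. f m x - f n x) \<le> e"
  obtains g where "g \<in> Lp q \<Omega>" "(\<lambda>n::nat. Lp_norm q \<Omega> (\<lambda>x. f n x - g x)) \<longlonglongrightarrow> 0"
proof -
  have q0: "0 < q" using q by simp
  note [measurable] = Lp_measurable[OF f]
  obtain N where N: "\<And>k m n. m \<ge> N k \<Longrightarrow> n \<ge> N k \<Longrightarrow> Lp_norm q \<Omega> (\<lambda>x. f m x - f n x) \<le> (1/4) ^ k"
    using cau[of "(1/4) ^ k" for k] by (metis zero_less_power zero_less_divide_1_iff zero_less_numeral)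
  \<comment> \<open>The sum makes r nondecreasing and at least \<open>N k\<close>; the added k makes
    it tend to infinity.\<close>
  define r where "r k = (\<Sum>i\<le>k. N i) + k" for k
  have rN: "N k \<le> r k" "r k \<le> r (Suc k)" "k \<le> r k" for k
    using member_le_sum[of k "{..k}" N] by (auto simp: r_def)
  define d where "d k x = \<bar>f (r (Suc k)) x - f (r k) x\<bar>" for k x
  have [measurable]: "d k \<in> borel_measurable (lebesgue_on \<Omega>)" for k
    unfolding d_def by measurable
  have dint: "(\<integral>\<^sup>+x. ennreal ((2 powr q) ^ k * d k x powr q) \<partial>lebesgue_on \<Omega>) \<le> ennreal (((1/2) powr q) ^ k)" for k
  proof -
    have "Lp_norm q \<Omega> (\<lambda>x. f (r (Suc k)) x - f (r k) x) \<le> (1/4) ^ k"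
      using rN(1)[of k] rN(2)[of k] by (intro N) auto
    then have "Lp_norm q \<Omega> (\<lambda>x. f (r (Suc k)) x - f (r k) x) powr q \<le> ((1/4) ^ k) powr q"
      using q0 by (intro powr_mono2) auto
    also have "\<dots> = ((1/4) powr q) ^ k"
      by (simp add: powr_power powr_realpow[symmetric] powr_powr mult.commute)
    finally have "(2 powr q) ^ k * Lp_norm q \<Omega> (\<lambda>x. f (r (Suc k)) x - f (r k) x) powr q \<le>
      (2 powr q) ^ k * ((1/4) powr q) ^ k" by (intro mult_left_mono) auto
    also have "\<dots> = ((1/2) powr q) ^ k"
      by (simp add: power_mult_distrib[symmetric] powr_mult[symmetric])
    finally have le: "(2 powr q) ^ k * Lp_norm q \<Omega> (\<lambda>x. f (r (Suc k)) x - f (r k) x) powr q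
      \<le> ((1/2) powr q) ^ k" .
    have "(\<integral>\<^sup>+x. ennreal ((2 powr q) ^ k * d k x powr q) \<partial>lebesgue_on \<Omega>) =
        ennreal ((2 powr q) ^ k) * (\<integral>\<^sup>+x. ennreal (d k x powr q) \<partial>lebesgue_on \<Omega>)"
      by (subst ennreal_mult) (auto intro!: nn_integral_cmult)
    also have "(\<integral>\<^sup>+x. ennreal (d k x powr q) \<partial>lebesgue_on \<Omega>) =
        ennreal (Lp_norm q \<Omega> (\<lambda>x. f (r (Suc k)) x - f (r k) x) powr q)"
      unfolding d_def by (rule nn_integral_Lp[OF q0 Lp_diff[OF q0 f f]])
    finally show ?thesis
      using le by (subst (asm) ennreal_mult[symmetric]) (auto intro: ennreal_leI)
  qed
  have "(\<integral>\<^sup>+x. (\<Sum>k. ennreal ((2 powr q) ^ k * d k x powr q)) \<partial>lebesgue_on \<Omega>) =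
        (\<Sum>k. (\<integral>\<^sup>+x. ennreal ((2 powr q) ^ k * d k x powr q) \<partial>lebesgue_on \<Omega>))"
    by (rule nn_integral_suminf) auto
  also have "\<dots> \<le> (\<Sum>k. ennreal (((1/2) powr q) ^ k))"
    by (intro suminf_le dint) auto
  also have "\<dots> < \<infinity>"
  proof -
    have "(1/2) powr q < 1" using q0 powr_less_mono2[of q "1/2" 1] by simp
    then show ?thesis by (subst suminf_ennreal2) (auto intro!: summable_geometric)
  qed
  finally have "AE x in lebesgue_on \<Omega>. (\<Sum>k. ennreal ((2 powr q) ^ k * d k x powr q)) \<noteq> \<infinity>"
    by (intro nn_integral_noteq_infinite) auto
  then have conv: "AE x in lebesgue_on \<Omega>. (\<lambda>k. f (r k) x) \<longlonglongrightarrow> lim (\<lambda>k. f (r k) x)"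
  proof (rule AE_mp, intro AE_I2 impI)
    fix x assume fin: "(\<Sum>k. ennreal ((2 powr q) ^ k * d k x powr q)) \<noteq> \<infinity>"
    define F where "F k = ennreal ((2 powr q) ^ k * d k x powr q)" for k
    obtain C where C: "C \<ge> 0" "suminf F = ennreal C"
      using fin unfolding F_def[symmetric] by (cases "suminf F" rule: ennreal_cases) auto
    have d0: "0 \<le> d k x" for k by (simp add: d_def)
    have "d k x \<le> C powr (1 / q) * (1/2) ^ k" for k
    proof -
      have "ennreal ((2 powr q) ^ k * d k x powr q) \<le> ennreal C"
        using sum_le_suminf[OF summableI, of "{k}" F] unfolding C(2) F_def by simp
      then have "(2 powr q) ^ k * d k x powr q \<le> C" using C(1) by (simp add: ennreal_le_iff)
      also have "(2 powr q) ^ k * d k x powr q = (2 ^ k * d k x) powr q"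
        by (simp add: powr_mult powr_power powr_realpow[symmetric] powr_powr mult.commute)
      finally have "((2 ^ k * d k x) powr q) powr (1 / q) \<le> C powr (1 / q)"
        using q0 by (intro powr_mono2) auto
      then have "2 ^ k * d k x \<le> C powr (1 / q)"
        using q0 d0[of k] by (simp add: powr_powr)
      then show ?thesis by (simp add: field_simps)
    qed
    then have "summable (\<lambda>k. d k x)"
      using d0 by (intro summable_comparison_test'[OF summable_mult[OF summable_geometric[of "1/2"]],
            of 0 _ "C powr (1 / q)"]) auto
    then have "summable (\<lambda>k. f (r (Suc k)) x - f (r k) x)"
      unfolding d_def by (rule summable_rabs_cancel)
    then have "convergent (\<lambda>n. (f (r n) x - f (r 0) x) + f (r 0) x)"
      unfolding summable_iff_convergent sum_lessThan_telescope[of "\<lambda>k. f (r k) x"]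
      by (rule convergent_add[OF _ convergent_const])
    then have "convergent (\<lambda>k. f (r k) x)" by simp
    then show "(\<lambda>k. f (r k) x) \<longlonglongrightarrow> lim (\<lambda>k. f (r k) x)" by (simp add: convergent_LIMSEQ_iff)
  qed
  define g where "g x = lim (\<lambda>k. f (r k) x)" for x
  have gm [measurable]: "g \<in> borel_measurable (lebesgue_on \<Omega>)" unfolding g_def by measurable
  \<comment> \<open>Fatou's lemma compares a fixed \<open>f n\<close> with the subsequence, so the
    estimate holds for every large n and not only along the subsequence.\<close>
  have bound: "(\<lambda>x. f n x - g x) \<in> Lp q \<Omega> \<and> Lp_norm q \<Omega> (\<lambda>x. f n x - g x) \<le> e"
    if e: "e > 0" and n: "\<forall>m\<ge>K. \<forall>n\<ge>K. Lp_norm q \<Omega> (\<lambda>x. f m x - f n x) \<le> e" "n \<ge> K" for e n K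
  proof -
    have "(\<integral>\<^sup>+x. ennreal (\<bar>f n x - g x\<bar> powr q) \<partial>lebesgue_on \<Omega>) =
        (\<integral>\<^sup>+x. liminf (\<lambda>k. ennreal (\<bar>f n x - f (r k) x\<bar> powr q)) \<partial>lebesgue_on \<Omega>)"
    proof (rule nn_integral_cong_AE, use conv in eventually_elim)
      fix x assume "(\<lambda>k. f (r k) x) \<longlonglongrightarrow> lim (\<lambda>k. f (r k) x)"
      then have "(\<lambda>k. ennreal (\<bar>f n x - f (r k) x\<bar> powr q)) \<longlonglongrightarrow> ennreal (\<bar>f n x - g x\<bar> powr q)"
        unfolding g_def using q0
        by (intro tendsto_ennrealI tendsto_powr2 tendsto_intros) auto
      then show "ennreal (\<bar>f n x - g x\<bar> powr q) = liminf (\<lambda>k. ennreal (\<bar>f n x - f (r k) x\<bar> powr q))"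
        by (metis lim_imp_Liminf sequentially_bot)
    qed
    also have "\<dots> \<le> liminf (\<lambda>k. \<integral>\<^sup>+x. ennreal (\<bar>f n x - f (r k) x\<bar> powr q) \<partial>lebesgue_on \<Omega>)"
      by (rule nn_integral_liminf) auto
    also have "\<dots> \<le> Liminf sequentially (\<lambda>k. ennreal (e powr q))"
    proof (rule Liminf_mono)
      have "\<forall>\<^sub>F k in sequentially. K \<le> k" by simp
      then show "\<forall>\<^sub>F k in sequentially. (\<integral>\<^sup>+x. ennreal (\<bar>f n x - f (r k) x\<bar> powr q) \<partial>lebesgue_on \<Omega>) \<le> ennreal (e powr q)"
      proof eventually_elim
        case (elim k)
        have "Lp_norm q \<Omega> (\<lambda>x. f n x - f (r k) x) \<le> e" using n elim rN(3)[of k] by auto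
        then show ?case
          using nn_integral_Lp[OF q0 Lp_diff[OF q0 f f], of n "r k"] q0
          by (auto intro!: ennreal_leI powr_mono2)
      qed
    qed
    also have "\<dots> = ennreal (e powr q)" by (simp add: Liminf_const)
    finally show ?thesis using Lp_memI[OF q0 _ _ , of e "\<lambda>x. f n x - g x" \<Omega>] e by auto
  qed
  show thesis
  proof
    obtain K where K: "\<forall>m\<ge>K. \<forall>n\<ge>K. Lp_norm q \<Omega> (\<lambda>x. f m x - f n x) \<le> 1"
      using cau[of 1] by auto
    have "(\<lambda>x. f K x - (f K x - g x)) \<in> Lp q \<Omega>"
      by (rule Lp_diff[OF q0 f conjunct1[OF bound[OF zero_less_one K order_refl]]])
    then show "g \<in> Lp q \<Omega>" by simp
    show "(\<lambda>n. Lp_norm q \<Omega> (\<lambda>x. f n x - g x)) \<longlonglongrightarrow> 0"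
    proof (rule LIMSEQ_I)
      fix e :: real assume "e > 0"
      then obtain K where K: "\<forall>m\<ge>K. \<forall>n\<ge>K. Lp_norm q \<Omega> (\<lambda>x. f m x - f n x) \<le> e / 2"
        using cau[of "e / 2"] by auto
      then show "\<exists>no. \<forall>n\<ge>no. norm (Lp_norm q \<Omega> (\<lambda>x. f n x - g x) - 0) < e"
        using bound[OF _ K] \<open>e > 0\<close> by (intro exI[of _ K]) force
    qed
  qed
qed

subsection \<open>The inner product\<close>

lemma Lp2_norm_sq: "(Lp_norm 2 \<Omega> f)\<^sup>2 = L2_inner \<Omega> f f"
  using Lp_norm_powr[of 2 \<Omega> f] by (simp add: L2_inner_def power2_eq_square)

lemma Lp2_integrable_sq: "f \<in> Lp 2 \<Omega> \<Longrightarrow> integrable (lebesgue_on \<Omega>) (\<lambda>x. (f x)\<^sup>2)"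
  using Lp_integrable[of f 2 \<Omega>] by simp

lemma Lp2_integrable_mult:
  assumes "f \<in> Lp 2 \<Omega>" "g \<in> Lp 2 \<Omega>"
  shows "integrable (lebesgue_on \<Omega>) (\<lambda>x. f x * g x)"
proof (rule Bochner_Integration.integrable_bound)
  show "integrable (lebesgue_on \<Omega>) (\<lambda>x. (f x)\<^sup>2 + (g x)\<^sup>2)"
    using assms by (auto intro: Lp2_integrable_sq)
  show "(\<lambda>x. f x * g x) \<in> borel_measurable (lebesgue_on \<Omega>)"
    using Lp_measurable[OF assms(1)] Lp_measurable[OF assms(2)] by measurable
  have "\<bar>a * b\<bar> \<le> a\<^sup>2 + b\<^sup>2" for a b :: real
  proof -
    have "2 * \<bar>a * b\<bar> \<le> a\<^sup>2 + b\<^sup>2"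
      using sum_squares_bound[of "\<bar>a\<bar>" "\<bar>b\<bar>"] by (simp add: abs_mult)
    then show ?thesis using abs_ge_zero[of "a * b"] by linarith
  qed
  then show "AE x in lebesgue_on \<Omega>. norm (f x * g x) \<le> norm ((f x)\<^sup>2 + (g x)\<^sup>2)"
    by auto
qed

lemma L2_inner_commute: "L2_inner \<Omega> f g = L2_inner \<Omega> g f"
  by (simp add: L2_inner_def mult.commute)

lemma L2_inner_diff_left:
  "f \<in> Lp 2 \<Omega> \<Longrightarrow> g \<in> Lp 2 \<Omega> \<Longrightarrow> h \<in> Lp 2 \<Omega> \<Longrightarrow>
   L2_inner \<Omega> (\<lambda>x. f x - g x) h = L2_inner \<Omega> f h - L2_inner \<Omega> g h"
  unfolding L2_inner_def by (simp add: left_diff_distrib Lp2_integrable_mult)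

lemma L2_inner_add_left:
  "f \<in> Lp 2 \<Omega> \<Longrightarrow> g \<in> Lp 2 \<Omega> \<Longrightarrow> h \<in> Lp 2 \<Omega> \<Longrightarrow>
   L2_inner \<Omega> (\<lambda>x. f x + g x) h = L2_inner \<Omega> f h + L2_inner \<Omega> g h"
  unfolding L2_inner_def by (simp add: distrib_right Lp2_integrable_mult)

lemma L2_inner_cmult_left: "L2_inner \<Omega> (\<lambda>x. c * f x) h = c * L2_inner \<Omega> f h"
  unfolding L2_inner_def by (simp add: mult.assoc)

lemma L2_inner_sum_left:
  assumes "\<And>i. i \<in> I \<Longrightarrow> f i \<in> Lp 2 \<Omega>" "h \<in> Lp 2 \<Omega>"
  shows "L2_inner \<Omega> (\<lambda>x. \<Sum>i\<in>I. f i x) h = (\<Sum>i\<in>I. L2_inner \<Omega> (f i) h)"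
  unfolding L2_inner_def sum_distrib_right
  by (rule Bochner_Integration.integral_sum) (use assms Lp2_integrable_mult in auto)

text \<open>Read off from Minkowski's inequality: expand the square of the norm of f + c g and
  compare it with the square of |f| + |c| |g| for c = 1 and c = -1.\<close>

lemma L2_Cauchy_Schwarz:
  assumes f: "f \<in> Lp 2 \<Omega>" and g: "g \<in> Lp 2 \<Omega>"
  shows "\<bar>L2_inner \<Omega> f g\<bar> \<le> Lp_norm 2 \<Omega> f * Lp_norm 2 \<Omega> g"
proof -
  have tri: "Lp_norm 2 \<Omega> (\<lambda>x. f x + c * g x) \<le> Lp_norm 2 \<Omega> f + \<bar>c\<bar> * Lp_norm 2 \<Omega> g" for c
    using Lp_norm_triangle[OF _ f Lp_cmult[OF g, of c]] Lp_norm_cmult[of 2 \<Omega> c g] by simp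
  have exp: "(Lp_norm 2 \<Omega> (\<lambda>x. f x + c * g x))\<^sup>2 =
      (Lp_norm 2 \<Omega> f)\<^sup>2 + 2 * c * L2_inner \<Omega> f g + c\<^sup>2 * (Lp_norm 2 \<Omega> g)\<^sup>2" for c
  proof -
    have "L2_inner \<Omega> (\<lambda>x. f x + c * g x) (\<lambda>x. f x + c * g x) =
      (LINT x|lebesgue_on \<Omega>. f x * f x + 2 * c * (f x * g x) + c\<^sup>2 * (g x * g x))"
      unfolding L2_inner_def
      by (rule Bochner_Integration.integral_cong) (auto simp: algebra_simps power2_eq_square)
    then show ?thesis
      unfolding Lp2_norm_sq by (simp add: L2_inner_def Lp2_integrable_mult f g)
  qed
  have "c * L2_inner \<Omega> f g \<le> \<bar>c\<bar> * (Lp_norm 2 \<Omega> f * Lp_norm 2 \<Omega> g)" for c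
  proof -
    have "(Lp_norm 2 \<Omega> (\<lambda>x. f x + c * g x))\<^sup>2 \<le> (Lp_norm 2 \<Omega> f + \<bar>c\<bar> * Lp_norm 2 \<Omega> g)\<^sup>2"
      by (rule power_mono[OF tri]) simp
    then show ?thesis unfolding exp by (simp add: power2_sum power_mult_distrib algebra_simps)
  qed
  from this[of 1] this[of "-1"] show ?thesis by simp
qed

lemma L2_inner_tendsto_eventually:
  assumes ev: "\<forall>\<^sub>F n in F. h n \<in> Lp 2 \<Omega>" and h': "h' \<in> Lp 2 \<Omega>" and y: "y \<in> Lp 2 \<Omega>"
    and l: "((\<lambda>n. Lp_norm 2 \<Omega> (\<lambda>x. h n x - h' x)) \<longlongrightarrow> 0) F"
  shows "((\<lambda>n. L2_inner \<Omega> (h n) y) \<longlongrightarrow> L2_inner \<Omega> h' y) F"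
proof (rule LIM_zero_cancel, rule Lim_null_comparison)
  show "\<forall>\<^sub>F n in F. norm (L2_inner \<Omega> (h n) y - L2_inner \<Omega> h' y) \<le>
      Lp_norm 2 \<Omega> (\<lambda>x. h n x - h' x) * Lp_norm 2 \<Omega> y"
    using ev
  proof eventually_elim
    case (elim n)
    then show ?case using L2_Cauchy_Schwarz[OF Lp_diff[OF _ elim h'] y] h' y by (simp add: L2_inner_diff_left)
  qed
  show "((\<lambda>n. Lp_norm 2 \<Omega> (\<lambda>x. h n x - h' x) * Lp_norm 2 \<Omega> y) \<longlongrightarrow> 0) F"
    using tendsto_mult_right[OF l] by simp
qed

lemma L2_inner_tendsto:
  assumes "\<And>n. h n \<in> Lp 2 \<Omega>" "h' \<in> Lp 2 \<Omega>" "y \<in> Lp 2 \<Omega>"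
    and "((\<lambda>n. Lp_norm 2 \<Omega> (\<lambda>x. h n x - h' x)) \<longlongrightarrow> 0) F"
  shows "((\<lambda>n. L2_inner \<Omega> (h n) y) \<longlongrightarrow> L2_inner \<Omega> h' y) F"
  using assms by (intro L2_inner_tendsto_eventually always_eventually) auto

subsection \<open>Embedding of higher into lower integrability\<close>

text \<open>Below the threshold e the square is at most e^2. Above it a^2 = |a|^(2 - p) |a|^p, and
  the exponent 2 - p \<le> 0 bounds the first factor. The free parameter e takes the place of
  Hoelder's inequality in the embedding of L^p into L2.\<close>

lemma sq_le_powr:
  fixes a p e :: real
  assumes "2 \<le> p" "0 < e"
  shows "a\<^sup>2 \<le> e\<^sup>2 + e powr (2 - p) * \<bar>a\<bar> powr p"
proof (cases "\<bar>a\<bar> \<le> e")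
  case True
  then have "a\<^sup>2 \<le> e\<^sup>2" using power_mono[of "\<bar>a\<bar>" e 2] by simp
  then show ?thesis by (smt (verit) mult_nonneg_nonneg powr_ge_zero)
next
  case False
  then have "\<bar>a\<bar> powr (2 - p) \<le> e powr (2 - p)" using assms by (intro powr_mono2') auto
  then have "\<bar>a\<bar> powr (2 - p) * \<bar>a\<bar> powr p \<le> e powr (2 - p) * \<bar>a\<bar> powr p"
    by (intro mult_right_mono) auto
  moreover have "\<bar>a\<bar> powr (2 - p) * \<bar>a\<bar> powr p = a\<^sup>2"
    using False assms by (simp add: powr_add[symmetric])
  ultimately show ?thesis by (smt (verit) zero_le_power2)
qed

lemma finite_measure_lebesgue_on:
  assumes "open \<Omega>" "bounded \<Omega>" shows "finite_measure (lebesgue_on \<Omega>)"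
proof
  have "\<Omega> \<in> lmeasurable" using assms by (simp add: lmeasurable_open)
  then have "emeasure lebesgue \<Omega> \<noteq> \<infinity>" "\<Omega> \<in> sets lebesgue"
    by (auto simp del: emeasure_completion dest: fmeasurableD2)
  then show "emeasure (lebesgue_on \<Omega>) (space (lebesgue_on \<Omega>)) \<noteq> \<infinity>"
    by (simp add: emeasure_restrict_space space_restrict_space del: emeasure_completion)
qed

lemma Lp_subset_Lp2:
  assumes "2 \<le> p" "open \<Omega>" "bounded \<Omega>" "f \<in> Lp p \<Omega>"
  shows "f \<in> Lp 2 \<Omega>"
proof -
  interpret finite_measure "lebesgue_on \<Omega>" using assms by (intro finite_measure_lebesgue_on)
  note [measurable] = Lp_measurable[OF assms(4)]
  have "integrable (lebesgue_on \<Omega>) (\<lambda>x. 1\<^sup>2 + 1 powr (2 - p) * \<bar>f x\<bar> powr p)"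
    using assms by (auto simp: Lp_integrable)
  then have "integrable (lebesgue_on \<Omega>) (\<lambda>x. (f x)\<^sup>2)"
    by (rule Bochner_Integration.integrable_bound)
       (use sq_le_powr[OF assms(1), of 1] in \<open>auto intro: order_trans\<close>)
  then show ?thesis by (simp add: Lp_def)
qed

lemma Lp_tendsto_imp_Lp2_tendsto:
  assumes p: "2 \<le> p" and \<Omega>: "open \<Omega>" "bounded \<Omega>" and f: "\<And>n. f n \<in> Lp p \<Omega>"
    and lim: "(\<lambda>n::nat. Lp_norm p \<Omega> (f n)) \<longlonglongrightarrow> 0"
  shows "(\<lambda>n. Lp_norm 2 \<Omega> (f n)) \<longlonglongrightarrow> 0"
proof -
  interpret finite_measure "lebesgue_on \<Omega>" using \<Omega> by (intro finite_measure_lebesgue_on)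
  define m where "m = measure (lebesgue_on \<Omega>) (space (lebesgue_on \<Omega>))"
  have m0: "m \<ge> 0" by (simp add: m_def)
  have f2: "f n \<in> Lp 2 \<Omega>" for n using Lp_subset_Lp2[OF p \<Omega> f] .
  have le: "(Lp_norm 2 \<Omega> (f n))\<^sup>2 \<le> e\<^sup>2 * m + e powr (2 - p) * Lp_norm p \<Omega> (f n) powr p"
    if "e > 0" for e n
  proof -
    have "(Lp_norm 2 \<Omega> (f n))\<^sup>2 = (LINT x|lebesgue_on \<Omega>. (f n x)\<^sup>2)"
      unfolding Lp2_norm_sq by (simp add: L2_inner_def power2_eq_square)
    also have "\<dots> \<le> (LINT x|lebesgue_on \<Omega>. e\<^sup>2 + e powr (2 - p) * \<bar>f n x\<bar> powr p)"
      using sq_le_powr[OF p that] f f2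
      by (intro integral_mono) (auto simp: Lp_integrable Lp2_integrable_sq)
    also have "\<dots> = e\<^sup>2 * m + e powr (2 - p) * Lp_norm p \<Omega> (f n) powr p"
      using p f by (simp add: Lp_integrable Lp_norm_powr m_def)
    finally show ?thesis .
  qed
  have "(\<lambda>n. (Lp_norm 2 \<Omega> (f n))\<^sup>2) \<longlonglongrightarrow> 0"
  proof (rule LIMSEQ_I)
    fix r :: real assume r: "r > 0"
    \<comment> \<open>The constant part e^2 m has to stay below r / 2; dividing by m + 1 covers m =
      0 as well. Only afterwards is n taken large for this e.\<close>
    define e where "e = sqrt (r / (2 * (m + 1)))"
    have e: "e > 0" "e\<^sup>2 * m < r / 2"
    proof -
      have "m \<ge> 0" by (rule m0)
      then show "e > 0" using r by (simp add: e_def)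
      have "e\<^sup>2 * m = r / 2 * (m / (m + 1))" using r \<open>m \<ge> 0\<close> by (simp add: e_def)
      also have "\<dots> < r / 2 * 1" using r \<open>m \<ge> 0\<close> by (intro mult_strict_left_mono) auto
      finally show "e\<^sup>2 * m < r / 2" by simp
    qed
    have "(\<lambda>n. e powr (2 - p) * Lp_norm p \<Omega> (f n) powr p) \<longlonglongrightarrow> e powr (2 - p) * 0 powr p"
      using p lim by (intro tendsto_mult tendsto_const tendsto_powr2) auto
    then have "\<forall>\<^sub>F n in sequentially. e powr (2 - p) * Lp_norm p \<Omega> (f n) powr p < r / 2"
      using r p by (intro order_tendstoD) auto
    then obtain N where "\<forall>n\<ge>N. e powr (2 - p) * Lp_norm p \<Omega> (f n) powr p < r / 2"
      by (auto simp: eventually_sequentially)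
    then show "\<exists>no. \<forall>n\<ge>no. norm ((Lp_norm 2 \<Omega> (f n))\<^sup>2 - 0) < r"
      using le[OF e(1)] e(2) by (intro exI[of _ N]) (auto intro: order_le_less_trans, smt (verit))
  qed
  then have "(\<lambda>n. sqrt ((Lp_norm 2 \<Omega> (f n))\<^sup>2)) \<longlonglongrightarrow> sqrt 0" by (rule tendsto_real_sqrt)
  then show ?thesis by simp
qed

section \<open>Test functions and weak derivatives\<close>

lemma test_functionE:
  assumes "\<phi> \<in> test_functions \<Omega>"
  obtains K where "compact K" "K \<subseteq> \<Omega>" "\<And>x. x \<notin> K \<Longrightarrow> \<phi> x = 0" "smooth \<phi>"
  using assms unfolding test_functions_def by blast

lemma partial_deriv_eq_0_outside:
  assumes "closed K" "\<And>x. x \<notin> K \<Longrightarrow> \<phi> x = 0" "x \<notin> K"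
  shows "partial_deriv b \<phi> x = 0"
proof (rule partial_deriv_eq[where f' = "\<lambda>_. 0", simplified])
  show "(\<phi> has_derivative (\<lambda>_. 0)) (at x)"
    by (rule has_derivative_transform_within_open[of "\<lambda>_. 0" _ _ _ "- K"]) (use assms in auto)
qed

lemma test_function_partial_deriv:
  assumes "\<phi> \<in> test_functions \<Omega>" "b \<in> Basis"
  shows "partial_deriv b \<phi> \<in> test_functions \<Omega>"
proof -
  obtain K where K: "compact K" "K \<subseteq> \<Omega>" "\<And>x. x \<notin> K \<Longrightarrow> \<phi> x = 0" "smooth \<phi>"
    using test_functionE[OF assms(1)] by blast
  have "\<forall>x. x \<notin> K \<longrightarrow> partial_deriv b \<phi> x = 0"
    using partial_deriv_eq_0_outside[OF compact_imp_closed[OF K(1)] K(3)] by simp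
  then show ?thesis
    unfolding test_functions_def using smooth_partial_deriv[OF K(4) assms(2)] K(1,2) by auto
qed

lemma test_function_mult:
  assumes "\<phi> \<in> test_functions \<Omega>" "\<psi> \<in> test_functions \<Omega>"
  shows "(\<lambda>x. \<phi> x * \<psi> x) \<in> test_functions \<Omega>"
proof -
  obtain K where "compact K" "K \<subseteq> \<Omega>" "\<And>x. x \<notin> K \<Longrightarrow> \<phi> x = 0" "smooth \<phi>"
    using test_functionE[OF assms(1)] by blast
  moreover have "smooth \<psi>" using assms(2) by (simp add: test_functions_def)
  ultimately show ?thesis
    unfolding test_functions_def by (auto intro!: smooth_mult exI[of _ K])
qed

lemma test_function_outside: "\<phi> \<in> test_functions \<Omega> \<Longrightarrow> x \<notin> \<Omega> \<Longrightarrow> \<phi> x = 0"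
  by (metis subsetD test_functionE)

lemma test_function_continuous_on: "\<phi> \<in> test_functions \<Omega> \<Longrightarrow> continuous_on S \<phi>"
  using smooth_continuous_on continuous_on_subset unfolding test_functions_def by blast

lemma test_function_measurable:
  "\<phi> \<in> test_functions \<Omega> \<Longrightarrow> \<phi> \<in> borel_measurable borel"
  by (rule borel_measurable_continuous_onI) (rule test_function_continuous_on)

lemma test_function_measurable_lebesgue_on:
  "\<phi> \<in> test_functions \<Omega> \<Longrightarrow> \<phi> \<in> borel_measurable (lebesgue_on S)"
  by (intro measurable_restrict_space1 measurable_completion) (simp add: test_function_measurable)

lemma test_function_bounded:
  assumes "\<phi> \<in> test_functions \<Omega>"
  obtains B where "0 < B" "\<And>x. \<bar>\<phi> x\<bar> \<le> B"
proof -
  obtain K where K: "compact K" "K \<subseteq> \<Omega>" "\<And>x. x \<notin> K \<Longrightarrow> \<phi> x = 0" "smooth \<phi>"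
    using test_functionE[OF assms] by blast
  have "bounded (\<phi> ` K)"
    using K test_function_continuous_on[OF assms] by (intro compact_imp_bounded compact_continuous_image)
  then obtain B where "0 < B" "\<And>x. x \<in> K \<Longrightarrow> \<bar>\<phi> x\<bar> \<le> B"
    unfolding bounded_pos by auto
  with K(3) show thesis by (intro that[of B]) (fastforce, metis abs_zero less_imp_le)
qed

lemma test_function_Lp:
  assumes "\<phi> \<in> test_functions \<Omega>" "0 < q" "\<Omega> \<in> sets lebesgue"
  shows "\<phi> \<in> Lp q \<Omega>"
proof -
  obtain K where K: "compact K" "K \<subseteq> \<Omega>" "\<And>x. x \<notin> K \<Longrightarrow> \<phi> x = 0" "smooth \<phi>"
    using test_functionE[OF assms(1)] by blast
  obtain B where B: "0 < B" "\<And>x. \<bar>\<phi> x\<bar> \<le> B" using test_function_bounded[OF assms(1)] by blast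
  note [measurable] = test_function_measurable_lebesgue_on[OF assms(1), of \<Omega>]
  have Ks: "K \<in> sets (lebesgue_on \<Omega>)"
    using K assms(3) by (auto simp: sets_restrict_space_iff compact_imp_closed)
  have "integrable (lebesgue_on \<Omega>) (\<lambda>x. \<bar>\<phi> x\<bar> powr q)"
  proof (rule integrableI_bounded_set[OF Ks])
    have "emeasure (lebesgue_on \<Omega>) K = emeasure lborel K"
      using K assms(3) by (subst emeasure_restrict_space) (auto simp: compact_imp_closed)
    then show "emeasure (lebesgue_on \<Omega>) K < \<infinity>"
      using emeasure_bounded_finite[OF compact_imp_bounded[OF K(1)]] by simp
    show "AE x in lebesgue_on \<Omega>. x \<in> K \<longrightarrow> norm (\<bar>\<phi> x\<bar> powr q) \<le> B powr q"
      using B assms(2) by (intro AE_I2) (auto intro!: powr_mono2)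
  qed (use K in auto)
  then show ?thesis by (simp add: Lp_def)
qed

section \<open>Integration by parts for test functions\<close>

lemma partial_deriv_mult:
  assumes "smooth \<phi>" "smooth \<psi>"
  shows "partial_deriv b (\<lambda>x. \<phi> x * \<psi> x) x = \<phi> x * partial_deriv b \<psi> x + partial_deriv b \<phi> x * \<psi> x"
proof -
  have "((\<lambda>x. \<phi> x * \<psi> x) has_derivative
      (\<lambda>h. \<phi> x * frechet_derivative \<psi> (at x) h + frechet_derivative \<phi> (at x) h * \<psi> x)) (at x)"
    by (intro has_derivative_mult smooth_has_derivative assms)
  then show ?thesis
    by (subst partial_deriv_eq) (auto simp: partial_deriv_def)
qed

lemma smooth_has_real_derivative_line:
  assumes "smooth \<phi>"
  shows "((\<lambda>s. \<phi> (x + s *\<^sub>R b)) has_real_derivative partial_deriv b \<phi> (x + s *\<^sub>R b)) (at s)"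
proof -
  have d: "(\<phi> has_derivative frechet_derivative \<phi> (at (x + s *\<^sub>R b))) (at (x + s *\<^sub>R b))"
    using assms by (rule smooth_has_derivative)
  then have "linear (frechet_derivative \<phi> (at (x + s *\<^sub>R b)))"
    by (rule has_derivative_linear)
  moreover have e: "((\<lambda>s. x + s *\<^sub>R b) has_derivative (\<lambda>h. h *\<^sub>R b)) (at s)"
    by (auto intro!: derivative_eq_intros)
  have "((\<lambda>s. \<phi> (x + s *\<^sub>R b)) has_derivative
      (\<lambda>h. frechet_derivative \<phi> (at (x + s *\<^sub>R b)) (h *\<^sub>R b))) (at s)"
    using has_derivative_compose[OF e, of \<phi> "frechet_derivative \<phi> (at (x + s *\<^sub>R b))"] d by simp
  ultimately show ?thesis
    by (simp add: has_field_derivative_def partial_deriv_def linear_scale mult_commute_abs)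
qed

lemma integral_lborel_translate:
  fixes f :: "'a::euclidean_space \<Rightarrow> real"
  assumes "f \<in> borel_measurable borel"
  shows "(LINT x|lborel. f (x + c)) = integral\<^sup>L lborel f"
proof -
  have "integral\<^sup>L lborel f = integral\<^sup>L (distr lborel borel ((+) c)) f"
    by (simp add: lborel_distr_plus)
  also have "\<dots> = (LINT x|lborel. f (c + x))"
    using assms by (subst integral_distr) auto
  finally show ?thesis by (simp add: add.commute)
qed

lemma nn_integral_lborel_translate:
  assumes "f \<in> borel_measurable borel"
  shows "(\<integral>\<^sup>+x. f (x + c) \<partial>lborel) = integral\<^sup>N (lborel :: 'a::euclidean_space measure) f"
proof -
  have "integral\<^sup>N lborel f = integral\<^sup>N (distr lborel borel ((+) c)) f"
    by (simp add: lborel_distr_plus)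
  also have "\<dots> = (\<integral>\<^sup>+x. f (c + x) \<partial>lborel)"
    using assms by (subst nn_integral_distr) auto
  finally show ?thesis by (simp add: add.commute)
qed

lemma test_function_integrable_lborel:
  fixes \<Omega> :: "'a::euclidean_space set"
  assumes "\<phi> \<in> test_functions \<Omega>" shows "integrable lborel \<phi>"
proof -
  have "\<phi> \<in> test_functions UNIV" using assms unfolding test_functions_def by blast
  then have "\<phi> \<in> Lp 1 UNIV" by (intro test_function_Lp) auto
  then have "integrable lebesgue (\<lambda>x. \<bar>\<phi> x\<bar>)"
    using Lp_integrable[of \<phi> 1 UNIV] by (simp add: lebesgue_on_UNIV_eq)
  then have "integrable lborel (\<lambda>x. \<bar>\<phi> x\<bar>)"
    using test_function_measurable[OF assms] by (simp add: integrable_completion)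
  then show ?thesis using test_function_measurable[OF assms] by (simp add: integrable_abs_iff)
qed

text \<open>Differentiate the translation invariance of the integral.\<close>

lemma integral_partial_deriv_test_function:
  fixes \<Omega> :: "'a::euclidean_space set"
  assumes F: "F \<in> test_functions \<Omega>" and b: "b \<in> Basis"
  shows "(LINT x|lborel. partial_deriv b F x) = 0"
proof -
  obtain K where K: "compact K" "K \<subseteq> \<Omega>" "\<And>x. x \<notin> K \<Longrightarrow> F x = 0" and s: "smooth F"
    using test_functionE[OF F] by blast
  have dF: "partial_deriv b F \<in> test_functions \<Omega>" using F b by (rule test_function_partial_deriv)
  obtain C where C: "0 < C" "\<And>x. \<bar>partial_deriv b F x\<bar> \<le> C" using test_function_bounded[OF dF] by blast
  obtain R where R: "\<And>x. x \<in> K \<Longrightarrow> norm x \<le> R" using compact_imp_bounded[OF K(1)] by (auto simp: bounded_iff)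
  note [measurable] = test_function_measurable[OF F] test_function_measurable[OF dF]
  let ?s = "\<lambda>n x. (F (x + inverse (real (Suc n)) *\<^sub>R b) - F x) / inverse (real (Suc n))"
  have Fi: "integrable lborel F" using F by (rule test_function_integrable_lborel)
  have z: "integral\<^sup>L lborel (?s n) = 0" for n
  proof -
    define c where "c = inverse (real (Suc n)) *\<^sub>R b"
    have "integrable lborel (\<lambda>x. F (x + c))"
      using Fi lborel_distr_plus[of c] integrable_distr_eq[of "(+) c" lborel borel F]
      by (simp add: add.commute)
    then have "(LINT x|lborel. F (x + c) - F x) = 0"
      using Fi integral_lborel_translate[of F c] by simp
    then show ?thesis by (simp add: c_def)
  qed
  have "(\<lambda>n. integral\<^sup>L lborel (?s n)) \<longlonglongrightarrow> (LINT x|lborel. partial_deriv b F x)"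
  \<comment> \<open>K lies in the ball of radius R and the shifts have length at most 1, so all
    difference quotients vanish outside \<open>cball 0 (R + 1)\<close>. Inside, the mean value
    theorem bounds them by C.\<close>
  proof (rule integral_dominated_convergence[where w = "\<lambda>x. C * indicator (cball 0 (R + 1)) x"])
    show "integrable lborel (\<lambda>x::'a. C * indicator (cball 0 (R + 1)) x)"
      using emeasure_bounded_finite[OF bounded_cball[of "0::'a" "R + 1"]]
      by (intro integrable_mult_right integrable_real_indicator) auto
    show "AE x in lborel. (\<lambda>n. ?s n x) \<longlonglongrightarrow> partial_deriv b F x"
    proof (rule AE_I2)
      fix x
      have "((\<lambda>s. F (x + s *\<^sub>R b)) has_real_derivative partial_deriv b F (x + 0 *\<^sub>R b)) (at 0)"
        by (rule smooth_has_real_derivative_line[OF s])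
      then have "((\<lambda>h. (F (x + h *\<^sub>R b) - F x) / h) \<longlongrightarrow> partial_deriv b F x) (at 0)"
        by (simp add: DERIV_def)
      moreover have "filterlim (\<lambda>n. inverse (real (Suc n))) (at 0) sequentially"
        unfolding filterlim_at using LIMSEQ_inverse_real_of_nat by simp
      ultimately show "(\<lambda>n. ?s n x) \<longlonglongrightarrow> partial_deriv b F x"
        by (rule filterlim_compose)
    qed
    fix n
    define h where "h = inverse (real (Suc n))"
    have h: "0 < h" "h \<le> 1" by (auto simp: h_def inverse_le_1_iff)
    show "AE x in lborel. norm (?s n x) \<le> C * indicator (cball 0 (R + 1)) x"
      unfolding h_def[symmetric]
    proof (rule AE_I2)
      fix x
      show "norm ((F (x + h *\<^sub>R b) - F x) / h) \<le> C * indicator (cball 0 (R + 1)) x"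
      proof (cases "x \<in> cball 0 (R + 1)")
        case True
        obtain z where "F (x + h *\<^sub>R b) - F (x + 0 *\<^sub>R b) = (h - 0) * partial_deriv b F (x + z *\<^sub>R b)"
          using MVT2[OF h(1) smooth_has_real_derivative_line[OF s]] by blast
        then have "norm ((F (x + h *\<^sub>R b) - F x) / h) = \<bar>partial_deriv b F (x + z *\<^sub>R b)\<bar>"
          using h by simp
        then show ?thesis using C True by simp
      next
        case False
        then have "norm x > R + 1" by simp
        moreover have "norm x \<le> norm (x + h *\<^sub>R b) + 1"
          using norm_triangle_ineq4[of "x + h *\<^sub>R b" "h *\<^sub>R b"] b h by simp
        ultimately have "x \<notin> K" "x + h *\<^sub>R b \<notin> K" using R by force+
        then show ?thesis using K(3) False by simp
      qed
    qed
  qed auto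
  then show ?thesis unfolding z by (simp add: LIMSEQ_const_iff)
qed

lemma integral_lebesgue_on_eq_lborel:
  fixes f :: "'a::euclidean_space \<Rightarrow> real"
  assumes "S \<in> sets lebesgue" "f \<in> borel_measurable borel" "\<And>x. x \<notin> S \<Longrightarrow> f x = 0"
  shows "integral\<^sup>L (lebesgue_on S) f = integral\<^sup>L lborel f"
proof -
  have "integral\<^sup>L (lebesgue_on S) f = (LINT x|lebesgue. indicator S x *\<^sub>R f x)"
    using assms by (subst integral_restrict_space) auto
  also have "(\<lambda>x. indicator S x *\<^sub>R f x) = f" using assms(3) by (auto simp: indicator_def fun_eq_iff)
  also have "integral\<^sup>L lebesgue f = integral\<^sup>L lborel f" using assms(2) by (simp add: integral_completion)
  finally show ?thesis .
qed

text \<open>Lebesgue measure is complete, so measurability passes to every representative, in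
  particular to the one that \<open>weak_partial\<close> selects.\<close>

lemma borel_measurable_lebesgue_on_cong_AE:
  fixes f g :: "'a::euclidean_space \<Rightarrow> real"
  assumes "S \<in> sets lebesgue" "f \<in> borel_measurable (lebesgue_on S)" "AE x in lebesgue_on S. f x = g x"
  shows "g \<in> borel_measurable (lebesgue_on S)"
proof -
  have "AE x in lebesgue. (if x \<in> S then f x else 0) = (if x \<in> S then g x else 0)"
    using assms by (auto simp: AE_restrict_space_iff elim!: eventually_mono)
  then have "(\<lambda>x. if x \<in> S then g x else 0) \<in> borel_measurable lebesgue"
    by (rule borel_measurable_AE[rotated]) (use assms borel_measurable_if in blast)
  then show ?thesis by (rule borel_measurable_if_D)
qed

section \<open>Weak partial derivatives on an open set\<close>

context
  fixes \<Omega> :: "'a::euclidean_space set"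
  assumes \<Omega>: "open \<Omega>"
begin

lemma open_sets_lebesgue: "\<Omega> \<in> sets lebesgue"
  using \<Omega> by auto

lemma locally_integrable_mult_test_function:
  assumes f: "locally_integrable \<Omega> f" and \<phi>: "\<phi> \<in> test_functions \<Omega>"
  shows "integrable (lebesgue_on \<Omega>) (\<lambda>x. f x * \<phi> x)"
proof -
  obtain K where K: "compact K" "K \<subseteq> \<Omega>" "\<And>x. x \<notin> K \<Longrightarrow> \<phi> x = 0" "smooth \<phi>"
    using test_functionE[OF \<phi>] by blast
  obtain B where B: "0 < B" "\<And>x. \<bar>\<phi> x\<bar> \<le> B" using test_function_bounded[OF \<phi>] by blast
  have fi: "integrable lebesgue (\<lambda>x. indicator K x *\<^sub>R f x)"
    using f K unfolding locally_integrable_def set_integrable_def by blast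
  have m: "\<phi> \<in> borel_measurable lebesgue"
    using test_function_measurable_lebesgue_on[OF \<phi>, of UNIV] by (simp add: lebesgue_on_UNIV_eq)
  have eq: "indicator \<Omega> x *\<^sub>R (f x * \<phi> x) = (indicator K x *\<^sub>R f x) * \<phi> x" for x
    using K by (cases "x \<in> K") (auto simp: indicator_def)
  have "integrable lebesgue (\<lambda>x. (indicator K x *\<^sub>R f x) * \<phi> x)"
  proof (rule Bochner_Integration.integrable_bound)
    show "integrable lebesgue (\<lambda>x. B * (indicator K x *\<^sub>R f x))" using fi by (rule integrable_mult_right)
    show "(\<lambda>x. (indicator K x *\<^sub>R f x) * \<phi> x) \<in> borel_measurable lebesgue"
      using fi m by (intro borel_measurable_times borel_measurable_integrable[OF fi])
    show "AE x in lebesgue. norm (indicator K x *\<^sub>R f x * \<phi> x) \<le> norm (B * indicator K x *\<^sub>R f x)"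
    proof (rule AE_I2)
      fix x
      have "norm (indicator K x *\<^sub>R f x * \<phi> x) = \<bar>indicator K x * f x\<bar> * \<bar>\<phi> x\<bar>"
        by (simp add: abs_mult)
      also have "\<dots> \<le> \<bar>indicator K x * f x\<bar> * B" by (rule mult_left_mono[OF B(2)]) simp
      finally show "norm (indicator K x *\<^sub>R f x * \<phi> x) \<le> norm (B * indicator K x *\<^sub>R f x)"
        using B(1) by (simp add: abs_mult mult.commute)
    qed
  qed
  then show ?thesis
    using open_sets_lebesgue unfolding eq[symmetric] by (simp add: integrable_restrict_space)
qed

lemma Lp2_locally_integrable:
  assumes f: "f \<in> Lp 2 \<Omega>"
  shows "locally_integrable \<Omega> f"
  unfolding locally_integrable_def set_integrable_def
proof safe
  fix K assume K: "compact K" "K \<subseteq> \<Omega>"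
  have Ks: "K \<in> sets lborel" using K(1) by (simp add: compact_imp_closed)
  have "integrable lborel (indicator K :: 'a \<Rightarrow> real)"
    using emeasure_bounded_finite[OF compact_imp_bounded[OF K(1)]] Ks
    by (intro integrable_real_indicator) auto
  then have 1: "integrable lebesgue (indicator K :: 'a \<Rightarrow> real)"
    using Ks by (subst integrable_completion) auto
  have 2: "integrable lebesgue (\<lambda>x. indicator \<Omega> x *\<^sub>R (f x)\<^sup>2)"
    using Lp2_integrable_sq[OF f] open_sets_lebesgue by (simp add: integrable_restrict_space)
  show "integrable lebesgue (\<lambda>x. indicator K x *\<^sub>R f x)"
  proof (rule Bochner_Integration.integrable_bound)
    show "integrable lebesgue (\<lambda>x. indicator K x + indicator \<Omega> x *\<^sub>R (f x)\<^sup>2)"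
      using 1 2 by (rule Bochner_Integration.integrable_add)
    have "(\<lambda>x. if x \<in> \<Omega> then f x else 0) \<in> borel_measurable lebesgue"
      using Lp_measurable[OF f] open_sets_lebesgue borel_measurable_if by blast
    then have "(\<lambda>x. indicator K x *\<^sub>R (if x \<in> \<Omega> then f x else 0)) \<in> borel_measurable lebesgue"
      using Ks by (intro borel_measurable_scaleR borel_measurable_indicator) auto
    also have "(\<lambda>x. indicator K x *\<^sub>R (if x \<in> \<Omega> then f x else 0)) = (\<lambda>x. indicator K x *\<^sub>R f x)"
      using K by (auto simp: indicator_def fun_eq_iff)
    finally show "(\<lambda>x. indicator K x *\<^sub>R f x) \<in> borel_measurable lebesgue" .
    have "\<bar>a\<bar> \<le> 1 + a\<^sup>2" for a :: real
      using sum_squares_bound[of "\<bar>a\<bar>" 1] by simp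
    then show "AE x in lebesgue. norm (indicator K x *\<^sub>R f x) \<le> norm (indicator K x + indicator \<Omega> x *\<^sub>R (f x)\<^sup>2)"
      using K by (intro AE_I2) (auto simp: indicator_def)
  qed
qed

text \<open>Since \<open>weak_partial\<close> selects a derivative by \<open>SOME\<close>, this
  uniqueness is what links the selected function to a derivative that is known explicitly.\<close>

lemma has_weak_partial_unique:
  assumes "has_weak_partial \<Omega> b f g" "has_weak_partial \<Omega> b f h"
  shows "AE x in lebesgue_on \<Omega>. g x = h x"
proof -
  have g: "locally_integrable \<Omega> g" and h: "locally_integrable \<Omega> h"
    using assms by (auto simp: has_weak_partial_def)
  then have "locally_integrable \<Omega> (\<lambda>x. g x - h x)"
    unfolding locally_integrable_def by (auto intro: set_integral_diff(1))
  moreover have "(LINT x|lebesgue_on \<Omega>. (g x - h x) * \<phi> x) = 0" if "\<phi> \<in> test_functions \<Omega>" for \<phi>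
    using assms that locally_integrable_mult_test_function[OF g that] locally_integrable_mult_test_function[OF h that]
    by (simp add: has_weak_partial_def left_diff_distrib)
  ultimately have "AE x in lebesgue_on \<Omega>. g x - h x = 0"
    by (rule fundamental_lemma_variations[OF \<Omega>])
  then show ?thesis by simp
qed

lemma weak_partial_AE_eq:
  assumes "has_weak_partial \<Omega> b f g"
  shows "AE x in lebesgue_on \<Omega>. weak_partial \<Omega> b f x = g x"
  unfolding weak_partial_def
  by (rule has_weak_partial_unique[OF someI[of "has_weak_partial \<Omega> b f", OF assms] assms])

lemma has_weak_partial_add:
  assumes "has_weak_partial \<Omega> b f g" "has_weak_partial \<Omega> b f' g'" "b \<in> Basis"
  shows "has_weak_partial \<Omega> b (\<lambda>x. f x + f' x) (\<lambda>x. g x + g' x)"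
proof -
  have l: "locally_integrable \<Omega> f" "locally_integrable \<Omega> g" "locally_integrable \<Omega> f'" "locally_integrable \<Omega> g'"
    using assms by (auto simp: has_weak_partial_def)
  then have "locally_integrable \<Omega> (\<lambda>x. f x + f' x)" "locally_integrable \<Omega> (\<lambda>x. g x + g' x)"
    unfolding locally_integrable_def by (auto intro: set_integral_add(1))
  moreover have "(LINT x|lebesgue_on \<Omega>. (f x + f' x) * partial_deriv b \<phi> x) =
    - (LINT x|lebesgue_on \<Omega>. (g x + g' x) * \<phi> x)" if t: "\<phi> \<in> test_functions \<Omega>" for \<phi>
    using assms t l locally_integrable_mult_test_function[OF _ t]
      locally_integrable_mult_test_function[OF _ test_function_partial_deriv[OF t assms(3)]]
    by (simp add: has_weak_partial_def distrib_right)
  ultimately show ?thesis by (simp add: has_weak_partial_def)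
qed

lemma has_weak_partial_cmult:
  assumes "has_weak_partial \<Omega> b f g"
  shows "has_weak_partial \<Omega> b (\<lambda>x. c * f x) (\<lambda>x. c * g x)"
  using assms unfolding has_weak_partial_def locally_integrable_def
  by (auto simp: mult.assoc intro!: set_integrable_mult_right)

text \<open>By the product rule the two integrands add up to the derivative of the test function
  \<phi> \<psi>, and the integral of such a derivative vanishes.\<close>

lemma has_weak_partial_test_function:
  assumes \<phi>: "\<phi> \<in> test_functions \<Omega>" and b: "b \<in> Basis"
  shows "has_weak_partial \<Omega> b \<phi> (partial_deriv b \<phi>)"
  unfolding has_weak_partial_def
proof (intro conjI ballI)
  have d: "partial_deriv b \<phi> \<in> test_functions \<Omega>" using assms by (rule test_function_partial_deriv)
  show l: "locally_integrable \<Omega> \<phi>" "locally_integrable \<Omega> (partial_deriv b \<phi>)"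
    using \<phi> d open_sets_lebesgue by (auto intro!: Lp2_locally_integrable test_function_Lp)
  fix \<psi> assume \<psi>: "\<psi> \<in> test_functions \<Omega>"
  have s: "smooth \<phi>" "smooth \<psi>" using \<phi> \<psi> by (auto simp: test_functions_def)
  have m: "(\<lambda>x. \<phi> x * \<psi> x) \<in> test_functions \<Omega>" using \<phi> \<psi> by (rule test_function_mult)
  have p: "partial_deriv b (\<lambda>x. \<phi> x * \<psi> x) \<in> test_functions \<Omega>" using m b by (rule test_function_partial_deriv)
  have "(LINT x|lebesgue_on \<Omega>. \<phi> x * partial_deriv b \<psi> x + partial_deriv b \<phi> x * \<psi> x) =
      (LINT x|lborel. partial_deriv b (\<lambda>x. \<phi> x * \<psi> x) x)"
    unfolding partial_deriv_mult[OF s, symmetric]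
    by (intro integral_lebesgue_on_eq_lborel open_sets_lebesgue test_function_measurable[OF p] test_function_outside[OF p])
  also have "\<dots> = 0" by (rule integral_partial_deriv_test_function[OF m b])
  finally show "(LINT x|lebesgue_on \<Omega>. \<phi> x * partial_deriv b \<psi> x) = - (LINT x|lebesgue_on \<Omega>. partial_deriv b \<phi> x * \<psi> x)"
    using locally_integrable_mult_test_function[OF l(1) test_function_partial_deriv[OF \<psi> b]]
      locally_integrable_mult_test_function[OF l(2) \<psi>] by simp
qed

text \<open>Both sides of the defining identity are L2 inner products with a fixed function, hence
  continuous under L2 convergence.\<close>

lemma has_weak_partial_closed:
  assumes b: "b \<in> Basis" and w: "\<And>n::nat. has_weak_partial \<Omega> b (f n) (g n)"
    and L: "\<And>n. f n \<in> Lp 2 \<Omega>" "\<And>n. g n \<in> Lp 2 \<Omega>" "f' \<in> Lp 2 \<Omega>" "g' \<in> Lp 2 \<Omega>"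
    and lim: "(\<lambda>n. Lp_norm 2 \<Omega> (\<lambda>x. f n x - f' x)) \<longlonglongrightarrow> 0"
      "(\<lambda>n. Lp_norm 2 \<Omega> (\<lambda>x. g n x - g' x)) \<longlonglongrightarrow> 0"
  shows "has_weak_partial \<Omega> b f' g'"
  unfolding has_weak_partial_def
proof (intro conjI ballI Lp2_locally_integrable L)
  fix \<phi> assume t: "\<phi> \<in> test_functions \<Omega>"
  have t2: "\<phi> \<in> Lp 2 \<Omega>" "partial_deriv b \<phi> \<in> Lp 2 \<Omega>"
    using t test_function_partial_deriv[OF t b] open_sets_lebesgue by (auto intro: test_function_Lp)
  have "L2_inner \<Omega> (f n) (partial_deriv b \<phi>) = - L2_inner \<Omega> (g n) \<phi>" for n
    using w t by (simp add: has_weak_partial_def L2_inner_def)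
  then have "(\<lambda>n. - L2_inner \<Omega> (g n) \<phi>) \<longlonglongrightarrow> L2_inner \<Omega> f' (partial_deriv b \<phi>)"
    using L2_inner_tendsto[OF L(1,3) t2(2) lim(1)] by simp
  moreover have "(\<lambda>n. - L2_inner \<Omega> (g n) \<phi>) \<longlonglongrightarrow> - L2_inner \<Omega> g' \<phi>"
    by (intro tendsto_minus L2_inner_tendsto L t2 lim)
  ultimately show "(LINT x|lebesgue_on \<Omega>. f' x * partial_deriv b \<phi> x) = - (LINT x|lebesgue_on \<Omega>. g' x * \<phi> x)"
    using LIMSEQ_unique unfolding L2_inner_def by blast
qed

end

section \<open>Sobolev spaces\<close>

text \<open>Seen as the Euclidean norm of the L2 norms of the components, the gradient norm inherits
  Cauchy-Schwarz from the scalar case and from \<open>L2_set\<close>.\<close>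

lemma grad_norm_eq_L2_set_Lp_norm:
  assumes "\<And>b. b \<in> Basis \<Longrightarrow> weak_partial \<Omega> b f \<in> Lp 2 \<Omega>"
  shows "grad_norm \<Omega> f = L2_set (\<lambda>b. Lp_norm 2 \<Omega> (weak_partial \<Omega> b f)) Basis"
  unfolding grad_norm_def L2_set_def Lp2_norm_sq L2_inner_def
  using assms by (subst Bochner_Integration.integral_sum)
    (auto simp: Lp2_integrable_sq power2_eq_square Lp2_integrable_mult)

lemma grad_norm_nonneg [simp]: "0 \<le> grad_norm \<Omega> f"
  unfolding grad_norm_def by (intro real_sqrt_ge_zero integral_nonneg_AE AE_I2 sum_nonneg) simp

lemma Lp_norm_le_H1_norm: "Lp_norm 2 \<Omega> f \<le> H1_norm \<Omega> f" "grad_norm \<Omega> f \<le> H1_norm \<Omega> f"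
  unfolding H1_norm_def by (auto intro!: real_le_rsqrt)

lemma H1_norm_le_add: "H1_norm \<Omega> f \<le> Lp_norm 2 \<Omega> f + grad_norm \<Omega> f"
  unfolding H1_norm_def by (intro sqrt_sum_squares_le_sum) auto

section \<open>Weak gradients and the Dirichlet form\<close>

context
  fixes \<Omega> :: "'a::euclidean_space set"
  assumes \<Omega>: "open \<Omega>"
begin

lemma H1_Lp2: "f \<in> H1 \<Omega> \<Longrightarrow> f \<in> Lp 2 \<Omega>"
  by (simp add: H1_def)

lemma H1_weak_partial:
  assumes "f \<in> H1 \<Omega>" "b \<in> Basis"
  shows "has_weak_partial \<Omega> b f (weak_partial \<Omega> b f)" "weak_partial \<Omega> b f \<in> Lp 2 \<Omega>"
proof -
  obtain g where g: "g \<in> Lp 2 \<Omega>" "has_weak_partial \<Omega> b f g" using assms by (auto simp: H1_def)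
  show "has_weak_partial \<Omega> b f (weak_partial \<Omega> b f)"
    unfolding weak_partial_def by (rule someI[of "has_weak_partial \<Omega> b f", OF g(2)])
  have ae: "AE x in lebesgue_on \<Omega>. g x = weak_partial \<Omega> b f x"
    using weak_partial_AE_eq[OF \<Omega> g(2)] by (simp add: eq_commute)
  show "weak_partial \<Omega> b f \<in> Lp 2 \<Omega>"
    by (rule Lp_cong_AE(1)[OF g(1) borel_measurable_lebesgue_on_cong_AE[OF open_sets_lebesgue[OF \<Omega>]
      Lp_measurable[OF g(1)] ae] ae])
qed

lemma H1I:
  "f \<in> Lp 2 \<Omega> \<Longrightarrow> (\<And>b. b \<in> Basis \<Longrightarrow> has_weak_partial \<Omega> b f (g b)) \<Longrightarrow>
   (\<And>b. b \<in> Basis \<Longrightarrow> g b \<in> Lp 2 \<Omega>) \<Longrightarrow> f \<in> H1 \<Omega>"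
  unfolding H1_def by blast

lemma H1_add: "f \<in> H1 \<Omega> \<Longrightarrow> g \<in> H1 \<Omega> \<Longrightarrow> (\<lambda>x. f x + g x) \<in> H1 \<Omega>"
  by (rule H1I[where g = "\<lambda>b x. weak_partial \<Omega> b f x + weak_partial \<Omega> b g x"])
     (auto intro: Lp_add H1_Lp2 has_weak_partial_add[OF \<Omega>] H1_weak_partial)

lemma H1_cmult: "f \<in> H1 \<Omega> \<Longrightarrow> (\<lambda>x. c * f x) \<in> H1 \<Omega>"
  by (rule H1I[where g = "\<lambda>b x. c * weak_partial \<Omega> b f x"])
     (auto intro: Lp_cmult H1_Lp2 has_weak_partial_cmult[OF \<Omega>] H1_weak_partial)

lemma H1_diff: "f \<in> H1 \<Omega> \<Longrightarrow> g \<in> H1 \<Omega> \<Longrightarrow> (\<lambda>x. f x - g x) \<in> H1 \<Omega>"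
  using H1_add[OF _ H1_cmult[of g "-1"], of f] by simp

lemma weak_partial_add_AE:
  assumes "f \<in> H1 \<Omega>" "g \<in> H1 \<Omega>" "b \<in> Basis"
  shows "AE x in lebesgue_on \<Omega>. weak_partial \<Omega> b (\<lambda>x. f x + g x) x = weak_partial \<Omega> b f x + weak_partial \<Omega> b g x"
  using assms by (intro weak_partial_AE_eq[OF \<Omega>] has_weak_partial_add[OF \<Omega>] H1_weak_partial) auto

lemma weak_partial_cmult_AE:
  assumes "f \<in> H1 \<Omega>" "b \<in> Basis"
  shows "AE x in lebesgue_on \<Omega>. weak_partial \<Omega> b (\<lambda>x. c * f x) x = c * weak_partial \<Omega> b f x"
  using assms by (intro weak_partial_AE_eq[OF \<Omega>] has_weak_partial_cmult[OF \<Omega>] H1_weak_partial) auto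

lemma weak_partial_diff_AE:
  assumes "f \<in> H1 \<Omega>" "g \<in> H1 \<Omega>" "b \<in> Basis"
  shows "AE x in lebesgue_on \<Omega>. weak_partial \<Omega> b (\<lambda>x. f x - g x) x = weak_partial \<Omega> b f x - weak_partial \<Omega> b g x"
  using weak_partial_add_AE[OF assms(1) H1_cmult[OF assms(2), of "-1"] assms(3)]
    weak_partial_cmult_AE[OF assms(2,3), of "-1"] by eventually_elim simp

lemma grad_norm_eq_L2_set:
  "f \<in> H1 \<Omega> \<Longrightarrow> grad_norm \<Omega> f = L2_set (\<lambda>b. Lp_norm 2 \<Omega> (weak_partial \<Omega> b f)) Basis"
  by (rule grad_norm_eq_L2_set_Lp_norm) (rule H1_weak_partial)

lemma grad_inner_eq_sum:
  assumes "f \<in> H1 \<Omega>" "g \<in> H1 \<Omega>"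
  shows "grad_inner \<Omega> f g = (\<Sum>b\<in>Basis. L2_inner \<Omega> (weak_partial \<Omega> b f) (weak_partial \<Omega> b g))"
  unfolding grad_inner_def L2_inner_def
  using assms by (intro Bochner_Integration.integral_sum Lp2_integrable_mult H1_weak_partial)

lemma grad_norm_sq:
  "f \<in> H1 \<Omega> \<Longrightarrow> (grad_norm \<Omega> f)\<^sup>2 = grad_inner \<Omega> f f"
  by (simp add: grad_norm_eq_L2_set grad_inner_eq_sum L2_set_def Lp2_norm_sq[symmetric] sum_nonneg)

lemma grad_inner_commute: "grad_inner \<Omega> f g = grad_inner \<Omega> g f"
  by (simp add: grad_inner_def mult.commute)

lemma L2_inner_cong_AE:
  assumes "f \<in> Lp 2 \<Omega>" "f' \<in> Lp 2 \<Omega>" "h \<in> Lp 2 \<Omega>" "AE x in lebesgue_on \<Omega>. f x = f' x"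
  shows "L2_inner \<Omega> f h = L2_inner \<Omega> f' h"
  unfolding L2_inner_def
  by (rule integral_cong_AE) (use assms Lp_measurable in \<open>auto intro!: borel_measurable_times\<close>)

lemma grad_inner_add_left:
  assumes "f \<in> H1 \<Omega>" "g \<in> H1 \<Omega>" "h \<in> H1 \<Omega>"
  shows "grad_inner \<Omega> (\<lambda>x. f x + g x) h = grad_inner \<Omega> f h + grad_inner \<Omega> g h"
proof -
  have "L2_inner \<Omega> (weak_partial \<Omega> b (\<lambda>x. f x + g x)) (weak_partial \<Omega> b h) =
      L2_inner \<Omega> (weak_partial \<Omega> b f) (weak_partial \<Omega> b h) + L2_inner \<Omega> (weak_partial \<Omega> b g) (weak_partial \<Omega> b h)"
    if b: "b \<in> Basis" for b
    using L2_inner_cong_AE[OF H1_weak_partial(2)[OF H1_add[OF assms(1,2)] b]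
        Lp_add[OF _ H1_weak_partial(2)[OF assms(1) b] H1_weak_partial(2)[OF assms(2) b]]
        H1_weak_partial(2)[OF assms(3) b] weak_partial_add_AE[OF assms(1,2) b]]
      L2_inner_add_left[OF H1_weak_partial(2)[OF assms(1) b] H1_weak_partial(2)[OF assms(2) b]
        H1_weak_partial(2)[OF assms(3) b]] by simp
  then show ?thesis
    using assms by (simp add: grad_inner_eq_sum H1_add sum.distrib)
qed

lemma grad_inner_cmult_left:
  assumes "f \<in> H1 \<Omega>" "h \<in> H1 \<Omega>"
  shows "grad_inner \<Omega> (\<lambda>x. c * f x) h = c * grad_inner \<Omega> f h"
proof -
  have "L2_inner \<Omega> (weak_partial \<Omega> b (\<lambda>x. c * f x)) (weak_partial \<Omega> b h) =
      c * L2_inner \<Omega> (weak_partial \<Omega> b f) (weak_partial \<Omega> b h)"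
    if b: "b \<in> Basis" for b
    using L2_inner_cong_AE[OF H1_weak_partial(2)[OF H1_cmult[OF assms(1)] b]
        Lp_cmult[OF H1_weak_partial(2)[OF assms(1) b]]
        H1_weak_partial(2)[OF assms(2) b] weak_partial_cmult_AE[OF assms(1) b]]
      L2_inner_cmult_left by simp
  then show ?thesis
    using assms by (simp add: grad_inner_eq_sum H1_cmult sum_distrib_left)
qed

lemma grad_inner_diff_left:
  assumes "f \<in> H1 \<Omega>" "g \<in> H1 \<Omega>" "h \<in> H1 \<Omega>"
  shows "grad_inner \<Omega> (\<lambda>x. f x - g x) h = grad_inner \<Omega> f h - grad_inner \<Omega> g h"
  using grad_inner_add_left[OF assms(1) H1_cmult[OF assms(2), of "-1"] assms(3)]
    grad_inner_cmult_left[OF assms(2,3), of "-1"] by simp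

lemma grad_Cauchy_Schwarz:
  assumes "f \<in> H1 \<Omega>" "g \<in> H1 \<Omega>"
  shows "\<bar>grad_inner \<Omega> f g\<bar> \<le> grad_norm \<Omega> f * grad_norm \<Omega> g"
proof -
  have "\<bar>grad_inner \<Omega> f g\<bar> \<le> (\<Sum>b\<in>Basis. \<bar>L2_inner \<Omega> (weak_partial \<Omega> b f) (weak_partial \<Omega> b g)\<bar>)"
    unfolding grad_inner_eq_sum[OF assms] by (rule sum_abs)
  also have "\<dots> \<le> (\<Sum>b\<in>Basis. \<bar>Lp_norm 2 \<Omega> (weak_partial \<Omega> b f)\<bar> * \<bar>Lp_norm 2 \<Omega> (weak_partial \<Omega> b g)\<bar>)"
    using L2_Cauchy_Schwarz[OF H1_weak_partial(2)[OF assms(1)] H1_weak_partial(2)[OF assms(2)]]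
    by (intro sum_mono) auto
  also have "\<dots> \<le> grad_norm \<Omega> f * grad_norm \<Omega> g"
    unfolding grad_norm_eq_L2_set[OF assms(1)] grad_norm_eq_L2_set[OF assms(2)] by (rule L2_set_mult_ineq)
  finally show ?thesis .
qed

lemma grad_norm_triangle:
  assumes "f \<in> H1 \<Omega>" "g \<in> H1 \<Omega>"
  shows "grad_norm \<Omega> (\<lambda>x. f x + g x) \<le> grad_norm \<Omega> f + grad_norm \<Omega> g"
proof (rule power2_le_imp_le)
  have fg: "(\<lambda>x. f x + g x) \<in> H1 \<Omega>" using assms by (rule H1_add)
  have "grad_inner \<Omega> (\<lambda>x. f x + g x) (\<lambda>x. f x + g x) =
      grad_inner \<Omega> f f + 2 * grad_inner \<Omega> f g + grad_inner \<Omega> g g"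
    using assms fg
    by (simp add: grad_inner_add_left grad_inner_commute[of f "\<lambda>x. f x + g x"]
        grad_inner_commute[of g "\<lambda>x. f x + g x"] grad_inner_commute[of g f])
  then show "(grad_norm \<Omega> (\<lambda>x. f x + g x))\<^sup>2 \<le> (grad_norm \<Omega> f + grad_norm \<Omega> g)\<^sup>2"
    using grad_Cauchy_Schwarz[OF assms] assms fg by (simp add: power2_sum grad_norm_sq)
qed simp

lemma grad_norm_cmult: "f \<in> H1 \<Omega> \<Longrightarrow> grad_norm \<Omega> (\<lambda>x. c * f x) = \<bar>c\<bar> * grad_norm \<Omega> f"
proof -
  assume f: "f \<in> H1 \<Omega>"
  have "(grad_norm \<Omega> (\<lambda>x. c * f x))\<^sup>2 = (\<bar>c\<bar> * grad_norm \<Omega> f)\<^sup>2"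
    using f by (simp add: grad_norm_sq power_mult_distrib grad_inner_cmult_left H1_cmult
        grad_inner_commute[of f "\<lambda>x. c * f x"] power2_eq_square[of c])
  then show ?thesis by (rule power2_eq_imp_eq) auto
qed

lemma grad_norm_diff_triangle:
  assumes "f \<in> H1 \<Omega>" "g \<in> H1 \<Omega>" "h \<in> H1 \<Omega>"
  shows "grad_norm \<Omega> (\<lambda>x. f x - h x) \<le> grad_norm \<Omega> (\<lambda>x. f x - g x) + grad_norm \<Omega> (\<lambda>x. g x - h x)"
  using grad_norm_triangle[OF H1_diff[OF assms(1,2)] H1_diff[OF assms(2,3)]] by simp

lemma grad_norm_minus_commute:
  assumes "f \<in> H1 \<Omega>" "g \<in> H1 \<Omega>"
  shows "grad_norm \<Omega> (\<lambda>x. f x - g x) = grad_norm \<Omega> (\<lambda>x. g x - f x)"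
  using grad_norm_cmult[OF H1_diff[OF assms], of "-1"] by simp

lemma grad_norm_abs_diff_le:
  assumes "f \<in> H1 \<Omega>" "g \<in> H1 \<Omega>"
  shows "\<bar>grad_norm \<Omega> f - grad_norm \<Omega> g\<bar> \<le> grad_norm \<Omega> (\<lambda>x. f x - g x)"
  using grad_norm_triangle[OF H1_diff[OF assms] assms(2)]
    grad_norm_triangle[OF H1_diff[OF assms(2,1)] assms(1)] grad_norm_minus_commute[OF assms] by simp

section \<open>The closure of the test functions\<close>

lemma test_function_H1: "\<phi> \<in> test_functions \<Omega> \<Longrightarrow> \<phi> \<in> H1 \<Omega>"
  by (rule H1I[where g = "\<lambda>b. partial_deriv b \<phi>"])
     (auto intro!: test_function_Lp test_function_partial_deriv has_weak_partial_test_function \<Omega> open_sets_lebesgue)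

lemma weak_partial_test_function:
  "\<phi> \<in> test_functions \<Omega> \<Longrightarrow> b \<in> Basis \<Longrightarrow>
   AE x in lebesgue_on \<Omega>. weak_partial \<Omega> b \<phi> x = partial_deriv b \<phi> x"
  by (intro weak_partial_AE_eq[OF \<Omega>] has_weak_partial_test_function \<Omega>)

text \<open>Approximation within e in each of the two norms separately is easier to add, scale and
  iterate than a sequence converging in \<open>H1_norm\<close>; the closure properties below become
  triangle inequalities.\<close>

lemma H01_iff:
  "f \<in> H01 \<Omega> \<longleftrightarrow> f \<in> H1 \<Omega> \<and> (\<forall>e>0. \<exists>\<phi>\<in>test_functions \<Omega>.
     Lp_norm 2 \<Omega> (\<lambda>x. \<phi> x - f x) < e \<and> grad_norm \<Omega> (\<lambda>x. \<phi> x - f x) < e)"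
proof safe
  assume f: "f \<in> H01 \<Omega>"
  then show "f \<in> H1 \<Omega>" by (simp add: H01_def)
  fix e :: real assume e: "e > 0"
  obtain \<phi> where \<phi>: "\<And>n::nat. \<phi> n \<in> test_functions \<Omega>" "(\<lambda>n. H1_norm \<Omega> (\<lambda>x. \<phi> n x - f x)) \<longlonglongrightarrow> 0"
    using f by (auto simp: H01_def)
  then have "\<forall>\<^sub>F n in sequentially. H1_norm \<Omega> (\<lambda>x. \<phi> n x - f x) < e"
    using e by (intro order_tendstoD) auto
  then obtain n where "H1_norm \<Omega> (\<lambda>x. \<phi> n x - f x) < e"
    by (auto simp: eventually_sequentially)
  then show "\<exists>\<phi>\<in>test_functions \<Omega>. Lp_norm 2 \<Omega> (\<lambda>x. \<phi> x - f x) < e \<and> grad_norm \<Omega> (\<lambda>x. \<phi> x - f x) < e"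
    using Lp_norm_le_H1_norm[of \<Omega> "\<lambda>x. \<phi> n x - f x"] \<phi>(1)[of n] by (intro bexI[of _ "\<phi> n"]) auto
next
  assume f: "f \<in> H1 \<Omega>" and a: "\<forall>e>0. \<exists>\<phi>\<in>test_functions \<Omega>.
     Lp_norm 2 \<Omega> (\<lambda>x. \<phi> x - f x) < e \<and> grad_norm \<Omega> (\<lambda>x. \<phi> x - f x) < e"
  then have "\<forall>n. \<exists>\<phi>. \<phi> \<in> test_functions \<Omega> \<and> Lp_norm 2 \<Omega> (\<lambda>x. \<phi> x - f x) < inverse (real (Suc n)) \<and>
      grad_norm \<Omega> (\<lambda>x. \<phi> x - f x) < inverse (real (Suc n))"
    by (metis inverse_positive_iff_positive of_nat_0_less_iff zero_less_Suc)
  then obtain \<phi> where \<phi>: "\<And>n. \<phi> n \<in> test_functions \<Omega>"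
    "\<And>n. Lp_norm 2 \<Omega> (\<lambda>x. \<phi> n x - f x) < inverse (real (Suc n))"
    "\<And>n. grad_norm \<Omega> (\<lambda>x. \<phi> n x - f x) < inverse (real (Suc n))" by metis
  have "(\<lambda>n. H1_norm \<Omega> (\<lambda>x. \<phi> n x - f x)) \<longlonglongrightarrow> 0"
  proof (rule Lim_null_comparison)
    have "norm (H1_norm \<Omega> (\<lambda>x. \<phi> n x - f x)) \<le> inverse (real (Suc n)) + inverse (real (Suc n))" for n
      using H1_norm_le_add[of \<Omega> "\<lambda>x. \<phi> n x - f x"] \<phi>(2,3)[of n]
        order_trans[OF Lp_norm_nonneg Lp_norm_le_H1_norm(1)[of \<Omega> "\<lambda>x. \<phi> n x - f x"]] by simp
    then show "\<forall>\<^sub>F n in sequentially. norm (H1_norm \<Omega> (\<lambda>x. \<phi> n x - f x)) \<le>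
        inverse (real (Suc n)) + inverse (real (Suc n))" by simp
    show "(\<lambda>n. inverse (real (Suc n)) + inverse (real (Suc n))) \<longlonglongrightarrow> 0"
      using tendsto_add[OF LIMSEQ_inverse_real_of_nat LIMSEQ_inverse_real_of_nat] by simp
  qed
  with f \<phi>(1) show "f \<in> H01 \<Omega>" by (auto simp: H01_def)
qed

lemma H01_H1: "f \<in> H01 \<Omega> \<Longrightarrow> f \<in> H1 \<Omega>"
  by (simp add: H01_def)

lemma H01_approxI:
  assumes f: "f \<in> H1 \<Omega>"
    and a: "\<And>e. e > 0 \<Longrightarrow> \<exists>g\<in>H01 \<Omega>. Lp_norm 2 \<Omega> (\<lambda>x. g x - f x) < e \<and> grad_norm \<Omega> (\<lambda>x. g x - f x) < e"
  shows "f \<in> H01 \<Omega>"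
  unfolding H01_iff
proof (intro conjI allI impI f)
  fix e :: real assume "e > 0"
  then obtain g where g: "g \<in> H01 \<Omega>" "Lp_norm 2 \<Omega> (\<lambda>x. g x - f x) < e / 2" "grad_norm \<Omega> (\<lambda>x. g x - f x) < e / 2"
    using a[of "e / 2"] by auto
  then obtain \<phi> where \<phi>: "\<phi> \<in> test_functions \<Omega>" "Lp_norm 2 \<Omega> (\<lambda>x. \<phi> x - g x) < e / 2"
    "grad_norm \<Omega> (\<lambda>x. \<phi> x - g x) < e / 2"
    using \<open>e > 0\<close> unfolding H01_iff by (meson half_gt_zero)
  have h: "\<phi> \<in> H1 \<Omega>" "g \<in> H1 \<Omega>" using \<phi> g by (auto intro: test_function_H1 H01_H1)
  show "\<exists>\<phi>\<in>test_functions \<Omega>. Lp_norm 2 \<Omega> (\<lambda>x. \<phi> x - f x) < e \<and> grad_norm \<Omega> (\<lambda>x. \<phi> x - f x) < e"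
    using Lp_norm_diff_triangle[OF _ H1_Lp2[OF h(1)] H1_Lp2[OF h(2)] H1_Lp2[OF f]]
      grad_norm_diff_triangle[OF h f] \<phi> g by (intro bexI[of _ \<phi>]) auto
qed

lemma test_function_add:
  assumes "\<phi> \<in> test_functions \<Omega>" "\<psi> \<in> test_functions \<Omega>"
  shows "(\<lambda>x. \<phi> x + \<psi> x) \<in> test_functions \<Omega>"
proof -
  obtain K where K: "compact K" "K \<subseteq> \<Omega>" "\<And>x. x \<notin> K \<Longrightarrow> \<phi> x = 0" "smooth \<phi>"
    using test_functionE[OF assms(1)] by blast
  obtain L where L: "compact L" "L \<subseteq> \<Omega>" "\<And>x. x \<notin> L \<Longrightarrow> \<psi> x = 0" "smooth \<psi>"
    using test_functionE[OF assms(2)] by blast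
  have "smooth (\<lambda>x. \<phi> x + \<psi> x)" using K(4) L(4) by (simp add: smooth_def Ck_add)
  moreover have "\<phi> x + \<psi> x = 0" if "x \<notin> K \<union> L" for x
    using that K(3) L(3) by simp
  ultimately show ?thesis
    unfolding test_functions_def using K(1,2) L(1,2) by (auto intro!: exI[of _ "K \<union> L"])
qed

lemma test_function_cmult:
  assumes "\<phi> \<in> test_functions \<Omega>" shows "(\<lambda>x. c * \<phi> x) \<in> test_functions \<Omega>"
proof -
  obtain K where K: "compact K" "K \<subseteq> \<Omega>" "\<And>x. x \<notin> K \<Longrightarrow> \<phi> x = 0" "smooth \<phi>"
    using test_functionE[OF assms(1)] by blast
  have "smooth (\<lambda>x. c * \<phi> x)" using K(4) by (simp add: smooth_def Ck_mult Ck_const)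
  then show ?thesis
    unfolding test_functions_def using K by (auto intro!: exI[of _ K])
qed

lemma H01_add:
  assumes f: "f \<in> H01 \<Omega>" and g: "g \<in> H01 \<Omega>"
  shows "(\<lambda>x. f x + g x) \<in> H01 \<Omega>"
  unfolding H01_iff
proof (intro conjI allI impI)
  show "(\<lambda>x. f x + g x) \<in> H1 \<Omega>" using f g by (intro H1_add H01_H1)
  fix e :: real assume "e > 0"
  then have e: "e / 2 > 0" by simp
  obtain \<phi> where \<phi>: "\<phi> \<in> test_functions \<Omega>" "Lp_norm 2 \<Omega> (\<lambda>x. \<phi> x - f x) < e / 2"
    "grad_norm \<Omega> (\<lambda>x. \<phi> x - f x) < e / 2" using f e unfolding H01_iff by blast
  obtain \<psi> where \<psi>: "\<psi> \<in> test_functions \<Omega>" "Lp_norm 2 \<Omega> (\<lambda>x. \<psi> x - g x) < e / 2"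
    "grad_norm \<Omega> (\<lambda>x. \<psi> x - g x) < e / 2" using g e unfolding H01_iff by blast
  have h: "(\<lambda>x. \<phi> x - f x) \<in> H1 \<Omega>" "(\<lambda>x. \<psi> x - g x) \<in> H1 \<Omega>"
    using \<phi>(1) \<psi>(1) f g by (simp_all add: H1_diff test_function_H1 H01_H1)
  have eq: "(\<lambda>x. (\<phi> x + \<psi> x) - (f x + g x)) = (\<lambda>x. (\<phi> x - f x) + (\<psi> x - g x))" by auto
  show "\<exists>\<phi>\<in>test_functions \<Omega>. Lp_norm 2 \<Omega> (\<lambda>x. \<phi> x - (f x + g x)) < e \<and> grad_norm \<Omega> (\<lambda>x. \<phi> x - (f x + g x)) < e"
    using Lp_norm_triangle[OF _ H1_Lp2[OF h(1)] H1_Lp2[OF h(2)]] grad_norm_triangle[OF h] \<phi> \<psi>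
    by (intro bexI[of _ "\<lambda>x. \<phi> x + \<psi> x"] test_function_add) (auto simp: eq)
qed

lemma H01_cmult:
  assumes f: "f \<in> H01 \<Omega>"
  shows "(\<lambda>x. c * f x) \<in> H01 \<Omega>"
  unfolding H01_iff
proof (intro conjI allI impI)
  show "(\<lambda>x. c * f x) \<in> H1 \<Omega>" using f by (intro H1_cmult H01_H1)
  fix e :: real assume "e > 0"
  then have e: "e / (\<bar>c\<bar> + 1) > 0" by (simp add: add_nonneg_pos)
  obtain \<phi> where \<phi>: "\<phi> \<in> test_functions \<Omega>" "Lp_norm 2 \<Omega> (\<lambda>x. \<phi> x - f x) < e / (\<bar>c\<bar> + 1)"
    "grad_norm \<Omega> (\<lambda>x. \<phi> x - f x) < e / (\<bar>c\<bar> + 1)" using f e unfolding H01_iff by blast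
  have h: "(\<lambda>x. \<phi> x - f x) \<in> H1 \<Omega>" using \<phi>(1) f by (simp add: H1_diff test_function_H1 H01_H1)
  have eq: "(\<lambda>x. c * \<phi> x - c * f x) = (\<lambda>x. c * (\<phi> x - f x))" by (auto simp: right_diff_distrib)
  have lt: "\<bar>c\<bar> * a < e" if "a < e / (\<bar>c\<bar> + 1)" "0 \<le> a" for a
  proof -
    have "\<bar>c\<bar> * a \<le> (\<bar>c\<bar> + 1) * a" using that by (intro mult_right_mono) auto
    also have "\<dots> < e" using that by (simp add: less_divide_eq mult.commute add_nonneg_pos)
    finally show ?thesis .
  qed
  show "\<exists>\<phi>\<in>test_functions \<Omega>. Lp_norm 2 \<Omega> (\<lambda>x. \<phi> x - c * f x) < e \<and> grad_norm \<Omega> (\<lambda>x. \<phi> x - c * f x) < e"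
    using lt[OF \<phi>(2)] lt[OF \<phi>(3)] h \<phi>(1)
    by (intro bexI[of _ "\<lambda>x. c * \<phi> x"] test_function_cmult) (auto simp: eq Lp_norm_cmult grad_norm_cmult)
qed

lemma H01_diff: "f \<in> H01 \<Omega> \<Longrightarrow> g \<in> H01 \<Omega> \<Longrightarrow> (\<lambda>x. f x - g x) \<in> H01 \<Omega>"
  using H01_add[OF _ H01_cmult[of g "-1"], of f] by simp

text \<open>The limit g is already given as an L2 limit. The components of the gradients converge by
  completeness of L2, and closedness of the weak derivative identifies their limits as the partial
  derivatives of g.\<close>

lemma H01_complete:
  assumes f: "\<And>n::nat. f n \<in> H01 \<Omega>" and g: "g \<in> Lp 2 \<Omega>"
    and lim: "(\<lambda>n. Lp_norm 2 \<Omega> (\<lambda>x. f n x - g x)) \<longlonglongrightarrow> 0"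
    and cau: "\<And>e. 0 < e \<Longrightarrow> \<exists>N. \<forall>m\<ge>N. \<forall>n\<ge>N. grad_norm \<Omega> (\<lambda>x. f m x - f n x) \<le> e"
  shows "g \<in> H01 \<Omega>" "(\<lambda>n. grad_norm \<Omega> (\<lambda>x. f n x - g x)) \<longlonglongrightarrow> 0"
proof -
  have f1: "f n \<in> H1 \<Omega>" for n using f by (rule H01_H1)
  have "\<exists>w. w \<in> Lp 2 \<Omega> \<and> (\<lambda>n. Lp_norm 2 \<Omega> (\<lambda>x. weak_partial \<Omega> b (f n) x - w x)) \<longlonglongrightarrow> 0"
    if b: "b \<in> Basis" for b
  proof -
    have "\<exists>N. \<forall>m\<ge>N. \<forall>n\<ge>N. Lp_norm 2 \<Omega> (\<lambda>x. weak_partial \<Omega> b (f m) x - weak_partial \<Omega> b (f n) x) \<le> e"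
      if "e > 0" for e
    proof -
      have "Lp_norm 2 \<Omega> (\<lambda>x. weak_partial \<Omega> b (f m) x - weak_partial \<Omega> b (f n) x) \<le>
          grad_norm \<Omega> (\<lambda>x. f m x - f n x)" for m n
      proof -
        have h: "(\<lambda>x. f m x - f n x) \<in> H1 \<Omega>" using f1 by (intro H1_diff)
        have "Lp_norm 2 \<Omega> (\<lambda>x. weak_partial \<Omega> b (f m) x - weak_partial \<Omega> b (f n) x) =
            Lp_norm 2 \<Omega> (weak_partial \<Omega> b (\<lambda>x. f m x - f n x))"
          using Lp_diff[OF _ H1_weak_partial(2)[OF f1 b, of m] H1_weak_partial(2)[OF f1 b, of n]]
          by (intro Lp_cong_AE(2)[OF H1_weak_partial(2)[OF h b] _ weak_partial_diff_AE[OF f1 f1 b]])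
             (simp add: Lp_measurable)
        also have "\<dots> \<le> grad_norm \<Omega> (\<lambda>x. f m x - f n x)"
          unfolding grad_norm_eq_L2_set[OF h] using b by (intro member_le_L2_set) auto
        finally show ?thesis .
      qed
      note leq = this
      obtain N where "\<forall>m\<ge>N. \<forall>n\<ge>N. grad_norm \<Omega> (\<lambda>x. f m x - f n x) \<le> e" using cau[OF \<open>e > 0\<close>] by blast
      then show ?thesis by (intro exI[of _ N] allI impI order_trans[OF leq]) blast
    qed
    note cauw = this
    show ?thesis
    proof (rule Lp_complete[where q = 2 and f = "\<lambda>n. weak_partial \<Omega> b (f n)" and \<Omega> = \<Omega>])
      show "weak_partial \<Omega> b (f n) \<in> Lp 2 \<Omega>" for n by (rule H1_weak_partial(2)[OF f1 b])
    qed (use cauw in simp_all, blast)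
  qed
  then have "\<exists>w. \<forall>b\<in>Basis. w b \<in> Lp 2 \<Omega> \<and>
      (\<lambda>n. Lp_norm 2 \<Omega> (\<lambda>x. weak_partial \<Omega> b (f n) x - w b x)) \<longlonglongrightarrow> 0"
    by (intro bchoice ballI)
  then obtain w where w: "\<And>b. b \<in> Basis \<Longrightarrow> w b \<in> Lp 2 \<Omega>"
    "\<And>b. b \<in> Basis \<Longrightarrow> (\<lambda>n. Lp_norm 2 \<Omega> (\<lambda>x. weak_partial \<Omega> b (f n) x - w b x)) \<longlonglongrightarrow> 0" by blast
  have hw: "has_weak_partial \<Omega> b g (w b)" if b: "b \<in> Basis" for b
    by (rule has_weak_partial_closed[OF \<Omega> b H1_weak_partial(1)[OF f1 b] H1_Lp2[OF f1]
        H1_weak_partial(2)[OF f1 b] g w(1)[OF b] lim w(2)[OF b]])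
  have g1: "g \<in> H1 \<Omega>" using g hw w(1) by (rule H1I)
  have "(\<lambda>n. L2_set (\<lambda>b. Lp_norm 2 \<Omega> (\<lambda>x. weak_partial \<Omega> b (f n) x - w b x)) Basis) \<longlonglongrightarrow> L2_set (\<lambda>b. 0) (Basis :: 'a set)"
    unfolding L2_set_def by (intro tendsto_intros w(2))
  also have "(\<lambda>n. L2_set (\<lambda>b. Lp_norm 2 \<Omega> (\<lambda>x. weak_partial \<Omega> b (f n) x - w b x)) Basis) =
      (\<lambda>n. grad_norm \<Omega> (\<lambda>x. f n x - g x))"
  proof
    fix n
    have h: "(\<lambda>x. f n x - g x) \<in> H1 \<Omega>" using f1 g1 by (intro H1_diff)
    have "Lp_norm 2 \<Omega> (\<lambda>x. weak_partial \<Omega> b (f n) x - w b x) = Lp_norm 2 \<Omega> (weak_partial \<Omega> b (\<lambda>x. f n x - g x))"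
      if b: "b \<in> Basis" for b
    proof (rule Lp_cong_AE(2)[OF H1_weak_partial(2)[OF h b]])
      show "(\<lambda>x. weak_partial \<Omega> b (f n) x - w b x) \<in> borel_measurable (lebesgue_on \<Omega>)"
        using Lp_diff[OF _ H1_weak_partial(2)[OF f1 b, of n] w(1)[OF b]] by (simp add: Lp_measurable)
      show "AE x in lebesgue_on \<Omega>. weak_partial \<Omega> b (\<lambda>x. f n x - g x) x = weak_partial \<Omega> b (f n) x - w b x"
        using weak_partial_diff_AE[OF f1 g1 b, of n] weak_partial_AE_eq[OF \<Omega> hw[OF b]] by eventually_elim simp
    qed
    then show "L2_set (\<lambda>b. Lp_norm 2 \<Omega> (\<lambda>x. weak_partial \<Omega> b (f n) x - w b x)) Basis = grad_norm \<Omega> (\<lambda>x. f n x - g x)"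
      unfolding grad_norm_eq_L2_set[OF h] by (intro L2_set_cong) auto
  qed
  finally show gl: "(\<lambda>n. grad_norm \<Omega> (\<lambda>x. f n x - g x)) \<longlonglongrightarrow> 0" by (simp add: L2_set_def)
  show "g \<in> H01 \<Omega>"
  proof (rule H01_approxI[OF g1])
    fix e :: real assume "e > 0"
    then have "\<forall>\<^sub>F n in sequentially. Lp_norm 2 \<Omega> (\<lambda>x. f n x - g x) < e \<and> grad_norm \<Omega> (\<lambda>x. f n x - g x) < e"
      using lim gl by (intro eventually_conj order_tendstoD)
    then obtain n where "Lp_norm 2 \<Omega> (\<lambda>x. f n x - g x) < e \<and> grad_norm \<Omega> (\<lambda>x. f n x - g x) < e"
      by (auto simp: eventually_sequentially)
    then show "\<exists>g'\<in>H01 \<Omega>. Lp_norm 2 \<Omega> (\<lambda>x. g' x - g x) < e \<and> grad_norm \<Omega> (\<lambda>x. g' x - g x) < e"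
      using f by blast
  qed
qed

section \<open>Green's formula for the Dirichlet Laplacian\<close>

lemma laplacian_Lp2:
  assumes "f \<in> DA \<Omega>" shows "laplacian \<Omega> f \<in> Lp 2 \<Omega>"
proof -
  have "(\<lambda>x. laplacian \<Omega> f x) \<in> Lp 2 \<Omega>"
    unfolding laplacian_def using assms
    by (intro Lp_sum H1_weak_partial(2)) (auto simp: DA_def H2_def)
  then show ?thesis by simp
qed

text \<open>For test functions this is the definition of the weak derivatives of
  \<open>weak_partial \<Omega> b f\<close>. Both sides are continuous in g with respect to the L2
  norm and the gradient norm, and test functions are dense in \<open>H01 \<Omega>\<close>.\<close>

lemma laplacian_inner:
  assumes f: "f \<in> DA \<Omega>" and g: "g \<in> H01 \<Omega>"
  shows "L2_inner \<Omega> (laplacian \<Omega> f) g = - grad_inner \<Omega> f g"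
proof -
  have f1: "f \<in> H1 \<Omega>" and f2: "\<And>b. b \<in> Basis \<Longrightarrow> weak_partial \<Omega> b f \<in> H1 \<Omega>"
    using f by (auto simp: DA_def H2_def)
  have l2: "laplacian \<Omega> f \<in> Lp 2 \<Omega>" using f by (rule laplacian_Lp2)
  have tst: "L2_inner \<Omega> (laplacian \<Omega> f) \<phi> = - grad_inner \<Omega> f \<phi>" if \<phi>: "\<phi> \<in> test_functions \<Omega>" for \<phi>
  proof -
    have p2: "\<phi> \<in> Lp 2 \<Omega>" using \<phi> by (intro H1_Lp2 test_function_H1)
    have "L2_inner \<Omega> (laplacian \<Omega> f) \<phi> = (\<Sum>b\<in>Basis. L2_inner \<Omega> (weak_partial \<Omega> b (weak_partial \<Omega> b f)) \<phi>)"
      using L2_inner_sum_left[of Basis "\<lambda>b. weak_partial \<Omega> b (weak_partial \<Omega> b f)", OF H1_weak_partial(2)[OF f2] p2]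
      by (simp add: L2_inner_def laplacian_def)
    also have "\<dots> = (\<Sum>b\<in>Basis. - L2_inner \<Omega> (weak_partial \<Omega> b f) (partial_deriv b \<phi>))"
      using H1_weak_partial(1)[OF f2] \<phi> by (intro sum.cong) (auto simp: L2_inner_def has_weak_partial_def)
    also have "\<dots> = (\<Sum>b\<in>Basis. - L2_inner \<Omega> (weak_partial \<Omega> b f) (weak_partial \<Omega> b \<phi>))"
    proof (rule sum.cong[OF refl])
      fix b :: 'a assume b: "b \<in> Basis"
      have "L2_inner \<Omega> (partial_deriv b \<phi>) (weak_partial \<Omega> b f) = L2_inner \<Omega> (weak_partial \<Omega> b \<phi>) (weak_partial \<Omega> b f)"
        using weak_partial_test_function[OF \<phi> b]
        by (intro L2_inner_cong_AE[OF H1_Lp2[OF test_function_H1[OF test_function_partial_deriv[OF \<phi> b]]]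
            H1_weak_partial(2)[OF test_function_H1[OF \<phi>] b] H1_weak_partial(2)[OF f1 b]])
           (simp add: eq_commute)
      then show "- L2_inner \<Omega> (weak_partial \<Omega> b f) (partial_deriv b \<phi>) = - L2_inner \<Omega> (weak_partial \<Omega> b f) (weak_partial \<Omega> b \<phi>)"
        by (simp add: L2_inner_commute)
    qed
    also have "\<dots> = - grad_inner \<Omega> f \<phi>"
      using f1 \<phi> by (simp add: grad_inner_eq_sum test_function_H1 sum_negf)
    finally show ?thesis .
  qed
  have g1: "g \<in> H1 \<Omega>" using g by (rule H01_H1)
  let ?D = "\<bar>L2_inner \<Omega> (laplacian \<Omega> f) g + grad_inner \<Omega> f g\<bar>"
  define C where "C = Lp_norm 2 \<Omega> (laplacian \<Omega> f) + grad_norm \<Omega> f"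
  have C: "C \<ge> 0" by (simp add: C_def)
  have le: "?D \<le> C * e" if e: "e > 0" for e
  proof -
    obtain \<phi> where \<phi>: "\<phi> \<in> test_functions \<Omega>" "Lp_norm 2 \<Omega> (\<lambda>x. \<phi> x - g x) < e"
      "grad_norm \<Omega> (\<lambda>x. \<phi> x - g x) < e" using g e unfolding H01_iff by blast
    have p1: "\<phi> \<in> H1 \<Omega>" using \<phi> by (intro test_function_H1)
    have d: "(\<lambda>x. \<phi> x - g x) \<in> H1 \<Omega>" using p1 g1 by (rule H1_diff)
    have "?D = \<bar>L2_inner \<Omega> (\<lambda>x. \<phi> x - g x) (laplacian \<Omega> f) + grad_inner \<Omega> (\<lambda>x. \<phi> x - g x) f\<bar>"
      using tst[OF \<phi>(1)] p1 g1 f1 l2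
      by (simp add: L2_inner_diff_left grad_inner_diff_left H1_Lp2 L2_inner_commute[of _ "laplacian \<Omega> f"] grad_inner_commute[of f])
    also have "\<dots> \<le> Lp_norm 2 \<Omega> (\<lambda>x. \<phi> x - g x) * Lp_norm 2 \<Omega> (laplacian \<Omega> f) +
        grad_norm \<Omega> (\<lambda>x. \<phi> x - g x) * grad_norm \<Omega> f"
      using L2_Cauchy_Schwarz[OF H1_Lp2[OF d] l2] grad_Cauchy_Schwarz[OF d f1] by linarith
    also have "\<dots> \<le> e * Lp_norm 2 \<Omega> (laplacian \<Omega> f) + e * grad_norm \<Omega> f"
      using \<phi> by (intro add_mono mult_right_mono) auto
    finally show ?thesis by (simp add: C_def algebra_simps)
  qed
  have "?D \<le> 0"
  proof (rule field_le_epsilon)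
    fix e :: real assume e: "e > 0"
    have "?D \<le> C * (e / (C + 1))" using e C by (intro le) auto
    also have "\<dots> \<le> e" using e C by (simp add: divide_le_eq mult_left_mono)
    finally show "?D \<le> 0 + e" by simp
  qed
  then show ?thesis by linarith
qed

end

section \<open>Rellich's compactness theorem\<close>

text \<open>Cauchy-Schwarz against the indicator of B, obtained by expanding the nonnegative
  integral over B of (v g - m)^2, where v is the measure of B and m the integral of g over
  B.\<close>

lemma integral_sq_le:
  fixes g :: "'b \<Rightarrow> real"
  assumes B: "B \<in> sets M" "emeasure M B < \<infinity>" "0 < measure M B"
    and g: "integrable M (\<lambda>y. indicator B y * g y)" "integrable M (\<lambda>y. indicator B y * (g y)\<^sup>2)"
  shows "(LINT y|M. indicator B y * g y)\<^sup>2 \<le> measure M B * (LINT y|M. indicator B y * (g y)\<^sup>2)"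
proof -
  define v where "v = measure M B"
  define m where "m = (LINT y|M. indicator B y * g y)"
  define q where "q = (LINT y|M. indicator B y * (g y)\<^sup>2)"
  have i: "integrable M (indicator B :: 'b \<Rightarrow> real)" using B by (intro integrable_real_indicator) auto
  have v: "v > 0" "(LINT y|M. indicator B y) = v" using B by (auto simp: v_def)
  have "0 \<le> (LINT y|M. indicator B y * (v * g y - m)\<^sup>2)"
    by (intro integral_nonneg_AE) auto
  also have "\<dots> = (LINT y|M. v\<^sup>2 * (indicator B y * (g y)\<^sup>2) - 2 * v * m * (indicator B y * g y) + m\<^sup>2 * indicator B y)"
    by (intro Bochner_Integration.integral_cong) (auto simp: power2_diff power_mult_distrib algebra_simps)
  also have "\<dots> = v\<^sup>2 * q - 2 * v * m * m + m\<^sup>2 * v"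
    using g i v by (simp add: m_def q_def)
  also have "\<dots> = v * (v * q - m\<^sup>2)" by (simp add: algebra_simps power2_eq_square)
  finally have "m\<^sup>2 \<le> v * q" using v by (simp add: zero_le_mult_iff)
  then show ?thesis by (simp add: m_def q_def v_def)
qed

lemma integrable_indicator_mult_bounded:
  fixes g :: "'a::euclidean_space \<Rightarrow> real"
  assumes "B \<in> sets lborel" "emeasure lborel B < \<infinity>" "g \<in> borel_measurable borel" "\<And>y. \<bar>g y\<bar> \<le> C"
  shows "integrable lborel (\<lambda>y. indicator B y * g y)"
  using assms integrableI_bounded_set_indicator[of B lborel g C] by auto

lemma nn_integral_indicator_eq:
  fixes g :: "'a::euclidean_space \<Rightarrow> real"
  assumes "integrable lborel (\<lambda>y. indicator B y * g y)" "\<And>y. 0 \<le> g y"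
  shows "ennreal (LINT y|lborel. indicator B y * g y) = (\<integral>\<^sup>+y. indicator B y * ennreal (g y) \<partial>lborel)"
proof -
  have "(\<integral>\<^sup>+y. ennreal (indicator B y * g y) \<partial>lborel) = ennreal (LINT y|lborel. indicator B y * g y)"
    using assms by (intro nn_integral_eq_integral) auto
  moreover have "ennreal (indicator B y * g y) = indicator B y * ennreal (g y)" for y
    by (auto simp: indicator_def)
  ultimately show ?thesis by simp
qed

section \<open>Translations and averages over balls\<close>

definition grad_sq :: "('a::euclidean_space \<Rightarrow> real) \<Rightarrow> 'a \<Rightarrow> real" where
  "grad_sq \<phi> x = (\<Sum>b\<in>Basis. (partial_deriv b \<phi> x)\<^sup>2)"

lemma grad_sq_nonneg: "0 \<le> grad_sq \<phi> x"
  by (auto simp: grad_sq_def intro: sum_nonneg)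

text \<open>The average over the ball about x without its normalisation, which saves divisions by
  the volume. Integrating over the fixed ball about 0 exposes the translations of \<phi>.\<close>

definition ball_int :: "real \<Rightarrow> ('a::euclidean_space \<Rightarrow> real) \<Rightarrow> 'a \<Rightarrow> real" where
  "ball_int r \<phi> x = (LINT y|lborel. indicator (ball (0::'a) r) y * \<phi> (x + y))"

context
  fixes \<Omega> :: "'a::euclidean_space set"
  assumes \<Omega>: "open \<Omega>"
begin

lemma grad_sq_test_function: "\<phi> \<in> test_functions \<Omega> \<Longrightarrow> grad_sq \<phi> \<in> test_functions \<Omega>"
proof -
  assume \<phi>: "\<phi> \<in> test_functions \<Omega>"
  have z: "(\<lambda>x. 0) \<in> test_functions \<Omega>"
    using test_function_cmult[OF \<Omega> \<phi>, of 0] by simp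
  have "(\<lambda>x. \<Sum>b\<in>I. (partial_deriv b \<phi> x)\<^sup>2) \<in> test_functions \<Omega>" if "finite I" "I \<subseteq> Basis" for I
    using that
  proof (induction I rule: finite_induct)
    case (insert b I)
    have d: "partial_deriv b \<phi> \<in> test_functions \<Omega>"
      using insert.prems by (intro test_function_partial_deriv[OF \<phi>]) simp
    show ?case
      using test_function_add[OF \<Omega> test_function_mult[OF d d] insert.IH] insert.prems insert.hyps
      by (simp add: power2_eq_square)
  qed (simp add: z)
  from this[OF finite_Basis order_refl] show ?thesis by (simp add: grad_sq_def[abs_def])
qed

lemma nn_integral_grad_sq:
  assumes \<phi>: "\<phi> \<in> test_functions \<Omega>"
  shows "(\<integral>\<^sup>+x. ennreal (grad_sq \<phi> x) \<partial>lborel) = ennreal ((grad_norm \<Omega> \<phi>)\<^sup>2)"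
proof -
  have g: "grad_sq \<phi> \<in> test_functions \<Omega>" using \<phi> by (rule grad_sq_test_function)
  have f1: "\<phi> \<in> H1 \<Omega>" using test_function_H1[OF \<Omega> \<phi>] .
  have "(\<integral>\<^sup>+x. ennreal (grad_sq \<phi> x) \<partial>lborel) = ennreal (LINT x|lborel. grad_sq \<phi> x)"
    using test_function_integrable_lborel[OF g] grad_sq_nonneg by (intro nn_integral_eq_integral) auto
  also have "(LINT x|lborel. grad_sq \<phi> x) = (LINT x|lebesgue_on \<Omega>. grad_sq \<phi> x)"
    by (intro integral_lebesgue_on_eq_lborel[symmetric] open_sets_lebesgue[OF \<Omega>] test_function_measurable[OF g]
        test_function_outside[OF g])
  also have "\<dots> = (LINT x|lebesgue_on \<Omega>. (\<Sum>b\<in>Basis. (weak_partial \<Omega> b \<phi> x)\<^sup>2))"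
  proof (rule integral_cong_AE)
    show "grad_sq \<phi> \<in> borel_measurable (lebesgue_on \<Omega>)"
      using g by (rule test_function_measurable_lebesgue_on)
    show "(\<lambda>x. \<Sum>b\<in>Basis. (weak_partial \<Omega> b \<phi> x)\<^sup>2) \<in> borel_measurable (lebesgue_on \<Omega>)"
      using H1_weak_partial(2)[OF \<Omega> f1] by (intro borel_measurable_sum borel_measurable_power Lp_measurable)
    have "AE x in lebesgue_on \<Omega>. \<forall>b\<in>Basis. weak_partial \<Omega> b \<phi> x = partial_deriv b \<phi> x"
      using weak_partial_test_function[OF \<Omega> \<phi>] by (intro AE_finite_allI) auto
    then show "AE x in lebesgue_on \<Omega>. grad_sq \<phi> x = (\<Sum>b\<in>Basis. (weak_partial \<Omega> b \<phi> x)\<^sup>2)"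
      by eventually_elim (simp add: grad_sq_def)
  qed
  also have "\<dots> = (grad_norm \<Omega> \<phi>)\<^sup>2"
    unfolding grad_norm_def by (subst real_sqrt_pow2) (auto intro!: integral_nonneg_AE sum_nonneg)
  finally show ?thesis .
qed

text \<open>The increment is the integral over [0, 1] of the derivative along the segment.
  Cauchy-Schwarz in the parameter and in the coordinates bounds its square by |h|^2 times the mean
  of \<open>grad_sq \<phi>\<close> on the segment; Tonelli's theorem and translation invariance
  integrate this over x. The integral over the whole space admits segments that leave
  \<Omega>.\<close>

lemma translation_estimate:
  assumes \<phi>: "\<phi> \<in> test_functions \<Omega>"
  shows "(\<integral>\<^sup>+x. ennreal ((\<phi> (x + h) - \<phi> x)\<^sup>2) \<partial>lborel) \<le> ennreal ((norm h * grad_norm \<Omega> \<phi>)\<^sup>2)"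
proof -
  have g: "grad_sq \<phi> \<in> test_functions \<Omega>" using \<phi> by (rule grad_sq_test_function)
  have s: "smooth \<phi>" using \<phi> by (simp add: test_functions_def)
  have [measurable]: "grad_sq \<phi> \<in> borel_measurable borel" using g by (rule test_function_measurable)
  let ?I = "{0..1::real}"
  have pt: "ennreal ((\<phi> (x + h) - \<phi> x)\<^sup>2) \<le>
      (\<integral>\<^sup>+s. indicator ?I s * ennreal ((norm h)\<^sup>2 * grad_sq \<phi> (x + s *\<^sub>R h)) \<partial>lborel)" for x
  proof -
    define D where "D s = (\<Sum>b\<in>Basis. (h \<bullet> b) * partial_deriv b \<phi> (x + s *\<^sub>R h))" for s
    have "continuous_on UNIV (\<lambda>s. partial_deriv b \<phi> (x + s *\<^sub>R h))" if "b \<in> Basis" for b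
      using test_function_continuous_on[OF test_function_partial_deriv[OF \<phi> that], of UNIV]
      by (rule continuous_on_compose2) (auto intro!: continuous_intros)
    then have Dc: "continuous_on UNIV D" unfolding D_def by (intro continuous_intros)
    have deriv: "((\<lambda>s. \<phi> (x + s *\<^sub>R h)) has_real_derivative D s) (at s)" for s
    proof -
      have l: "((\<lambda>s. x + s *\<^sub>R h) has_derivative (\<lambda>t. t *\<^sub>R h)) (at s)"
        by (auto intro!: derivative_eq_intros)
      have lin: "linear (frechet_derivative \<phi> (at (x + s *\<^sub>R h)))"
        using smooth_has_derivative[OF s] has_derivative_linear by blast
      have "((\<lambda>s. \<phi> (x + s *\<^sub>R h)) has_derivative (\<lambda>t. frechet_derivative \<phi> (at (x + s *\<^sub>R h)) (t *\<^sub>R h))) (at s)"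
        using has_derivative_compose[OF l, of \<phi> "frechet_derivative \<phi> (at (x + s *\<^sub>R h))"] smooth_has_derivative[OF s] by simp
      moreover have "frechet_derivative \<phi> (at (x + s *\<^sub>R h)) (t *\<^sub>R h) = D s * t" for t
        using lin frechet_derivative_sum_partial_deriv[OF smooth_differentiable[OF s], of "x + s *\<^sub>R h" h]
        by (simp add: linear_scale D_def)
      ultimately show ?thesis by (simp add: has_field_derivative_def)
    qed
    have i1: "integrable lborel (\<lambda>s. indicator ?I s * D s)"
      using borel_integrable_atLeastAtMost'[of 0 1 D] continuous_on_subset[OF Dc] by (simp add: set_integrable_def)
    have i2: "integrable lborel (\<lambda>s. indicator ?I s * (D s)\<^sup>2)"
      using borel_integrable_atLeastAtMost'[of 0 1 "\<lambda>s. (D s)\<^sup>2"] continuous_on_subset[OF Dc]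
      by (simp add: set_integrable_def continuous_on_power)
    have "(LINT s|lborel. indicator ?I s * D s) = \<phi> (x + 1 *\<^sub>R h) - \<phi> (x + 0 *\<^sub>R h)"
      using integral_FTC_Icc_real[of 0 1 "\<lambda>s. \<phi> (x + s *\<^sub>R h)" D] deriv Dc
      by (simp add: mult.commute continuous_on_eq_continuous_at)
    then have "(\<phi> (x + h) - \<phi> x)\<^sup>2 \<le> (LINT s|lborel. indicator ?I s * (D s)\<^sup>2)"
      using integral_sq_le[OF _ _ _ i1 i2] by simp
    then have "ennreal ((\<phi> (x + h) - \<phi> x)\<^sup>2) \<le> (\<integral>\<^sup>+s. indicator ?I s * ennreal ((D s)\<^sup>2) \<partial>lborel)"
      unfolding nn_integral_indicator_eq[OF i2 zero_le_power2, symmetric] by (rule ennreal_leI)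
    also have "\<dots> \<le> (\<integral>\<^sup>+s. indicator ?I s * ennreal ((norm h)\<^sup>2 * grad_sq \<phi> (x + s *\<^sub>R h)) \<partial>lborel)"
    proof (intro nn_integral_mono mult_left_mono ennreal_leI)
      fix s
      have "(D s)\<^sup>2 \<le> (\<Sum>b\<in>Basis. (h \<bullet> b)\<^sup>2) * grad_sq \<phi> (x + s *\<^sub>R h)"
        unfolding D_def grad_sq_def by (rule Cauchy_Schwarz_ineq_sum)
      also have "(\<Sum>b\<in>Basis. (h \<bullet> b)\<^sup>2) = (norm h)\<^sup>2"
        unfolding power2_norm_eq_inner euclidean_inner[of h h] by (simp add: power2_eq_square)
      finally show "(D s)\<^sup>2 \<le> (norm h)\<^sup>2 * grad_sq \<phi> (x + s *\<^sub>R h)" .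
    qed auto
    finally show ?thesis .
  qed
  have "(\<integral>\<^sup>+x. ennreal ((\<phi> (x + h) - \<phi> x)\<^sup>2) \<partial>lborel) \<le>
      (\<integral>\<^sup>+x. \<integral>\<^sup>+s. indicator ?I s * ennreal ((norm h)\<^sup>2 * grad_sq \<phi> (x + s *\<^sub>R h)) \<partial>lborel \<partial>lborel)"
    by (rule nn_integral_mono) (rule pt)
  also have "\<dots> = (\<integral>\<^sup>+s. \<integral>\<^sup>+x. indicator ?I s * ennreal ((norm h)\<^sup>2 * grad_sq \<phi> (x + s *\<^sub>R h)) \<partial>lborel \<partial>lborel)"
    by (rule lborel_pair.Fubini'[symmetric]) measurable
  also have "\<dots> = (\<integral>\<^sup>+s. indicator ?I s * ennreal ((norm h * grad_norm \<Omega> \<phi>)\<^sup>2) \<partial>lborel)"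
  proof (rule nn_integral_cong)
    fix s :: real
    have "(\<integral>\<^sup>+x. ennreal ((norm h)\<^sup>2 * grad_sq \<phi> (x + s *\<^sub>R h)) \<partial>lborel) =
        (\<integral>\<^sup>+x. ennreal ((norm h)\<^sup>2 * grad_sq \<phi> x) \<partial>lborel)"
      by (rule nn_integral_lborel_translate[of "\<lambda>x. ennreal ((norm h)\<^sup>2 * grad_sq \<phi> x)"]) measurable
    also have "\<dots> = ennreal ((norm h)\<^sup>2) * (\<integral>\<^sup>+x. ennreal (grad_sq \<phi> x) \<partial>lborel)"
      by (subst nn_integral_cmult[symmetric]) (auto simp: ennreal_mult grad_sq_nonneg)
    also have "\<dots> = ennreal ((norm h * grad_norm \<Omega> \<phi>)\<^sup>2)"
      unfolding nn_integral_grad_sq[OF \<phi>] by (simp add: ennreal_mult[symmetric] power_mult_distrib)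
    finally show "(\<integral>\<^sup>+x. indicator ?I s * ennreal ((norm h)\<^sup>2 * grad_sq \<phi> (x + s *\<^sub>R h)) \<partial>lborel) =
        indicator ?I s * ennreal ((norm h * grad_norm \<Omega> \<phi>)\<^sup>2)"
      by (subst nn_integral_cmult) (auto simp: mult.commute)
  qed
  also have "\<dots> = ennreal ((norm h * grad_norm \<Omega> \<phi>)\<^sup>2)"
    by (simp add: nn_integral_multc)
  finally show ?thesis .
qed

lemma measure_ball_pos: "0 < r \<Longrightarrow> 0 < measure lborel (ball (0::'a) r)"
  by (simp add: content_ball_pos)

lemma ball_int_integrable:
  assumes \<phi>: "\<phi> \<in> test_functions \<Omega>"
  shows "integrable lborel (\<lambda>y. indicator (ball (0::'a) r) y * (c - \<phi> (x + y)))"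
    "integrable lborel (\<lambda>y. indicator (ball (0::'a) r) y * (c - \<phi> (x + y))\<^sup>2)"
    "integrable lborel (\<lambda>y. indicator (ball (0::'a) r) y * \<phi> (x + y))"
    "integrable lborel (\<lambda>y. indicator (ball (0::'a) r) y * (\<phi> (x + y) - \<phi> (z + y)))"
    "integrable lborel (\<lambda>y. indicator (ball (0::'a) r) y * (\<phi> (x + y) - \<phi> (z + y))\<^sup>2)"
    "integrable lborel (\<lambda>y. indicator (ball (0::'a) r) y * (\<phi> (x + y))\<^sup>2)"
proof -
  obtain C where C: "C > 0" "\<And>x. \<bar>\<phi> x\<bar> \<le> C" using test_function_bounded[OF \<phi>] by blast
  note [measurable] = test_function_measurable[OF \<phi>]
  have f: "emeasure lborel (ball (0::'a) r) < \<infinity>" by (rule emeasure_bounded_finite) simp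
  have sq: "\<bar>a\<^sup>2\<bar> \<le> K\<^sup>2" if "\<bar>a\<bar> \<le> K" for a K :: real
    using power_mono[OF that, of 2] by simp
  have b1: "\<bar>c - \<phi> (x + y)\<bar> \<le> \<bar>c\<bar> + C" for y using C(2)[of "x + y"] by linarith
  have b2: "\<bar>\<phi> (x + y) - \<phi> (z + y)\<bar> \<le> 2 * C" for y using C(2)[of "x + y"] C(2)[of "z + y"] by linarith
  show "integrable lborel (\<lambda>y. indicator (ball (0::'a) r) y * (c - \<phi> (x + y)))"
    by (rule integrable_indicator_mult_bounded[OF _ f _ b1]) auto
  show "integrable lborel (\<lambda>y. indicator (ball (0::'a) r) y * (c - \<phi> (x + y))\<^sup>2)"
    by (rule integrable_indicator_mult_bounded[OF _ f _ sq[OF b1]]) auto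
  show "integrable lborel (\<lambda>y. indicator (ball (0::'a) r) y * \<phi> (x + y))"
    by (rule integrable_indicator_mult_bounded[OF _ f _ C(2)]) auto
  show "integrable lborel (\<lambda>y. indicator (ball (0::'a) r) y * (\<phi> (x + y) - \<phi> (z + y)))"
    by (rule integrable_indicator_mult_bounded[OF _ f _ b2]) auto
  show "integrable lborel (\<lambda>y. indicator (ball (0::'a) r) y * (\<phi> (x + y) - \<phi> (z + y))\<^sup>2)"
    by (rule integrable_indicator_mult_bounded[OF _ f _ sq[OF b2]]) auto
  show "integrable lborel (\<lambda>y. indicator (ball (0::'a) r) y * (\<phi> (x + y))\<^sup>2)"
    by (rule integrable_indicator_mult_bounded[OF _ f _ sq[OF C(2)]]) auto
qed

text \<open>Parametrised integrals and Tonelli's theorem require the ball indicator to be measurable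
  jointly in both variables.\<close>

lemma pred_snd_ball [measurable]: "Measurable.pred (borel \<Otimes>\<^sub>M borel) (\<lambda>x. snd x \<in> ball (0::'a) r)"
  by (rule pred_sets2[OF _ measurable_snd]) simp

lemma ball_int_measurable:
  assumes \<phi>: "\<phi> \<in> test_functions \<Omega>"
  shows "ball_int r \<phi> \<in> borel_measurable borel"
proof -
  note [measurable] = test_function_measurable[OF \<phi>]
  show ?thesis unfolding ball_int_def[abs_def] by measurable
qed

text \<open>The difference is the integral of \<phi>(x) - \<phi>(x + y) over |y| < r, so
  Cauchy-Schwarz on the ball and the translation estimate apply. After division by the volume, the
  average is within r times the gradient norm of \<phi> in L2.\<close>

lemma ball_int_approx:
  assumes \<phi>: "\<phi> \<in> test_functions \<Omega>" and r: "0 < r"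
  shows "(\<integral>\<^sup>+x. ennreal ((measure lborel (ball (0::'a) r) * \<phi> x - ball_int r \<phi> x)\<^sup>2) \<partial>lborel) \<le>
    ennreal ((measure lborel (ball (0::'a) r) * r * grad_norm \<Omega> \<phi>)\<^sup>2)"
proof -
  let ?v = "measure lborel (ball (0::'a) r)" and ?G = "grad_norm \<Omega> \<phi>"
  note [measurable] = test_function_measurable[OF \<phi>]
  have f: "emeasure lborel (ball (0::'a) r) < \<infinity>" by (rule emeasure_bounded_finite) simp
  have fv: "emeasure lborel (ball (0::'a) r) = ennreal ?v"
    using f by (intro emeasure_eq_ennreal_measure) auto
  have pt: "ennreal ((?v * \<phi> x - ball_int r \<phi> x)\<^sup>2) \<le>
      ennreal ?v * (\<integral>\<^sup>+y. indicator (ball (0::'a) r) y * ennreal ((\<phi> (x + y) - \<phi> x)\<^sup>2) \<partial>lborel)" for x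
  proof -
    have "integrable lborel (\<lambda>y. indicator (ball (0::'a) r) y * \<phi> x)"
      using f by (intro integrable_mult_left integrable_real_indicator) auto
    then have "?v * \<phi> x - ball_int r \<phi> x = (LINT y|lborel. indicator (ball (0::'a) r) y * (\<phi> x - \<phi> (x + y)))"
      using ball_int_integrable(3)[OF \<phi>] f by (simp add: ball_int_def right_diff_distrib)
    then have "(?v * \<phi> x - ball_int r \<phi> x)\<^sup>2 \<le> ?v * (LINT y|lborel. indicator (ball (0::'a) r) y * (\<phi> x - \<phi> (x + y))\<^sup>2)"
      using integral_sq_le[OF _ f measure_ball_pos[OF r] ball_int_integrable(1,2)[OF \<phi>]] by simp
    then have "ennreal ((?v * \<phi> x - ball_int r \<phi> x)\<^sup>2) \<le>
        ennreal (?v * (LINT y|lborel. indicator (ball (0::'a) r) y * (\<phi> x - \<phi> (x + y))\<^sup>2))"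
      by (rule ennreal_leI)
    also have "\<dots> = ennreal ?v * (\<integral>\<^sup>+y. indicator (ball (0::'a) r) y * ennreal ((\<phi> x - \<phi> (x + y))\<^sup>2) \<partial>lborel)"
      by (subst nn_integral_indicator_eq[OF ball_int_integrable(2)[OF \<phi>], symmetric])
         (auto intro!: ennreal_mult integral_nonneg_AE)
    finally show ?thesis by (simp add: power2_commute)
  qed
  have "(\<integral>\<^sup>+x. ennreal ((?v * \<phi> x - ball_int r \<phi> x)\<^sup>2) \<partial>lborel) \<le>
     (\<integral>\<^sup>+x. ennreal ?v * (\<integral>\<^sup>+y. indicator (ball (0::'a) r) y * ennreal ((\<phi> (x + y) - \<phi> x)\<^sup>2) \<partial>lborel) \<partial>lborel)"
    by (rule nn_integral_mono) (rule pt)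
  also have "\<dots> = ennreal ?v * (\<integral>\<^sup>+x. \<integral>\<^sup>+y. indicator (ball (0::'a) r) y * ennreal ((\<phi> (x + y) - \<phi> x)\<^sup>2) \<partial>lborel \<partial>lborel)"
    by (rule nn_integral_cmult) measurable
  also have "\<dots> \<le> ennreal ?v * (ennreal ((r * ?G)\<^sup>2) * ennreal ?v)"
  proof (rule mult_left_mono)
  have "(\<integral>\<^sup>+x. \<integral>\<^sup>+y. indicator (ball (0::'a) r) y * ennreal ((\<phi> (x + y) - \<phi> x)\<^sup>2) \<partial>lborel \<partial>lborel) =
      (\<integral>\<^sup>+y. \<integral>\<^sup>+x. indicator (ball (0::'a) r) y * ennreal ((\<phi> (x + y) - \<phi> x)\<^sup>2) \<partial>lborel \<partial>lborel)"
    by (rule lborel_pair.Fubini'[symmetric]) measurable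
  also have "\<dots> \<le> (\<integral>\<^sup>+y. ennreal ((r * ?G)\<^sup>2) * indicator (ball 0 r) (y::'a) \<partial>lborel)"
  proof (rule nn_integral_mono)
    fix y :: 'a
    have "(\<integral>\<^sup>+x. indicator (ball (0::'a) r) y * ennreal ((\<phi> (x + y) - \<phi> x)\<^sup>2) \<partial>lborel) =
        indicator (ball (0::'a) r) y * (\<integral>\<^sup>+x. ennreal ((\<phi> (x + y) - \<phi> x)\<^sup>2) \<partial>lborel)"
      by (rule nn_integral_cmult) measurable
    also have "\<dots> \<le> indicator (ball (0::'a) r) y * ennreal ((norm y * ?G)\<^sup>2)"
      by (intro mult_left_mono translation_estimate \<phi>) simp
    also have "\<dots> \<le> ennreal ((r * ?G)\<^sup>2) * indicator (ball (0::'a) r) y"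
      using r by (auto simp: indicator_def intro!: ennreal_leI power_mono mult_right_mono)
    finally show "(\<integral>\<^sup>+x. indicator (ball (0::'a) r) y * ennreal ((\<phi> (x + y) - \<phi> x)\<^sup>2) \<partial>lborel) \<le>
      ennreal ((r * ?G)\<^sup>2) * indicator (ball (0::'a) r) y" .
  qed
  also have "\<dots> = ennreal ((r * ?G)\<^sup>2) * ennreal ?v"
    by (subst nn_integral_cmult_indicator) (simp_all add: fv)
  finally show "(\<integral>\<^sup>+x. \<integral>\<^sup>+y. indicator (ball (0::'a) r) y * ennreal ((\<phi> (x + y) - \<phi> x)\<^sup>2) \<partial>lborel \<partial>lborel) \<le>
      ennreal ((r * ?G)\<^sup>2) * ennreal ?v" .
  qed simp
  also have "\<dots> = ennreal (?v * ((r * ?G)\<^sup>2 * ?v))"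
    by (simp add: ennreal_mult)
  also have "?v * ((r * ?G)\<^sup>2 * ?v) = (?v * r * ?G)\<^sup>2"
    by (simp add: power_mult_distrib power2_eq_square)
  finally show ?thesis .
qed

text \<open>The two averages differ by a translation through x - z, so the same two estimates apply.
  For a fixed radius this is equicontinuity of the averages of a family with bounded
  gradients.\<close>

lemma ball_int_Lipschitz:
  assumes \<phi>: "\<phi> \<in> test_functions \<Omega>" and r: "0 < r"
  shows "\<bar>ball_int r \<phi> x - ball_int r \<phi> z\<bar> \<le> sqrt (measure lborel (ball (0::'a) r)) * grad_norm \<Omega> \<phi> * norm (x - z)"
proof -
  let ?v = "measure lborel (ball (0::'a) r)" and ?G = "grad_norm \<Omega> \<phi>"
  note [measurable] = test_function_measurable[OF \<phi>]
  have f: "emeasure lborel (ball (0::'a) r) < \<infinity>" by (rule emeasure_bounded_finite) simp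
  let ?q = "LINT y|lborel. indicator (ball (0::'a) r) y * (\<phi> (x + y) - \<phi> (z + y))\<^sup>2"
  have "ball_int r \<phi> x - ball_int r \<phi> z = (LINT y|lborel. indicator (ball (0::'a) r) y * (\<phi> (x + y) - \<phi> (z + y)))"
    using ball_int_integrable(3)[OF \<phi>] by (simp add: ball_int_def right_diff_distrib)
  then have 1: "(ball_int r \<phi> x - ball_int r \<phi> z)\<^sup>2 \<le> ?v * ?q"
    using integral_sq_le[OF _ f measure_ball_pos[OF r] ball_int_integrable(4,5)[OF \<phi>]] by simp
  have "ennreal ?q \<le> ennreal ((norm (x - z) * ?G)\<^sup>2)"
  proof -
    have "ennreal ?q = (\<integral>\<^sup>+y. indicator (ball (0::'a) r) y * ennreal ((\<phi> (x + y) - \<phi> (z + y))\<^sup>2) \<partial>lborel)"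
      by (rule nn_integral_indicator_eq[OF ball_int_integrable(5)[OF \<phi>]]) simp
    also have "\<dots> \<le> (\<integral>\<^sup>+y. ennreal ((\<phi> ((y + z) + (x - z)) - \<phi> (y + z))\<^sup>2) \<partial>lborel)"
      by (intro nn_integral_mono) (auto simp: indicator_def algebra_simps)
    also have "\<dots> = (\<integral>\<^sup>+y. ennreal ((\<phi> (y + (x - z)) - \<phi> y)\<^sup>2) \<partial>lborel)"
      by (rule nn_integral_lborel_translate[of "\<lambda>y. ennreal ((\<phi> (y + (x - z)) - \<phi> y)\<^sup>2)"]) measurable
    also have "\<dots> \<le> ennreal ((norm (x - z) * ?G)\<^sup>2)" by (rule translation_estimate[OF \<phi>])
    finally show ?thesis .
  qed
  then have "?q \<le> (norm (x - z) * ?G)\<^sup>2" by simp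
  then have "(ball_int r \<phi> x - ball_int r \<phi> z)\<^sup>2 \<le> ?v * (norm (x - z) * ?G)\<^sup>2"
    using 1 mult_left_mono[of ?q _ ?v] by fastforce
  also have "\<dots> = (sqrt ?v * ?G * norm (x - z))\<^sup>2"
    by (simp add: power_mult_distrib algebra_simps)
  finally have "\<bar>ball_int r \<phi> x - ball_int r \<phi> z\<bar> \<le> \<bar>sqrt ?v * ?G * norm (x - z)\<bar>"
    by (simp only: abs_le_square_iff)
  also have "\<bar>sqrt ?v * ?G * norm (x - z)\<bar> = sqrt ?v * ?G * norm (x - z)"
    by (intro abs_of_nonneg mult_nonneg_nonneg) auto
  finally show ?thesis .
qed

text \<open>Equiboundedness, the companion of the Lipschitz estimate for an argument of
  Arzela-Ascoli type.\<close>

lemma ball_int_bound: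
  assumes \<phi>: "\<phi> \<in> test_functions \<Omega>" and r: "0 < r"
  shows "\<bar>ball_int r \<phi> x\<bar> \<le> sqrt (measure lborel (ball (0::'a) r)) * Lp_norm 2 \<Omega> \<phi>"
proof -
  let ?v = "measure lborel (ball (0::'a) r)"
  note [measurable] = test_function_measurable[OF \<phi>]
  have f: "emeasure lborel (ball (0::'a) r) < \<infinity>" by (rule emeasure_bounded_finite) simp
  have p: "(\<lambda>x. \<phi> x * \<phi> x) \<in> test_functions \<Omega>" using \<phi> \<phi> by (rule test_function_mult)
  let ?q = "LINT y|lborel. indicator (ball (0::'a) r) y * (\<phi> (x + y))\<^sup>2"
  have 1: "(ball_int r \<phi> x)\<^sup>2 \<le> ?v * ?q"
    using integral_sq_le[OF _ f measure_ball_pos[OF r] ball_int_integrable(3,6)[OF \<phi>]] by (simp add: ball_int_def)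
  have "ennreal ?q \<le> ennreal ((Lp_norm 2 \<Omega> \<phi>)\<^sup>2)"
  proof -
    have "ennreal ?q = (\<integral>\<^sup>+y. indicator (ball (0::'a) r) y * ennreal ((\<phi> (x + y))\<^sup>2) \<partial>lborel)"
      by (rule nn_integral_indicator_eq[OF ball_int_integrable(6)[OF \<phi>]]) simp
    also have "\<dots> \<le> (\<integral>\<^sup>+y. ennreal ((\<phi> (y + x))\<^sup>2) \<partial>lborel)"
      by (intro nn_integral_mono) (auto simp: indicator_def algebra_simps)
    also have "\<dots> = (\<integral>\<^sup>+y. ennreal ((\<phi> y)\<^sup>2) \<partial>lborel)"
      by (rule nn_integral_lborel_translate[of "\<lambda>y. ennreal ((\<phi> y)\<^sup>2)"]) measurable
    also have "\<dots> = ennreal (LINT y|lborel. \<phi> y * \<phi> y)"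
      using test_function_integrable_lborel[OF p] by (subst nn_integral_eq_integral[symmetric]) (auto simp: power2_eq_square)
    also have "(LINT y|lborel. \<phi> y * \<phi> y) = (LINT y|lebesgue_on \<Omega>. \<phi> y * \<phi> y)"
      by (intro integral_lebesgue_on_eq_lborel[symmetric] open_sets_lebesgue[OF \<Omega>] test_function_measurable[OF p]
          test_function_outside[OF p])
    finally show ?thesis by (simp add: Lp2_norm_sq L2_inner_def)
  qed
  then have "?q \<le> (Lp_norm 2 \<Omega> \<phi>)\<^sup>2" by simp
  then have "(ball_int r \<phi> x)\<^sup>2 \<le> ?v * (Lp_norm 2 \<Omega> \<phi>)\<^sup>2"
    using 1 mult_left_mono[of ?q _ ?v] by fastforce
  also have "\<dots> = (sqrt ?v * Lp_norm 2 \<Omega> \<phi>)\<^sup>2" by (simp add: power_mult_distrib)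
  finally have "\<bar>ball_int r \<phi> x\<bar> \<le> \<bar>sqrt ?v * Lp_norm 2 \<Omega> \<phi>\<bar>"
    by (simp only: abs_le_square_iff)
  also have "\<bar>sqrt ?v * Lp_norm 2 \<Omega> \<phi>\<bar> = sqrt ?v * Lp_norm 2 \<Omega> \<phi>"
    by (intro abs_of_nonneg mult_nonneg_nonneg) auto
  finally show ?thesis .
qed

text \<open>For each fixed radius the averages are equibounded and equi-Lipschitz, so convergence at
  a dense set of points gives convergence everywhere. Dominated convergence on the bounded set
  \<Omega> makes the averages Cauchy in L2, and \<open>ball_int_approx\<close> carries this over to
  the functions themselves.\<close>

lemma Rellich_test_functions:
  assumes bdd: "bounded \<Omega>" and \<phi>: "\<And>n::nat. \<phi> n \<in> test_functions \<Omega>"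
    and C: "\<And>n. Lp_norm 2 \<Omega> (\<phi> n) \<le> C" "\<And>n. grad_norm \<Omega> (\<phi> n) \<le> C"
  obtains k where "strict_mono (k :: nat \<Rightarrow> nat)"
    "\<And>e. 0 < e \<Longrightarrow> \<exists>N. \<forall>m\<ge>N. \<forall>n\<ge>N. Lp_norm 2 \<Omega> (\<lambda>x. \<phi> (k m) x - \<phi> (k n) x) \<le> e"
proof -
  let ?v = "\<lambda>r. measure lborel (ball (0::'a) r)"
  define r where "r j = inverse (real (Suc j))" for j
  have r: "0 < r j" "r j \<le> 1" for j by (auto simp: r_def inverse_le_1_iff)
  have C0: "0 \<le> C" using order_trans[OF Lp_norm_nonneg C(1)] .
  obtain Q :: "'a set" where Q: "countable Q" "\<And>X. open X \<Longrightarrow> X \<noteq> {} \<Longrightarrow> \<exists>d\<in>Q. d \<in> X"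
    using countable_dense_exists by metis
  \<comment> \<open>Pairing points with radius indices lets a single diagonal extraction serve all
    radii \<open>r j\<close> at once.\<close>
  let ?S = "Q \<times> (UNIV :: nat set)"
  have bd: "\<bar>ball_int (r j) (\<phi> n) x\<bar> \<le> sqrt (?v 1) * C" for j n x
  proof -
    have "?v (r j) \<le> ?v 1" using r(2)[of j] emeasure_bounded_finite[OF bounded_ball, of "0::'a" 1]
      by (intro measure_mono_fmeasurable) (auto simp: fmeasurable_def)
    then have "sqrt (?v (r j)) * Lp_norm 2 \<Omega> (\<phi> n) \<le> sqrt (?v 1) * C"
      using C(1) by (intro mult_mono) auto
    then show ?thesis using ball_int_bound[OF \<phi> r(1), of j n x] by linarith
  qed
  obtain k where k: "strict_mono (k :: nat \<Rightarrow> nat)"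
    "\<And>z. z \<in> ?S \<Longrightarrow> \<exists>l. (\<lambda>n. ball_int (r (snd z)) (\<phi> (k n)) (fst z)) \<longlonglongrightarrow> l"
    using function_convergent_subsequence[of ?S "\<lambda>n z. ball_int (r (snd z)) (\<phi> n) (fst z)" "sqrt (?v 1) * C"]
      Q(1) bd by auto
  have conv: "convergent (\<lambda>n. ball_int (r j) (\<phi> (k n)) x)" for j x
  proof (rule Cauchy_convergent, rule CauchyI)
    fix e :: real assume e: "e > 0"
    define L where "L = sqrt (?v (r j)) * C"
    have L: "L \<ge> 0" using C0 by (simp add: L_def)
    have lip: "\<bar>ball_int (r j) (\<phi> n) x - ball_int (r j) (\<phi> n) z\<bar> \<le> L * norm (x - z)" for n z
    proof -
      have "sqrt (?v (r j)) * grad_norm \<Omega> (\<phi> n) * norm (x - z) \<le> L * norm (x - z)"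
        unfolding L_def using C(2) by (intro mult_right_mono mult_left_mono) auto
      then show ?thesis using ball_int_Lipschitz[OF \<phi> r(1), of j n x z] by linarith
    qed
    \<comment> \<open>A dense point d this close to x costs e / 3 for each of the two averages by
      the Lipschitz bound; the Cauchy property at d accounts for the last third. L itself may be 0,
      hence L + 1.\<close>
    have "0 < e / (3 * (L + 1))" using e L by simp
    then have "ball x (e / (3 * (L + 1))) \<noteq> {}" by (metis centre_in_ball empty_iff)
    then obtain d where d: "d \<in> Q" "d \<in> ball x (e / (3 * (L + 1)))"
      using Q(2)[OF open_ball] by blast
    have "L * norm (x - d) \<le> (L + 1) * norm (x - d)" by (intro mult_right_mono) auto
    also have "\<dots> < (L + 1) * (e / (3 * (L + 1)))"
      using d(2) L by (intro mult_strict_left_mono) (auto simp: dist_norm)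
    also have "\<dots> = e / 3" using L by (simp add: field_simps)
    finally have Ld: "L * norm (x - d) < e / 3" .
    have "Cauchy (\<lambda>n. ball_int (r j) (\<phi> (k n)) d)"
      using k(2)[of "(d, j)"] d(1) by (auto intro: LIMSEQ_imp_Cauchy)
    then obtain N where N: "\<And>m n. m \<ge> N \<Longrightarrow> n \<ge> N \<Longrightarrow>
        norm (ball_int (r j) (\<phi> (k m)) d - ball_int (r j) (\<phi> (k n)) d) < e / 3"
      using CauchyD[of _ "e / 3"] e by (metis divide_pos_pos zero_less_numeral)
    show "\<exists>N. \<forall>m\<ge>N. \<forall>n\<ge>N. norm (ball_int (r j) (\<phi> (k m)) x - ball_int (r j) (\<phi> (k n)) x) < e"
    proof (intro exI[of _ N] allI impI)
      fix m n assume "m \<ge> N" "n \<ge> N"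
      then show "norm (ball_int (r j) (\<phi> (k m)) x - ball_int (r j) (\<phi> (k n)) x) < e"
        using N[of m n] lip[of "k m" d] lip[of "k n" d] Ld unfolding real_norm_def by linarith
    qed
  qed
  have L2c: "\<exists>N. \<forall>n\<ge>N. \<forall>m\<ge>N. Lp_norm 2 \<Omega> (\<lambda>x. ball_int (r j) (\<phi> (k n)) x - ball_int (r j) (\<phi> (k m)) x) \<le> e
      \<and> ball_int (r j) (\<phi> (k n)) \<in> Lp 2 \<Omega>"
    if e: "e > 0" for j e
  proof -
    interpret finite_measure "lebesgue_on \<Omega>" using \<Omega> bdd by (rule finite_measure_lebesgue_on)
    define a where "a n = ball_int (r j) (\<phi> (k n))" for n
    define l where "l x = lim (\<lambda>n. a n x)" for x
    define M where "M = sqrt (?v 1) * C"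
    have am [measurable]: "a n \<in> borel_measurable (lebesgue_on \<Omega>)" for n
      unfolding a_def using ball_int_measurable[OF \<phi>] by (intro measurable_restrict_space1 measurable_completion) simp
    have lm [measurable]: "l \<in> borel_measurable (lebesgue_on \<Omega>)" unfolding l_def by measurable
    have al: "(\<lambda>n. a n x) \<longlonglongrightarrow> l x" for x
      using conv[of j x] by (simp add: a_def l_def convergent_LIMSEQ_iff)
    have ab: "\<bar>a n x\<bar> \<le> M" for n x unfolding a_def M_def by (rule bd)
    have lb: "\<bar>l x\<bar> \<le> M" for x
      by (rule LIMSEQ_le_const2[OF tendsto_rabs[OF al]]) (use ab in auto)
    have mem: "f \<in> Lp 2 \<Omega>" if [measurable]: "f \<in> borel_measurable (lebesgue_on \<Omega>)" and "\<And>x. \<bar>f x\<bar> \<le> M" for f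
    proof -
      have "norm ((f x)\<^sup>2) \<le> M\<^sup>2" for x using power_mono[OF that(2), of x 2] by simp
      then have "integrable (lebesgue_on \<Omega>) (\<lambda>x. (f x)\<^sup>2)" by (intro integrable_const_bound[of _ "M\<^sup>2"]) auto
      then show ?thesis by (simp add: Lp_def)
    qed
    have a2: "a n \<in> Lp 2 \<Omega>" for n using am ab by (rule mem)
    have l2: "l \<in> Lp 2 \<Omega>" using lm lb by (rule mem)
    have "(\<lambda>n. LINT x|lebesgue_on \<Omega>. (a n x - l x)\<^sup>2) \<longlonglongrightarrow> (LINT x|lebesgue_on \<Omega>. 0)"
    proof (rule integral_dominated_convergence[where w = "\<lambda>x. (2 * M)\<^sup>2"])
      show "AE x in lebesgue_on \<Omega>. (\<lambda>n. (a n x - l x)\<^sup>2) \<longlonglongrightarrow> 0"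
      proof (rule AE_I2)
        fix x
        have "(\<lambda>n. (a n x - l x)\<^sup>2) \<longlonglongrightarrow> (l x - l x)\<^sup>2" by (intro tendsto_intros al)
        then show "(\<lambda>n. (a n x - l x)\<^sup>2) \<longlonglongrightarrow> 0" by simp
      qed
      fix n
      have "\<bar>a n x - l x\<bar> \<le> 2 * M" for x using ab[of n x] lb[of x] by linarith
      then show "AE x in lebesgue_on \<Omega>. norm ((a n x - l x)\<^sup>2) \<le> (2 * M)\<^sup>2"
        using power_mono[of "\<bar>a n _ - l _\<bar>" "2 * M" 2] by (intro AE_I2) simp
    qed auto
    then have "(\<lambda>n. (Lp_norm 2 \<Omega> (\<lambda>x. a n x - l x))\<^sup>2) \<longlonglongrightarrow> 0"
      unfolding Lp2_norm_sq by (simp add: L2_inner_def power2_eq_square)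
    then have "(\<lambda>n. Lp_norm 2 \<Omega> (\<lambda>x. a n x - l x)) \<longlonglongrightarrow> 0"
      using tendsto_real_sqrt[of _ 0] by fastforce
    then have "\<forall>\<^sub>F n in sequentially. Lp_norm 2 \<Omega> (\<lambda>x. a n x - l x) < e / 2"
      using e by (intro order_tendstoD) auto
    then obtain N where N: "\<And>n. n \<ge> N \<Longrightarrow> Lp_norm 2 \<Omega> (\<lambda>x. a n x - l x) < e / 2"
      by (auto simp: eventually_sequentially)
    show ?thesis
      unfolding a_def[symmetric]
    proof (intro exI[of _ N] allI impI conjI a2)
      fix n m assume nm: "N \<le> n" "N \<le> m"
      show "Lp_norm 2 \<Omega> (\<lambda>x. a n x - a m x) \<le> e"
        using Lp_norm_diff_triangle[OF _ a2[of n] l2 a2[of m]] N[OF nm(1)] N[OF nm(2)]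
          Lp_norm_minus_commute[of 2 \<Omega> l "a m"] by simp
    qed
  qed
  show thesis
  proof (rule that[OF k(1)])
    fix e :: real assume e: "e > 0"
    \<comment> \<open>The radius is fixed first: it makes the error between a function and its
      normalised average at most e / 3 for all n. Only then is N chosen, for this radius.\<close>
    obtain j where "inverse (real (Suc j)) < e / (3 * (C + 1))"
      using reals_Archimedean[of "e / (3 * (C + 1))"] e C0 by auto
    then have "r j * (3 * (C + 1)) < e"
      using C0 by (simp add: r_def pos_less_divide_eq)
    moreover have "r j * (3 * (C + 1)) = 3 * (r j * (C + 1))" by (rule mult.left_commute)
    ultimately have j: "r j * (C + 1) < e / 3" by linarith
    define v where "v = ?v (r j)"
    have v: "v > 0" unfolding v_def by (rule measure_ball_pos[OF r(1)])
    have ev: "v * e / 3 > 0" using v e by simp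
    let ?a = "\<lambda>n. ball_int (r j) (\<phi> (k n))"
    obtain N where N: "\<And>n m. n \<ge> N \<Longrightarrow> m \<ge> N \<Longrightarrow> Lp_norm 2 \<Omega> (\<lambda>x. ?a n x - ?a m x) \<le> v * e / 3"
      and a2: "\<And>n. n \<ge> N \<Longrightarrow> ?a n \<in> Lp 2 \<Omega>" using L2c[OF ev, of j] by blast
    have near: "Lp_norm 2 \<Omega> (\<lambda>x. v * \<phi> (k n) x - ?a n x) \<le> v * e / 3" for n
    proof -
      have m: "(\<lambda>x. v * \<phi> (k n) x - ?a n x) \<in> borel_measurable borel"
        using ball_int_measurable[OF \<phi>] test_function_measurable[OF \<phi>] by measurable
      have "(\<integral>\<^sup>+x. ennreal (\<bar>v * \<phi> (k n) x - ?a n x\<bar> powr 2) \<partial>lebesgue_on \<Omega>) \<le>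
          (\<integral>\<^sup>+x. ennreal ((v * \<phi> (k n) x - ?a n x)\<^sup>2) \<partial>lebesgue)"
        using open_sets_lebesgue[OF \<Omega>]
        by (subst nn_integral_restrict_space) (auto intro!: nn_integral_mono simp: indicator_def)
      also have "\<dots> = (\<integral>\<^sup>+x. ennreal ((v * \<phi> (k n) x - ?a n x)\<^sup>2) \<partial>lborel)"
        by (rule nn_integral_completion)
      also have "\<dots> \<le> ennreal ((v * r j * grad_norm \<Omega> (\<phi> (k n)))\<^sup>2)"
        unfolding v_def by (rule ball_int_approx[OF \<phi> r(1)])
      also have "\<dots> \<le> ennreal ((v * e / 3) powr 2)"
      proof (rule ennreal_leI)
        have "r j * grad_norm \<Omega> (\<phi> (k n)) \<le> r j * (C + 1)"
          using C(2)[of "k n"] r(1)[of j] by (intro mult_left_mono) auto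
        then have "v * (r j * grad_norm \<Omega> (\<phi> (k n))) \<le> v * (e / 3)"
          using j v by (intro mult_left_mono) auto
        then have "(v * r j * grad_norm \<Omega> (\<phi> (k n)))\<^sup>2 \<le> (v * e / 3)\<^sup>2"
          using v r(1)[of j] by (intro power_mono) (auto simp: mult.assoc)
        then show "(v * r j * grad_norm \<Omega> (\<phi> (k n)))\<^sup>2 \<le> (v * e / 3) powr 2" using ev by simp
      qed
      finally show ?thesis
        using m ev by (intro Lp_memI(2)[of 2]) (auto intro!: measurable_restrict_space1 measurable_completion)
    qed
    show "\<exists>N. \<forall>m\<ge>N. \<forall>n\<ge>N. Lp_norm 2 \<Omega> (\<lambda>x. \<phi> (k m) x - \<phi> (k n) x) \<le> e"
    proof (intro exI[of _ N] allI impI)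
      fix m n assume mn: "N \<le> m" "N \<le> n"
      have p2: "(\<lambda>x. v * \<phi> i x) \<in> Lp 2 \<Omega>" for i
        using test_function_Lp[OF \<phi> _ open_sets_lebesgue[OF \<Omega>], of 2] by (intro Lp_cmult) simp
      have "v * Lp_norm 2 \<Omega> (\<lambda>x. \<phi> (k m) x - \<phi> (k n) x) = Lp_norm 2 \<Omega> (\<lambda>x. v * \<phi> (k m) x - v * \<phi> (k n) x)"
        using v Lp_norm_cmult[of 2 \<Omega> v "\<lambda>x. \<phi> (k m) x - \<phi> (k n) x"] by (simp add: right_diff_distrib)
      also have "\<dots> \<le> v * e"
        using Lp_norm_diff_triangle[OF _ p2[of "k m"] a2[OF mn(1)] p2[of "k n"]]
          Lp_norm_diff_triangle[OF _ a2[OF mn(1)] a2[OF mn(2)] p2[of "k n"]] near[of m] near[of n] N[OF mn]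
          Lp_norm_minus_commute[of 2 \<Omega> "?a n" "\<lambda>x. v * \<phi> (k n) x"] by simp
      finally show "Lp_norm 2 \<Omega> (\<lambda>x. \<phi> (k m) x - \<phi> (k n) x) \<le> e" using v by simp
    qed
  qed
qed

text \<open>Replacing each \<open>u n\<close> by a test function within 1 / (n + 1) in both norms
  affects neither the boundedness of the sequence nor the Cauchy property of a subsequence.\<close>

lemma Rellich_H01:
  assumes bdd: "bounded \<Omega>" and u: "\<And>n::nat. u n \<in> H01 \<Omega>"
    and C: "\<And>n. Lp_norm 2 \<Omega> (u n) \<le> C" "\<And>n. grad_norm \<Omega> (u n) \<le> C"
  obtains k where "strict_mono (k :: nat \<Rightarrow> nat)"
    "\<And>e. 0 < e \<Longrightarrow> \<exists>N. \<forall>m\<ge>N. \<forall>n\<ge>N. Lp_norm 2 \<Omega> (\<lambda>x. u (k m) x - u (k n) x) \<le> e"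
proof -
  have "\<exists>\<phi>. \<phi> \<in> test_functions \<Omega> \<and> Lp_norm 2 \<Omega> (\<lambda>x. \<phi> x - u n x) < inverse (real (Suc n)) \<and>
      grad_norm \<Omega> (\<lambda>x. \<phi> x - u n x) < inverse (real (Suc n))" for n
  proof -
    have "inverse (real (Suc n)) > 0" by simp
    then show ?thesis using u[of n] unfolding H01_iff[OF \<Omega>] by blast
  qed
  then have "\<exists>\<phi>. \<forall>n. \<phi> n \<in> test_functions \<Omega> \<and> Lp_norm 2 \<Omega> (\<lambda>x. \<phi> n x - u n x) < inverse (real (Suc n)) \<and>
      grad_norm \<Omega> (\<lambda>x. \<phi> n x - u n x) < inverse (real (Suc n))" by (intro choice allI)
  then obtain \<phi> where \<phi>: "\<And>n. \<phi> n \<in> test_functions \<Omega>"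
    "\<And>n. Lp_norm 2 \<Omega> (\<lambda>x. \<phi> n x - u n x) < inverse (real (Suc n))"
    "\<And>n. grad_norm \<Omega> (\<lambda>x. \<phi> n x - u n x) < inverse (real (Suc n))" by blast
  have h: "\<phi> n \<in> H1 \<Omega>" "u n \<in> H1 \<Omega>" for n using test_function_H1[OF \<Omega> \<phi>(1)] H01_H1[OF \<Omega> u] by auto
  have h2: "\<phi> n \<in> Lp 2 \<Omega>" "u n \<in> Lp 2 \<Omega>" for n using H1_Lp2[OF \<Omega>] h by auto
  have inv1: "inverse (real (Suc n)) \<le> 1" for n by (simp add: inverse_le_1_iff)
  have b: "Lp_norm 2 \<Omega> (\<phi> n) \<le> C + 1" "grad_norm \<Omega> (\<phi> n) \<le> C + 1" for n
    using Lp_norm_abs_diff_le[OF _ h2(1)[of n] h2(2)[of n]] grad_norm_abs_diff_le[OF \<Omega> h(1)[of n] h(2)[of n]]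
      \<phi>(2,3)[of n] C[of n] inv1[of n] by auto
  obtain k where k: "strict_mono (k :: nat \<Rightarrow> nat)"
    "\<And>e. 0 < e \<Longrightarrow> \<exists>N. \<forall>m\<ge>N. \<forall>n\<ge>N. Lp_norm 2 \<Omega> (\<lambda>x. \<phi> (k m) x - \<phi> (k n) x) \<le> e"
    by (rule Rellich_test_functions[where \<phi> = \<phi>, OF bdd \<phi>(1) b]) blast
  show thesis
  proof (rule that[OF k(1)])
    fix e :: real assume e: "e > 0"
    then obtain N where N: "\<forall>m\<ge>N. \<forall>n\<ge>N. Lp_norm 2 \<Omega> (\<lambda>x. \<phi> (k m) x - \<phi> (k n) x) \<le> e / 3"
      using k(2)[of "e / 3"] by auto
    obtain K where K: "inverse (real (Suc K)) < e / 3" using reals_Archimedean[of "e / 3"] e by auto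
    have near: "Lp_norm 2 \<Omega> (\<lambda>x. \<phi> (k n) x - u (k n) x) \<le> e / 3" if "n \<ge> K" for n
    proof -
      have "K \<le> k n" using seq_suble[OF k(1), of n] that by simp
      then have "inverse (real (Suc (k n))) \<le> inverse (real (Suc K))" by (intro le_imp_inverse_le) auto
      then show ?thesis using \<phi>(2)[of "k n"] K by linarith
    qed
    show "\<exists>N. \<forall>m\<ge>N. \<forall>n\<ge>N. Lp_norm 2 \<Omega> (\<lambda>x. u (k m) x - u (k n) x) \<le> e"
    proof (intro exI[of _ "max N K"] allI impI)
      fix m n assume mn: "max N K \<le> m" "max N K \<le> n"
      then have "Lp_norm 2 \<Omega> (\<lambda>x. \<phi> (k m) x - \<phi> (k n) x) \<le> e / 3" using N by simp
      then show "Lp_norm 2 \<Omega> (\<lambda>x. u (k m) x - u (k n) x) \<le> e"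
        using Lp_norm_diff_triangle[OF _ h2(2)[of "k m"] h2(1)[of "k m"] h2(2)[of "k n"]]
          Lp_norm_diff_triangle[OF _ h2(1)[of "k m"] h2(1)[of "k n"] h2(2)[of "k n"]]
          near[of m] near[of n] mn Lp_norm_minus_commute[of 2 \<Omega> "u (k m)" "\<phi> (k m)"] by simp
    qed
  qed
qed

end

section \<open>Vector-valued functions of time\<close>

lemma bochner_simple_inner:
  assumes s: "bochner_simple M (Lp 2 \<Omega>) s" and y: "y \<in> Lp 2 \<Omega>"
  shows "integrable M (\<lambda>t. L2_inner \<Omega> (s t) y)"
    "(LINT t|M. L2_inner \<Omega> (s t) y) = L2_inner \<Omega> (simple_integral_in M s) y"
proof -
  let ?R = "s ` space M" and ?E = "\<lambda>z. {t \<in> space M. s t = z}"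
  have sf: "simple_function M s" and R: "?R \<subseteq> Lp 2 \<Omega>" and fin: "emeasure M {t \<in> space M. s t \<noteq> (\<lambda>x. 0)} \<noteq> \<infinity>"
    using s by (auto simp: bochner_simple_def)
  have fR: "finite ?R" using sf by (rule simple_functionD(1))
  have Em: "?E z \<in> sets M" for z
    using simple_functionD(2)[OF sf, of "{z}"] by (simp add: vimage_def Int_def conj_commute)
  have eq: "L2_inner \<Omega> (s t) y = (\<Sum>z\<in>?R. indicator (?E z) t * L2_inner \<Omega> z y)" if "t \<in> space M" for t
  proof -
    have "(\<Sum>z\<in>?R. indicator (?E z) t * L2_inner \<Omega> z y) = (\<Sum>z\<in>?R. if s t = z then L2_inner \<Omega> z y else 0)"
      using that by (intro sum.cong) (auto simp: indicator_def)
    also have "\<dots> = L2_inner \<Omega> (s t) y" using fR that by (simp add: sum.delta')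
    finally show ?thesis by simp
  qed
  have int: "integrable M (\<lambda>t. indicator (?E z) t * L2_inner \<Omega> z y) \<and>
      (LINT t|M. indicator (?E z) t * L2_inner \<Omega> z y) = measure M (?E z) * L2_inner \<Omega> z y" for z
  \<comment> \<open>Only preimages of nonzero values are known to have finite measure; the value 0
    contributes nothing to either side, whatever the measure of its preimage.\<close>
  proof (cases "z = (\<lambda>x. 0)")
    case True
    then show ?thesis by (simp add: L2_inner_def)
  next
    case False
    then have "emeasure M (?E z) \<le> emeasure M {t \<in> space M. s t \<noteq> (\<lambda>x. 0)}"
      using simple_functionD(2)[OF sf, of "- {\<lambda>x. 0}"]
      by (intro emeasure_mono) (auto simp: vimage_def Int_def conj_commute)
    also have "\<dots> < \<infinity>" using fin by (simp add: top.not_eq_extremum)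
    finally have lt: "emeasure M (?E z) < \<infinity>" .
    then have "integrable M (indicator (?E z) :: _ \<Rightarrow> real)" using Em by (intro integrable_real_indicator)
    moreover have "?E z \<inter> space M = ?E z" by auto
    ultimately show ?thesis by (simp add: mult.commute)
  qed
  show "integrable M (\<lambda>t. L2_inner \<Omega> (s t) y)"
    by (rule Bochner_Integration.integrable_cong[THEN iffD2, OF refl eq]) (use int in auto)
  have "(LINT t|M. L2_inner \<Omega> (s t) y) = (LINT t|M. (\<Sum>z\<in>?R. indicator (?E z) t * L2_inner \<Omega> z y))"
    by (rule Bochner_Integration.integral_cong[OF refl eq])
  also have "\<dots> = (\<Sum>z\<in>?R. LINT t|M. indicator (?E z) t * L2_inner \<Omega> z y)"
    by (rule Bochner_Integration.integral_sum) (rule conjunct1[OF int])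
  also have "\<dots> = (\<Sum>z\<in>?R. measure M (?E z) * L2_inner \<Omega> z y)"
    by (rule sum.cong[OF refl]) (rule conjunct2[OF int])
  also have "\<dots> = (\<Sum>z\<in>?R. L2_inner \<Omega> (\<lambda>x. measure M (?E z) * z x) y)"
    by (simp add: L2_inner_cmult_left)
  also have "\<dots> = L2_inner \<Omega> (simple_integral_in M s) y"
    unfolding simple_integral_in_def[abs_def]
    using R y by (intro L2_inner_sum_left[symmetric] Lp_cmult) auto
  finally show "(LINT t|M. L2_inner \<Omega> (s t) y) = L2_inner \<Omega> (simple_integral_in M s) y" .
qed

lemma bochner_simple_mem: "bochner_simple M X s \<Longrightarrow> t \<in> space M \<Longrightarrow> s t \<in> X"
  by (auto simp: bochner_simple_def)

text \<open>The pairings of the simple approximations converge almost everywhere. Their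
  \<open>lim\<close> is measurable as a total function and agrees with the pairing of v off a null
  set.\<close>

lemma strongly_measurable_inner:
  fixes J :: "real set"
  assumes J: "J \<in> sets lebesgue" and v: "strongly_measurable (lebesgue_on J) (Lp 2 \<Omega>) (Lp_norm 2 \<Omega>) v"
    and y: "y \<in> Lp 2 \<Omega>"
  shows "(\<lambda>t. L2_inner \<Omega> (v t) y) \<in> borel_measurable (lebesgue_on J)"
proof -
  obtain s where s: "\<And>n. bochner_simple (lebesgue_on J) (Lp 2 \<Omega>) (s n)"
    "AE t in lebesgue_on J. (\<lambda>n. Lp_norm 2 \<Omega> (\<lambda>x. s n t x - v t x)) \<longlonglongrightarrow> 0"
    and vX: "AE t in lebesgue_on J. v t \<in> Lp 2 \<Omega>"
    using v by (auto simp: strongly_measurable_def)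
  have m: "(\<lambda>t. lim (\<lambda>n. L2_inner \<Omega> (s n t) y)) \<in> borel_measurable (lebesgue_on J)"
    by (intro borel_measurable_lim_metric borel_measurable_integrable[OF bochner_simple_inner(1)[OF s(1) y]])
  have "AE t in lebesgue_on J. lim (\<lambda>n. L2_inner \<Omega> (s n t) y) = L2_inner \<Omega> (v t) y"
    using s(2) vX AE_space
  proof eventually_elim
    case (elim t)
    show ?case
      by (rule limI[OF L2_inner_tendsto[OF bochner_simple_mem[OF s(1) elim(3)] elim(2) y elim(1)]])
  qed
  then show ?thesis by (rule borel_measurable_lebesgue_on_cong_AE[OF J m])
qed

text \<open>Pairing with y is continuous and linear, so it commutes with the limit of simple
  integrals. All later use of vector-valued integrals passes through this reduction to scalar
  ones.\<close>

lemma has_bochner_integral_in_inner: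
  fixes J :: "real set"
  assumes J: "J \<in> sets lebesgue" and v: "has_bochner_integral_in (lebesgue_on J) (Lp 2 \<Omega>) (Lp_norm 2 \<Omega>) v h"
    and y: "y \<in> Lp 2 \<Omega>"
  shows "integrable (lebesgue_on J) (\<lambda>t. L2_inner \<Omega> (v t) y)"
    "(LINT t|lebesgue_on J. L2_inner \<Omega> (v t) y) = L2_inner \<Omega> h y"
proof -
  let ?M = "lebesgue_on J"
  obtain s where s: "\<And>n. bochner_simple ?M (Lp 2 \<Omega>) (s n)"
    "(\<lambda>n. \<integral>\<^sup>+t. ennreal (Lp_norm 2 \<Omega> (\<lambda>x. s n t x - v t x)) \<partial>?M) \<longlonglongrightarrow> 0"
    "(\<lambda>n. Lp_norm 2 \<Omega> (\<lambda>x. simple_integral_in ?M (s n) x - h x)) \<longlonglongrightarrow> 0"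
    and sm: "strongly_measurable ?M (Lp 2 \<Omega>) (Lp_norm 2 \<Omega>) v" and h: "h \<in> Lp 2 \<Omega>"
    using v by (auto simp: has_bochner_integral_in_def)
  have vX: "AE t in ?M. v t \<in> Lp 2 \<Omega>" using sm by (simp add: strongly_measurable_def)
  have vm [measurable]: "(\<lambda>t. L2_inner \<Omega> (v t) y) \<in> borel_measurable ?M"
    by (rule strongly_measurable_inner[OF J sm y])
  have si: "integrable ?M (\<lambda>t. L2_inner \<Omega> (s n t) y)" for n using bochner_simple_inner(1)[OF s(1) y] .
  note [measurable] = borel_measurable_integrable[OF si]
  define C where "C = Lp_norm 2 \<Omega> y"
  let ?d = "\<lambda>n. \<integral>\<^sup>+t. ennreal (norm (L2_inner \<Omega> (s n t) y - L2_inner \<Omega> (v t) y)) \<partial>?M"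
  \<comment> \<open>Measurability of the norm integrand on the right has not been established, so a
    constant cannot be pulled out of that integral. Its inverse is moved into the left integrand
    instead, which is measurable; C + 1 makes the inverse meaningful when C = 0.\<close>
  have le: "?d n \<le> ennreal (C + 1) * (\<integral>\<^sup>+t. ennreal (Lp_norm 2 \<Omega> (\<lambda>x. s n t x - v t x)) \<partial>?M)" for n
  proof -
    have "(\<integral>\<^sup>+t. ennreal (inverse (C + 1) * norm (L2_inner \<Omega> (s n t) y - L2_inner \<Omega> (v t) y)) \<partial>?M) \<le>
       (\<integral>\<^sup>+t. ennreal (Lp_norm 2 \<Omega> (\<lambda>x. s n t x - v t x)) \<partial>?M)"
    proof (rule nn_integral_mono_AE, use vX AE_space in eventually_elim)
      case (elim t)
      have sX: "s n t \<in> Lp 2 \<Omega>" using bochner_simple_mem[OF s(1) elim(2)] .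
      have C: "C \<ge> 0" by (simp add: C_def)
      have "norm (L2_inner \<Omega> (s n t) y - L2_inner \<Omega> (v t) y) \<le> Lp_norm 2 \<Omega> (\<lambda>x. s n t x - v t x) * C"
        using L2_Cauchy_Schwarz[OF Lp_diff[OF _ sX elim(1)] y] sX elim(1) y by (simp add: L2_inner_diff_left C_def)
      also have "\<dots> \<le> Lp_norm 2 \<Omega> (\<lambda>x. s n t x - v t x) * (C + 1)" by (intro mult_left_mono) auto
      finally show ?case using C by (intro ennreal_leI) (simp add: field_simps)
    qed
    then have "ennreal (C + 1) * (\<integral>\<^sup>+t. ennreal (inverse (C + 1) * norm (L2_inner \<Omega> (s n t) y - L2_inner \<Omega> (v t) y)) \<partial>?M)
      \<le> ennreal (C + 1) * (\<integral>\<^sup>+t. ennreal (Lp_norm 2 \<Omega> (\<lambda>x. s n t x - v t x)) \<partial>?M)"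
      by (rule mult_left_mono) simp
    moreover have "ennreal (C + 1) * (\<integral>\<^sup>+t. ennreal (inverse (C + 1) * norm (L2_inner \<Omega> (s n t) y - L2_inner \<Omega> (v t) y)) \<partial>?M) = ?d n"
    proof -
      have C: "C + 1 > 0" by (simp add: C_def add_nonneg_pos)
      have "ennreal (C + 1) * ennreal (inverse (C + 1) * r) = ennreal r" if "r \<ge> 0" for r
        using C that by (subst ennreal_mult[symmetric]) (auto simp: mult.assoc[symmetric])
      then show ?thesis by (subst nn_integral_cmult[symmetric]) auto
    qed
    ultimately show ?thesis by simp
  qed
  have "(\<lambda>n. ennreal (C + 1) * (\<integral>\<^sup>+t. ennreal (Lp_norm 2 \<Omega> (\<lambda>x. s n t x - v t x)) \<partial>?M)) \<longlonglongrightarrow> ennreal (C + 1) * 0"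
    by (intro ennreal_tendsto_cmult s(2)) simp
  then have d0: "?d \<longlonglongrightarrow> 0"
    by (intro tendsto_sandwich[OF _ _ tendsto_const, where g = ?d]) (use le in auto)
  then have "\<forall>\<^sub>F n in sequentially. ?d n < 1" by (rule order_tendstoD) simp
  then obtain n where n: "?d n < 1" by (auto simp: eventually_sequentially)
  have "integrable ?M (\<lambda>t. L2_inner \<Omega> (s n t) y - L2_inner \<Omega> (v t) y)"
    using n by (intro integrableI_bounded) (auto intro: less_trans)
  from Bochner_Integration.integrable_diff[OF si[of n] this]
  show vi: "integrable ?M (\<lambda>t. L2_inner \<Omega> (v t) y)" by simp
  have "(\<lambda>n. LINT t|?M. L2_inner \<Omega> (s n t) y) \<longlonglongrightarrow> (LINT t|?M. L2_inner \<Omega> (v t) y)"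
    by (rule tendsto_L1_int[OF si vi d0])
  moreover have "(\<lambda>n. LINT t|?M. L2_inner \<Omega> (s n t) y) \<longlonglongrightarrow> L2_inner \<Omega> h y"
    unfolding bochner_simple_inner(2)[OF s(1) y]
  proof (rule L2_inner_tendsto[OF _ h y s(3)])
    fix n show "simple_integral_in ?M (s n) \<in> Lp 2 \<Omega>"
      unfolding simple_integral_in_def[abs_def] using s(1)[of n] by (intro Lp_sum Lp_cmult) (auto simp: bochner_simple_def)
  qed
  ultimately show "(LINT t|?M. L2_inner \<Omega> (v t) y) = L2_inner \<Omega> h y" by (rule LIMSEQ_unique)
qed

section \<open>Weak time derivatives\<close>

lemma weak_time_deriv_inner:
  assumes J: "J \<in> sets lebesgue" and w: "has_weak_time_deriv \<Omega> J u v" and \<eta>: "\<eta> \<in> test_functions J" and y: "y \<in> Lp 2 \<Omega>"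
  shows "(LINT t|lebesgue_on J. deriv \<eta> t * L2_inner \<Omega> (u t) y) = - (LINT t|lebesgue_on J. \<eta> t * L2_inner \<Omega> (v t) y)"
proof -
  obtain h where h: "has_bochner_integral_in (lebesgue_on J) (Lp 2 \<Omega>) (Lp_norm 2 \<Omega>) (\<lambda>t x. deriv \<eta> t * u t x) h"
    "has_bochner_integral_in (lebesgue_on J) (Lp 2 \<Omega>) (Lp_norm 2 \<Omega>) (\<lambda>t x. \<eta> t * v t x) (\<lambda>x. - h x)"
    using w \<eta> unfolding has_weak_time_deriv_def by blast
  have "L2_inner \<Omega> (\<lambda>x. - h x) y = - L2_inner \<Omega> h y" by (simp add: L2_inner_def)
  then show ?thesis
    using has_bochner_integral_in_inner(2)[OF J h(1) y] has_bochner_integral_in_inner(2)[OF J h(2) y]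
    by (simp add: L2_inner_cmult_left)
qed

lemma L2L2_inner_Lp2:
  assumes J: "J \<in> sets lebesgue" and v: "v \<in> L2L2 J \<Omega>" and y: "y \<in> Lp 2 \<Omega>"
  shows "(\<lambda>t. L2_inner \<Omega> (v t) y) \<in> Lp 2 J"
proof -
  have sm: "strongly_measurable (lebesgue_on J) (Lp 2 \<Omega>) (Lp_norm 2 \<Omega>) v"
    and vi: "integrable (lebesgue_on J) (\<lambda>t. Lp_norm 2 \<Omega> (v t) powr 2)"
    using v by (auto simp: bochner_Lq_def)
  have vX: "AE t in lebesgue_on J. v t \<in> Lp 2 \<Omega>" using sm by (simp add: strongly_measurable_def)
  note [measurable] = strongly_measurable_inner[OF J sm y]
  have "integrable (lebesgue_on J) (\<lambda>t. (L2_inner \<Omega> (v t) y)\<^sup>2)"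
  proof (rule Bochner_Integration.integrable_bound)
    show "integrable (lebesgue_on J) (\<lambda>t. Lp_norm 2 \<Omega> (v t) powr 2 * (Lp_norm 2 \<Omega> y)\<^sup>2)"
      using vi by (rule integrable_mult_left)
    show "AE t in lebesgue_on J. norm ((L2_inner \<Omega> (v t) y)\<^sup>2) \<le> norm (Lp_norm 2 \<Omega> (v t) powr 2 * (Lp_norm 2 \<Omega> y)\<^sup>2)"
      using vX
    proof eventually_elim
      case (elim t)
      show ?case
        using power_mono[OF L2_Cauchy_Schwarz[OF elim y] abs_ge_zero, of 2] by (simp add: power_mult_distrib)
    qed
  qed measurable
  then show ?thesis by (simp add: Lp_def)
qed

text \<open>The values of the approximating simple functions replace a countable dense subset of \<open>L\<^sup>2\<close>.\<close>

lemma AE_eq_if_inner_AE_eq: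
  fixes J1 J2 :: "real set"
  assumes J: "J1 \<in> sets lebesgue" "J2 \<in> sets lebesgue" "J1 \<subseteq> J2"
    and v: "strongly_measurable (lebesgue_on J1) (Lp 2 \<Omega>) (Lp_norm 2 \<Omega>) v"
    and w: "strongly_measurable (lebesgue_on J2) (Lp 2 \<Omega>) (Lp_norm 2 \<Omega>) w"
    and eq: "\<And>y. y \<in> Lp 2 \<Omega> \<Longrightarrow> AE t in lebesgue_on J1. L2_inner \<Omega> (v t) y = L2_inner \<Omega> (w t) y"
  shows "AE t in lebesgue_on J1. v t \<in> Lp 2 \<Omega> \<and> w t \<in> Lp 2 \<Omega> \<and> (AE x in lebesgue_on \<Omega>. v t x = w t x)"
proof -
  have sub: "AE t in lebesgue_on J1. P t" if "AE t in lebesgue_on J2. P t" for P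
    using that J by (auto simp: AE_restrict_space_iff elim!: eventually_mono)
  obtain s where s: "\<And>n. bochner_simple (lebesgue_on J1) (Lp 2 \<Omega>) (s n)"
    "AE t in lebesgue_on J1. (\<lambda>n. Lp_norm 2 \<Omega> (\<lambda>x. s n t x - v t x)) \<longlonglongrightarrow> 0"
    and vX: "AE t in lebesgue_on J1. v t \<in> Lp 2 \<Omega>"
    using v by (auto simp: strongly_measurable_def)
  obtain r where r: "\<And>n. bochner_simple (lebesgue_on J2) (Lp 2 \<Omega>) (r n)"
    "AE t in lebesgue_on J2. (\<lambda>n. Lp_norm 2 \<Omega> (\<lambda>x. r n t x - w t x)) \<longlonglongrightarrow> 0"
    and wX: "AE t in lebesgue_on J2. w t \<in> Lp 2 \<Omega>"
    using w by (auto simp: strongly_measurable_def)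
  let ?Y = "(\<Union>n. s n ` J1) \<union> (\<Union>n. r n ` J2)"
  have "finite (s n ` J1)" "s n ` J1 \<subseteq> Lp 2 \<Omega>" "finite (r n ` J2)" "r n ` J2 \<subseteq> Lp 2 \<Omega>" for n
    using s(1)[of n] r(1)[of n] simple_functionD(1)[of "lebesgue_on J1" "s n"] simple_functionD(1)[of "lebesgue_on J2" "r n"]
    by (auto simp: bochner_simple_def space_restrict_space)
  note sr = this
  have Y: "countable ?Y" "?Y \<subseteq> Lp 2 \<Omega>"
  proof -
    show "countable ?Y"
      using sr(1,3) by (auto intro!: countable_UN[OF countableI_type] intro: countable_finite)
    show "?Y \<subseteq> Lp 2 \<Omega>" by (intro Un_least UN_least sr(2,4))
  qed
  have "AE t in lebesgue_on J1. \<forall>y\<in>?Y. L2_inner \<Omega> (v t) y = L2_inner \<Omega> (w t) y"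
    unfolding AE_ball_countable[OF Y(1)] using eq Y(2) by blast
  with vX sub[OF wX] s(2) sub[OF r(2)] AE_space show ?thesis
  proof eventually_elim
    case (elim t)
    have t: "t \<in> J1" "t \<in> J2" using elim(5) J by (auto simp: space_restrict_space)
    \<comment> \<open>This difference is orthogonal to the simple approximations of both functions
      at time t, hence in the limit to \<open>v t\<close> and \<open>w t\<close>, hence to
      itself.\<close>
    define z where "z x = v t x - w t x" for x
    have z: "z \<in> Lp 2 \<Omega>" unfolding z_def using elim(1,2) by (intro Lp_diff) auto
    have sX: "s n t \<in> Lp 2 \<Omega>" "r n t \<in> Lp 2 \<Omega>" for n
      using bochner_simple_mem[OF s(1)] bochner_simple_mem[OF r(1)] t by (auto simp: space_restrict_space)
    have "s n t \<in> ?Y" "r n t \<in> ?Y" for n using t by blast+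
    then have "L2_inner \<Omega> (v t) (s n t) = L2_inner \<Omega> (w t) (s n t)"
      "L2_inner \<Omega> (v t) (r n t) = L2_inner \<Omega> (w t) (r n t)" for n
      using bspec[OF elim(6)] by blast+
    then have "L2_inner \<Omega> z (s n t) = 0" "L2_inner \<Omega> z (r n t) = 0" for n
      unfolding z_def using elim(1,2) sX by (simp_all add: L2_inner_diff_left)
    then have "(\<lambda>n. 0) \<longlonglongrightarrow> L2_inner \<Omega> (v t) z" "(\<lambda>n. 0) \<longlonglongrightarrow> L2_inner \<Omega> (w t) z"
      using L2_inner_tendsto[OF sX(1) elim(1) z elim(3)] L2_inner_tendsto[OF sX(2) elim(2) z elim(4)]
      by (simp_all add: L2_inner_commute[of _ _ z])
    then have "L2_inner \<Omega> (v t) z = 0" "L2_inner \<Omega> (w t) z = 0" by (simp_all add: LIMSEQ_const_iff)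
    then have "L2_inner \<Omega> z z = 0"
      using elim(1,2) z unfolding z_def by (simp add: L2_inner_diff_left)
    then have "AE x in lebesgue_on \<Omega>. z x = 0"
      using Lp2_norm_sq[of \<Omega> z] by (intro Lp_norm_eq_0D[OF _ z]) auto
    then show ?case using elim(1,2) by (simp add: z_def)
  qed
qed

text \<open>Two intervals are needed because one derivative comes with a strong solution on (0, T)
  and the other lives on the half-line. Test functions on \<open>J1\<close> are test functions on
  \<open>J2\<close>, so for every fixed y the two pairings act alike on them, and the scalar
  fundamental lemma applies.\<close>

lemma weak_time_deriv_unique:
  fixes J1 J2 :: "real set"
  assumes J: "open J1" "open J2" "J1 \<subseteq> J2"
    and v: "has_weak_time_deriv \<Omega> J1 u v" "v \<in> L2L2 J1 \<Omega>"
    and w: "has_weak_time_deriv \<Omega> J2 u w" "w \<in> L2L2 J2 \<Omega>"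
  shows "AE t in lebesgue_on J1. v t \<in> Lp 2 \<Omega> \<and> w t \<in> Lp 2 \<Omega> \<and> (AE x in lebesgue_on \<Omega>. v t x = w t x)"
proof -
  have Js: "J1 \<in> sets lebesgue" "J2 \<in> sets lebesgue" using J by auto
  show ?thesis
  proof (rule AE_eq_if_inner_AE_eq[OF Js J(3)])
    show "strongly_measurable (lebesgue_on J1) (Lp 2 \<Omega>) (Lp_norm 2 \<Omega>) v"
      "strongly_measurable (lebesgue_on J2) (Lp 2 \<Omega>) (Lp_norm 2 \<Omega>) w"
      using v w by (auto simp: bochner_Lq_def)
    fix y assume y: "y \<in> Lp 2 \<Omega>"
    let ?v = "\<lambda>t. L2_inner \<Omega> (v t) y" and ?w = "\<lambda>t. L2_inner \<Omega> (w t) y"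
    have lv: "locally_integrable J1 ?v"
      by (rule Lp2_locally_integrable[OF J(1) L2L2_inner_Lp2[OF Js(1) v(2) y]])
    have "locally_integrable J2 ?w"
      by (rule Lp2_locally_integrable[OF J(2) L2L2_inner_Lp2[OF Js(2) w(2) y]])
    then have lw: "locally_integrable J1 ?w" using J(3) by (auto simp: locally_integrable_def)
    have "AE t in lebesgue_on J1. ?v t - ?w t = 0"
    proof (rule fundamental_lemma_variations[OF J(1)])
      show "locally_integrable J1 (\<lambda>t. ?v t - ?w t)"
        using lv lw unfolding locally_integrable_def by (auto intro: set_integral_diff(1))
      fix \<eta> assume \<eta>: "\<eta> \<in> test_functions J1"
      then have \<eta>2: "\<eta> \<in> test_functions J2" using J(3) unfolding test_functions_def by blast
      have ext: "(LINT t|lebesgue_on J2. \<theta> t * f t) = (LINT t|lebesgue_on J1. \<theta> t * f t)"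
        if "\<And>t. t \<notin> J1 \<Longrightarrow> \<theta> t = 0" for \<theta> f :: "real \<Rightarrow> real"
      proof -
        have "(\<lambda>t. indicator J2 t *\<^sub>R (\<theta> t * f t)) = (\<lambda>t. indicator J1 t *\<^sub>R (\<theta> t * f t))"
          using that J(3) by (auto simp: indicator_def fun_eq_iff)
        then show ?thesis using Js by (subst (1 2) integral_restrict_space) auto
      qed
      have out: "\<eta> t = 0" "deriv \<eta> t = 0" if "t \<notin> J1" for t
      proof -
        show "\<eta> t = 0" using \<eta> that by (rule test_function_outside)
        have "smooth \<eta>" using \<eta> by (simp add: test_functions_def)
        then have "(\<eta> has_real_derivative partial_deriv 1 \<eta> t) (at t)"
          using smooth_has_real_derivative_line[of \<eta> 0 1 t] by simp
        moreover have "partial_deriv 1 \<eta> t = 0"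
          using test_function_outside[OF test_function_partial_deriv[OF \<eta>] that] by simp
        ultimately show "deriv \<eta> t = 0" by (simp add: DERIV_imp_deriv)
      qed
      have "(LINT t|lebesgue_on J1. \<eta> t * ?v t) = (LINT t|lebesgue_on J1. \<eta> t * ?w t)"
        using weak_time_deriv_inner[OF Js(1) v(1) \<eta> y] weak_time_deriv_inner[OF Js(2) w(1) \<eta>2 y]
          ext[of \<eta> ?w] ext[of "deriv \<eta>" "\<lambda>t. L2_inner \<Omega> (u t) y"] out by simp
      moreover have "(LINT t|lebesgue_on J1. (?v t - ?w t) * \<eta> t) =
          (LINT t|lebesgue_on J1. ?v t * \<eta> t) - (LINT t|lebesgue_on J1. ?w t * \<eta> t)"
        unfolding left_diff_distrib
        by (intro Bochner_Integration.integral_diff locally_integrable_mult_test_function[OF J(1) _ \<eta>] lv lw)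
      ultimately show "(LINT t|lebesgue_on J1. (?v t - ?w t) * \<eta> t) = 0"
        by (simp add: mult.commute)
    qed
    then show "AE t in lebesgue_on J1. ?v t = ?w t" by simp
  qed
qed

text \<open>The indicator of a measurable set A of times, multiplied by a fixed y, is an admissible
  test function: it is simple, and square integrable since J has finite measure. It isolates the
  integral over A of the scalar pairing.\<close>

lemma AE_eq_if_orthogonal:
  fixes J :: "real set"
  assumes J: "open J" "bounded J" and v: "v \<in> L2L2 J \<Omega>" and w: "w \<in> L2L2 J \<Omega>"
    and z: "\<And>\<phi>. \<phi> \<in> L2L2 J \<Omega> \<Longrightarrow> (LINT t|lebesgue_on J. L2_inner \<Omega> (\<lambda>x. v t x - w t x) (\<phi> t)) = 0"
  shows "AE t in lebesgue_on J. v t \<in> Lp 2 \<Omega> \<and> w t \<in> Lp 2 \<Omega> \<and> (AE x in lebesgue_on \<Omega>. v t x = w t x)"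
proof -
  interpret finite_measure "lebesgue_on J" using J by (rule finite_measure_lebesgue_on)
  have Js: "J \<in> sets lebesgue" using J by auto
  have sm: "strongly_measurable (lebesgue_on J) (Lp 2 \<Omega>) (Lp_norm 2 \<Omega>) v"
      "strongly_measurable (lebesgue_on J) (Lp 2 \<Omega>) (Lp_norm 2 \<Omega>) w"
    using v w by (auto simp: bochner_Lq_def)
  show ?thesis
  proof (rule AE_eq_if_inner_AE_eq[OF Js Js order_refl sm])
    fix y assume y: "y \<in> Lp 2 \<Omega>"
    let ?v = "\<lambda>t. L2_inner \<Omega> (v t) y" and ?w = "\<lambda>t. L2_inner \<Omega> (w t) y"
    have i: "integrable (lebesgue_on J) f" if "f \<in> Lp 2 J" for f
      using Lp2_integrable_mult[OF that, of "\<lambda>_. 1"] by (simp add: Lp_def)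
    have iv: "integrable (lebesgue_on J) ?v" by (rule i[OF L2L2_inner_Lp2[OF Js v y]])
    have iw: "integrable (lebesgue_on J) ?w" by (rule i[OF L2L2_inner_Lp2[OF Js w y]])
    have vX: "AE t in lebesgue_on J. v t \<in> Lp 2 \<Omega>" and wX: "AE t in lebesgue_on J. w t \<in> Lp 2 \<Omega>"
      using sm by (auto simp: strongly_measurable_def)
    show "AE t in lebesgue_on J. ?v t = ?w t"
    proof (rule density_unique_real[OF iv iw])
      fix A assume A: "A \<in> sets (lebesgue_on J)"
      define \<phi> where "\<phi> t = (if t \<in> A then y else (\<lambda>x. 0))" for t
      have AJ: "A \<inter> space (lebesgue_on J) = A" using A sets.sets_into_space by blast
      have bs: "bochner_simple (lebesgue_on J) (Lp 2 \<Omega>) \<phi>"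
        unfolding bochner_simple_def
      proof (intro conjI)
        show "simple_function (lebesgue_on J) \<phi>"
          unfolding \<phi>_def[abs_def] by (rule simple_function_If_set) (use A AJ in auto)
      qed (use y in \<open>auto simp: \<phi>_def\<close>)
      have n: "Lp_norm 2 \<Omega> (\<phi> t) powr 2 = indicator A t * Lp_norm 2 \<Omega> y powr 2" for t
        by (simp add: \<phi>_def)
      have "\<phi> \<in> L2L2 J \<Omega>"
        unfolding bochner_Lq_def strongly_measurable_def
      proof (intro CollectI conjI exI[of _ "\<lambda>_. \<phi>"] allI bs)
        show "AE t in lebesgue_on J. \<phi> t \<in> Lp 2 \<Omega>" using y by (auto simp: \<phi>_def)
        show "integrable (lebesgue_on J) (\<lambda>t. Lp_norm 2 \<Omega> (\<phi> t) powr 2)"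
          unfolding n using A by (intro integrable_mult_left integrable_real_indicator) (auto simp: less_top[symmetric])
      qed simp
      from z[OF this] have "(LINT t|lebesgue_on J. L2_inner \<Omega> (\<lambda>x. v t x - w t x) (\<phi> t)) = 0" .
      also have "(LINT t|lebesgue_on J. L2_inner \<Omega> (\<lambda>x. v t x - w t x) (\<phi> t)) =
          (LINT t|lebesgue_on J. indicator A t *\<^sub>R ?v t - indicator A t *\<^sub>R ?w t)"
      proof (rule Bochner_Integration.integral_cong_AE)
        have e: "AE t in lebesgue_on J. indicator A t *\<^sub>R ?v t - indicator A t *\<^sub>R ?w t =
            L2_inner \<Omega> (\<lambda>x. v t x - w t x) (\<phi> t)"
          using vX wX
        proof eventually_elim
          case (elim t)
          then show ?case
            using y by (cases "t \<in> A") (simp_all add: \<phi>_def L2_inner_diff_left L2_inner_def[of _ _ "\<lambda>x. 0"])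
        qed
        then show "AE t in lebesgue_on J. L2_inner \<Omega> (\<lambda>x. v t x - w t x) (\<phi> t) =
            indicator A t *\<^sub>R ?v t - indicator A t *\<^sub>R ?w t" by eventually_elim simp
        show m: "(\<lambda>t. indicator A t *\<^sub>R ?v t - indicator A t *\<^sub>R ?w t) \<in> borel_measurable (lebesgue_on J)"
          using A iv iw by measurable
        show "(\<lambda>t. L2_inner \<Omega> (\<lambda>x. v t x - w t x) (\<phi> t)) \<in> borel_measurable (lebesgue_on J)"
          by (rule borel_measurable_lebesgue_on_cong_AE[OF Js m e])
      qed
      also have "\<dots> = (LINT t:A|lebesgue_on J. ?v t) - (LINT t:A|lebesgue_on J. ?w t)"
        unfolding set_lebesgue_integral_def
        using A iv iw by (intro Bochner_Integration.integral_diff integrable_mult_indicator)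
      finally show "(LINT t:A|lebesgue_on J. ?v t) = (LINT t:A|lebesgue_on J. ?w t)" by simp
    qed
  qed
qed

section \<open>The modulus of continuity in time\<close>

lemma smooth_antiderivative:
  fixes P \<rho> :: "real \<Rightarrow> real"
  assumes d: "\<And>x. (P has_real_derivative \<rho> x) (at x)" and s: "smooth \<rho>"
  shows "smooth P"
proof -
  have "partial_deriv 1 P = \<rho>"
  proof
    fix x show "partial_deriv 1 P x = \<rho> x"
      using partial_deriv_eq[of P "(*) (\<rho> x)" x 1] d[of x] by (simp add: has_field_derivative_def)
  qed
  moreover have "P differentiable (at x)" for x
    using d[of x] by (auto simp: has_field_derivative_def differentiable_def)
  ultimately have Suc: "Ck (Suc k) P" for k using s by (simp add: smooth_def)
  show ?thesis unfolding smooth_def using Suc Ck_Suc_imp_Ck by blast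
qed

text \<open>P is a smoothed Heaviside function that jumps just after s. Its derivative \<rho> is a
  nonnegative approximation of the Dirac measure at s.\<close>

lemma smooth_step:
  fixes s e :: real
  assumes e: "e > 0"
  obtains P \<rho> where "\<And>x. (P has_real_derivative \<rho> x) (at x)" "smooth P" "smooth \<rho>"
    "\<And>x. 0 \<le> \<rho> x" "\<And>x. x \<notin> {s<..<s + e} \<Longrightarrow> \<rho> x = 0"
    "\<And>x. x \<le> s \<Longrightarrow> P x = 0" "\<And>x. s + e \<le> x \<Longrightarrow> P x = 1" "\<And>x. 0 \<le> P x" "\<And>x. P x \<le> 1"
proof -
  define \<beta> where "\<beta> = box_bump 1 s (s + e)"
  \<comment> \<open>The integration starts at s - 1 rather than at s, so that every x \<ge> s is an
    interior point of an interval on which the fundamental theorem of calculus applies.\<close>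
  define c where "c = integral {s - 1..s + e} \<beta>"
  define P where "P x = integral {s - 1..x} \<beta> / c" for x
  define \<rho> where "\<rho> x = \<beta> x / c" for x
  have b0: "0 \<le> \<beta> x" for x unfolding \<beta>_def by (rule box_bump_bounds)
  have bs: "smooth \<beta>" unfolding \<beta>_def by (rule smooth_box_bump)
  have bc: "continuous_on S \<beta>" for S using smooth_continuous_on[OF bs] continuous_on_subset by blast
  have out: "\<beta> x = 0" if "x \<notin> {s<..<s + e}" for x
    using that box_bump_outside[of x s "s + e" 1] by (simp add: \<beta>_def box_real)
  have bi: "\<beta> integrable_on {a..b}" for a b by (rule integrable_continuous_real[OF bc])
  have "\<beta> (s + e / 2) > 0"
    using e by (simp add: \<beta>_def box_bump_def psi_def)
  then have "c \<noteq> 0"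
    unfolding c_def using e b0 integral_eq_0_iff[OF bc[of "{s - 1..s + e}"]] by fastforce
  moreover have "c \<ge> 0" unfolding c_def using b0 by (intro integral_nonneg bi) auto
  ultimately have c: "c > 0" by simp
  have zero: "integral {s - 1..x} \<beta> = 0" if "x \<le> s" for x
  proof -
    have "integral {s - 1..x} \<beta> = integral {s - 1..x} (\<lambda>_. 0)"
      using that out by (intro Henstock_Kurzweil_Integration.integral_cong) auto
    then show ?thesis by simp
  qed
  have const: "integral {s - 1..x} \<beta> = c" if "s + e \<le> x" for x
  proof -
    have "integral {s - 1..s + e} \<beta> + integral {s + e..x} \<beta> = integral {s - 1..x} \<beta>"
      using that e by (intro Henstock_Kurzweil_Integration.integral_combine bi) auto
    moreover have "integral {s + e..x} \<beta> = integral {s + e..x} (\<lambda>_. 0)"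
      using out by (intro Henstock_Kurzweil_Integration.integral_cong) auto
    ultimately show ?thesis by (simp add: c_def)
  qed
  have P0: "P x = 0" if "x \<le> s" for x using zero[OF that] by (simp add: P_def)
  have P1: "P x = 1" if "s + e \<le> x" for x using const[OF that] c by (simp add: P_def)
  have r0: "0 \<le> \<rho> x" for x using b0 c by (simp add: \<rho>_def)
  have d: "(P has_real_derivative \<rho> x) (at x)" for x
  proof (cases "x < s")
    case True
    have "((\<lambda>_. 0) has_real_derivative \<rho> x) (at x)" using out[of x] True by (simp add: \<rho>_def)
    moreover have "\<forall>\<^sub>F y in nhds x. P y = 0"
      using eventually_nhds_in_open[of "{..<s}" x] True P0 by (auto elim!: eventually_mono)
    ultimately show ?thesis by (subst DERIV_cong_ev) auto
  next
    case False
    have "((\<lambda>x. integral {s - 1..x} \<beta>) has_real_derivative \<beta> x) (at x within {s - 1..x + 1})"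
      using False by (intro integral_has_real_derivative bc) auto
    then have "((\<lambda>x. integral {s - 1..x} \<beta>) has_real_derivative \<beta> x) (at x)"
      using False at_within_Icc_at[of "s - 1" x "x + 1"] by simp
    then show ?thesis unfolding P_def \<rho>_def by (rule DERIV_cdivide)
  qed
  have mono: "P x \<le> P y" if "x \<le> y" for x y
    using DERIV_nonneg_imp_nondecreasing[OF that] d r0 by blast
  have rs: "smooth \<rho>" using smooth_mult[OF smooth_const[of "inverse c"] bs] by (simp add: \<rho>_def[abs_def] divide_inverse mult.commute)
  show thesis
  proof (rule that[OF d smooth_antiderivative[OF d rs] rs r0 _ P0 P1])
    show "\<rho> x = 0" if "x \<notin> {s<..<s + e}" for x using out[OF that] by (simp add: \<rho>_def)
    show "0 \<le> P x" for x using P0[of "min x s"] mono[of "min x s" x] by simp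
    show "P x \<le> 1" for x using P1[of "max x (s + e)"] mono[of x "max x (s + e)"] by simp
  qed
qed

lemma continuous_locally_integrable:
  assumes c: "continuous_on S (a :: real \<Rightarrow> real)"
  shows "locally_integrable S a"
  unfolding locally_integrable_def set_integrable_def
proof safe
  fix K assume K: "compact K" "K \<subseteq> S"
  have "integrable lborel (\<lambda>x. indicator K x *\<^sub>R a x)"
    using borel_integrable_compact[OF K(1) continuous_on_subset[OF c K(2)]] .
  then show "integrable lebesgue (\<lambda>x. indicator K x *\<^sub>R a x)"
    by (subst integrable_completion) auto
qed

lemma L2L2_norm_integrable:
  assumes "v \<in> L2L2 J \<Omega>"
  shows "integrable (lebesgue_on J) (\<lambda>t. (Lp_norm 2 \<Omega> (v t))\<^sup>2)"
    "(\<lambda>t. Lp_norm 2 \<Omega> (v t)) \<in> borel_measurable (lebesgue_on J)"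
proof -
  show i: "integrable (lebesgue_on J) (\<lambda>t. (Lp_norm 2 \<Omega> (v t))\<^sup>2)"
    using assms by (simp add: bochner_Lq_def)
  have "(\<lambda>t. sqrt ((Lp_norm 2 \<Omega> (v t))\<^sup>2)) \<in> borel_measurable (lebesgue_on J)"
    using borel_measurable_integrable[OF i] by measurable
  then show "(\<lambda>t. Lp_norm 2 \<Omega> (v t)) \<in> borel_measurable (lebesgue_on J)" by simp
qed

lemma measure_lebesgue_on_Ioc:
  fixes a b :: real
  assumes "0 \<le> a" "a \<le> b"
  shows "{a<..b} \<in> sets (lebesgue_on {0<..})" "emeasure (lebesgue_on {0<..}) {a<..b} = ennreal (b - a)"
    "measure (lebesgue_on {0<..}) {a<..b} = b - a"
proof -
  show s: "{a<..b} \<in> sets (lebesgue_on {0<..})" using assms by (auto simp: sets_restrict_space_iff)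
  have sub: "{a<..b} \<subseteq> {0<..}" using assms by auto
  show "emeasure (lebesgue_on {0<..}) {a<..b} = ennreal (b - a)"
    using assms sub by (subst emeasure_restrict_space) auto
  then show "measure (lebesgue_on {0<..}) {a<..b} = b - a"
    using assms by (simp add: measure_def)
qed

text \<open>Test the weak derivative with the difference of two steps, located just after \<open>s\<close> and \<open>t\<close>.\<close>

lemma time_modulus:
  assumes w: "has_weak_time_deriv \<Omega> {0<..} u v" "v \<in> L2L2 {0<..} \<Omega>"
    and u: "\<And>t. 0 < t \<Longrightarrow> u t \<in> Lp 2 \<Omega>"
    and cont: "\<And>t. 0 < t \<Longrightarrow> ((\<lambda>s. Lp_norm 2 \<Omega> (\<lambda>x. u s x - u t x)) \<longlongrightarrow> 0) (at t)"
    and t: "0 < s" "s < t" "t < t'"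
  shows "(Lp_norm 2 \<Omega> (\<lambda>x. u t x - u s x))\<^sup>2 \<le>
    (t' - s) * (LINT \<tau>|lebesgue_on {0<..}. indicator {s<..t'} \<tau> * (Lp_norm 2 \<Omega> (v \<tau>))\<^sup>2)"
proof -
  let ?J = "{0<..} :: real set" and ?M = "lebesgue_on {0<..} :: real measure"
  \<comment> \<open>Testing with the increment itself makes D^2 the difference of the scalar
    function a at t and at s.\<close>
  define y where "y x = u t x - u s x" for x
  define D where "D = Lp_norm 2 \<Omega> y"
  define q where "q = (LINT \<tau>|?M. indicator {s<..t'} \<tau> * (Lp_norm 2 \<Omega> (v \<tau>))\<^sup>2)"
  define Q where "Q = sqrt ((t' - s) * q)"
  define a where "a \<tau> = L2_inner \<Omega> (u \<tau>) y" for \<tau>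
  define b where "b \<tau> = L2_inner \<Omega> (v \<tau>) y" for \<tau>
  let ?I = "{s<..t'}"
  have Jo: "open ?J" and Js: "?J \<in> sets lebesgue" by auto
  have y: "y \<in> Lp 2 \<Omega>" unfolding y_def using u t by (intro Lp_diff) auto
  have D2: "D\<^sup>2 = a t - a s"
    unfolding D_def Lp2_norm_sq a_def using L2_inner_diff_left[OF u[of t] u[of s] y] t
    by (simp add: y_def[abs_def, symmetric])
  have D0: "D \<ge> 0" by (simp add: D_def)
  have I: "?I \<in> sets ?M" "emeasure ?M ?I = ennreal (t' - s)" "measure ?M ?I = t' - s"
    using measure_lebesgue_on_Ioc[of s t'] t by auto
  note gi = L2L2_norm_integrable[OF w(2)]
  have q0: "q \<ge> 0" unfolding q_def by (intro integral_nonneg_AE) auto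
  have ac: "((\<lambda>\<sigma>. a \<sigma>) \<longlongrightarrow> a \<tau>) (at \<tau>)" if "\<tau> > 0" for \<tau>
    unfolding a_def
  proof (rule L2_inner_tendsto_eventually[OF _ u[OF that] y cont[OF that]])
    have "\<forall>\<^sub>F \<sigma> in at \<tau>. \<sigma> \<in> ?J" using that by (intro eventually_at_in_open') auto
    then show "\<forall>\<^sub>F \<sigma> in at \<tau>. u \<sigma> \<in> Lp 2 \<Omega>" by eventually_elim (simp add: u)
  qed
  have aco: "continuous_on ?J a"
    using ac by (auto simp: continuous_on_def intro: tendsto_within_subset)
  have al: "locally_integrable ?J a" by (rule continuous_locally_integrable[OF aco])
  have isq: "integrable ?M (\<lambda>\<tau>. indicator ?I \<tau> * (Lp_norm 2 \<Omega> (v \<tau>))\<^sup>2)"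
    using integrable_mult_indicator[OF I(1) gi(1)] by simp
  have i1: "integrable ?M (\<lambda>\<tau>. indicator ?I \<tau> * Lp_norm 2 \<Omega> (v \<tau>))"
  proof (rule Bochner_Integration.integrable_bound)
    show "integrable ?M (\<lambda>\<tau>. indicator ?I \<tau> + indicator ?I \<tau> * (Lp_norm 2 \<Omega> (v \<tau>))\<^sup>2)"
      using I isq by (intro Bochner_Integration.integrable_add integrable_real_indicator) auto
    show "(\<lambda>\<tau>. indicator ?I \<tau> * Lp_norm 2 \<Omega> (v \<tau>)) \<in> borel_measurable ?M"
      using I(1) gi(2) by measurable
    have "r \<le> 1 + r\<^sup>2" for r :: real using sum_squares_bound[of r 1] by simp (smt (verit) zero_le_power2)
    then show "AE \<tau> in ?M. norm (indicator ?I \<tau> * Lp_norm 2 \<Omega> (v \<tau>)) \<le>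
        norm (indicator ?I \<tau> + indicator ?I \<tau> * (Lp_norm 2 \<Omega> (v \<tau>))\<^sup>2)"
      by (intro AE_I2) (auto simp: indicator_def)
  qed
  have intg: "(LINT \<tau>|?M. indicator ?I \<tau> * Lp_norm 2 \<Omega> (v \<tau>)) \<le> Q"
  proof -
    have "(LINT \<tau>|?M. indicator ?I \<tau> * Lp_norm 2 \<Omega> (v \<tau>))\<^sup>2 \<le> (t' - s) * q"
      using integral_sq_le[OF I(1) _ _ i1 isq] I t by (simp add: q_def)
    then show ?thesis unfolding Q_def by (rule real_le_rsqrt)
  qed
  \<comment> \<open>Here k is the error of replacing a point value of a by its average against an
    approximate Dirac measure, once at s and once at t.\<close>
  have main: "D\<^sup>2 \<le> D * Q + 2 * k" if k: "k > 0" for k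
  proof -
    have near: "\<exists>e>0. \<forall>\<sigma>. \<bar>\<sigma> - \<tau>\<bar> < e \<longrightarrow> \<bar>a \<sigma> - a \<tau>\<bar> \<le> k" if \<tau>: "\<tau> > 0" for \<tau>
    proof -
      obtain e where "e > 0" "\<And>\<sigma>. \<sigma> \<noteq> \<tau> \<Longrightarrow> dist \<sigma> \<tau> < e \<Longrightarrow> dist (a \<sigma>) (a \<tau>) < k"
        using tendstoD[OF ac[OF \<tau>] k] by (auto simp: eventually_at)
      then have "\<bar>a \<sigma> - a \<tau>\<bar> \<le> k" if "\<bar>\<sigma> - \<tau>\<bar> < e" for \<sigma>
        using that k by (cases "\<sigma> = \<tau>") (auto simp: dist_real_def intro: less_imp_le)
      with \<open>e > 0\<close> show ?thesis by blast
    qed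
    obtain e1 where e1: "e1 > 0" "\<And>\<sigma>. \<bar>\<sigma> - s\<bar> < e1 \<Longrightarrow> \<bar>a \<sigma> - a s\<bar> \<le> k" using near[of s] t by auto
    obtain e2 where e2: "e2 > 0" "\<And>\<sigma>. \<bar>\<sigma> - t\<bar> < e2 \<Longrightarrow> \<bar>a \<sigma> - a t\<bar> \<le> k" using near[of t] t by auto
    \<comment> \<open>The width is small enough for the continuity of a at s and at t, and t + e
      \<le> t' keeps the second step within the interval of integration. This is the room for which
      t' > t is required.\<close>
    define e where "e = min (min e1 e2) (t' - t)"
    have e: "e > 0" "e \<le> e1" "e \<le> e2" "t + e \<le> t'" using e1 e2 t by (auto simp: e_def)
    have step: "\<exists>P \<rho>. (\<forall>x. (P has_real_derivative \<rho> x) (at x)) \<and> smooth P \<and>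
        \<rho> \<in> test_functions ?J \<and> (\<forall>x. x \<le> r \<longrightarrow> P x = 0) \<and> (\<forall>x. r + e \<le> x \<longrightarrow> P x = 1) \<and>
        (\<forall>x. 0 \<le> P x \<and> P x \<le> 1) \<and> \<bar>(LINT \<tau>|?M. a \<tau> * \<rho> \<tau>) - a r\<bar> \<le> k"
      if r: "r > 0" and near: "\<And>\<sigma>. \<bar>\<sigma> - r\<bar> < e \<Longrightarrow> \<bar>a \<sigma> - a r\<bar> \<le> k" for r
    proof -
      obtain P \<rho> where P: "\<And>x. (P has_real_derivative \<rho> x) (at x)" "smooth P" "smooth \<rho>"
        "\<And>x. 0 \<le> \<rho> x" "\<And>x. x \<notin> {r<..<r + e} \<Longrightarrow> \<rho> x = 0"
        "\<And>x. x \<le> r \<Longrightarrow> P x = 0" "\<And>x. r + e \<le> x \<Longrightarrow> P x = 1" "\<And>x. 0 \<le> P x" "\<And>x. P x \<le> 1"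
        using smooth_step[OF e(1), of r] by blast
      have z: "\<forall>x. x \<notin> {r..r + e} \<longrightarrow> \<rho> x = 0" using P(5) by force
      have \<rho>: "\<rho> \<in> test_functions ?J"
        unfolding test_functions_def using P(3) z r by (intro CollectI conjI exI[of _ "{r..r + e}"]) auto
      have i: "integrable ?M (\<lambda>\<tau>. a \<tau> * \<rho> \<tau>)" by (rule locally_integrable_mult_test_function[OF Jo al \<rho>])
      have ir: "integrable ?M \<rho>"
        using test_function_Lp[OF \<rho> zero_less_one Js] Lp_integrable[of \<rho> 1 ?J] P(4) by simp
      have "(LINT \<tau>|?M. \<rho> \<tau>) = (LINT \<tau>|lborel. \<rho> \<tau>)"
        using test_function_measurable[OF \<rho>] by (intro integral_lebesgue_on_eq_lborel Js test_function_outside[OF \<rho>]) auto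
      also have "\<dots> = (LINT \<tau>|lborel. \<rho> \<tau> * indicator {r..r + e} \<tau>)"
        using z by (intro Bochner_Integration.integral_cong) (auto simp: indicator_def)
      also have "\<dots> = P (r + e) - P r"
        using e(1) P(1) smooth_continuous_on[OF P(3)]
        by (intro integral_FTC_Icc_real) (auto simp: continuous_on_eq_continuous_at)
      finally have one: "(LINT \<tau>|?M. \<rho> \<tau>) = 1" using P(6,7) by simp
      have "(LINT \<tau>|?M. a \<tau> * \<rho> \<tau>) - a r = (LINT \<tau>|?M. a \<tau> * \<rho> \<tau> - a r * \<rho> \<tau>)"
        using i ir one by simp
      also have "\<bar>\<dots>\<bar> \<le> (LINT \<tau>|?M. k * \<rho> \<tau>)"
      proof (rule integral_abs_bound[THEN order_trans], rule integral_mono)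
        show "integrable ?M (\<lambda>\<tau>. \<bar>a \<tau> * \<rho> \<tau> - a r * \<rho> \<tau>\<bar>)" using i ir by auto
        show "integrable ?M (\<lambda>\<tau>. k * \<rho> \<tau>)" using ir by auto
        fix \<tau>
        have "\<bar>a \<tau> - a r\<bar> * \<rho> \<tau> \<le> k * \<rho> \<tau>"
        proof (cases "\<tau> \<in> {r<..<r + e}")
          case True
          then show ?thesis using near[of \<tau>] P(4)[of \<tau>] by (intro mult_right_mono) auto
        qed (simp add: P(5))
        then show "\<bar>a \<tau> * \<rho> \<tau> - a r * \<rho> \<tau>\<bar> \<le> k * \<rho> \<tau>"
          using P(4)[of \<tau>] by (simp add: left_diff_distrib[symmetric] abs_mult)
      qed
      also have "\<dots> = k" using one by simp
      finally show ?thesis using P \<rho> by blast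
    qed
    have s1: "\<bar>a \<sigma> - a s\<bar> \<le> k" if "\<bar>\<sigma> - s\<bar> < e" for \<sigma> using e1(2)[of \<sigma>] e(2) that by linarith
    have t1: "\<bar>a \<sigma> - a t\<bar> \<le> k" if "\<bar>\<sigma> - t\<bar> < e" for \<sigma> using e2(2)[of \<sigma>] e(3) that by linarith
    obtain P1 \<rho>1 where P1: "\<And>x. (P1 has_real_derivative \<rho>1 x) (at x)" "smooth P1"
        "\<rho>1 \<in> test_functions ?J" "\<And>x. x \<le> s \<Longrightarrow> P1 x = 0" "\<And>x. s + e \<le> x \<Longrightarrow> P1 x = 1"
        "\<And>x. 0 \<le> P1 x" "\<And>x. P1 x \<le> 1" "\<bar>(LINT \<tau>|?M. a \<tau> * \<rho>1 \<tau>) - a s\<bar> \<le> k"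
      using step[OF t(1) s1] by blast
    obtain P2 \<rho>2 where P2: "\<And>x. (P2 has_real_derivative \<rho>2 x) (at x)" "smooth P2"
        "\<rho>2 \<in> test_functions ?J" "\<And>x. x \<le> t \<Longrightarrow> P2 x = 0" "\<And>x. t + e \<le> x \<Longrightarrow> P2 x = 1"
        "\<And>x. 0 \<le> P2 x" "\<And>x. P2 x \<le> 1" "\<bar>(LINT \<tau>|?M. a \<tau> * \<rho>2 \<tau>) - a t\<bar> \<le> k"
      using step[OF less_trans[OF t(1,2)] t1] by blast
    \<comment> \<open>This function rises after s and returns to 0 after t. Its derivative compares
      averages of a near s and near t, while |\<eta>| \<le> 1 leaves at most D times the integral of
      |v| over (s, t'] on the other side.\<close>
    define \<eta> where "\<eta> x = P1 x - P2 x" for x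
    have out: "\<eta> x = 0" if "x \<notin> ?I" for x
      using that P1(4)[of x] P2(4)[of x] P1(5)[of x] P2(5)[of x] e t unfolding \<eta>_def by force
    have \<eta>t: "\<eta> \<in> test_functions ?J"
      unfolding test_functions_def
    proof (intro CollectI conjI exI[of _ "{s..t'}"])
      show "smooth \<eta>" unfolding \<eta>_def[abs_def] using P1(2) P2(2) by (rule smooth_diff)
      show "\<forall>x. x \<notin> {s..t'} \<longrightarrow> \<eta> x = 0" using out by auto
    qed (use t in auto)
    have \<eta>1: "\<bar>\<eta> x\<bar> \<le> 1" for x using P1(6,7)[of x] P2(6,7)[of x] unfolding \<eta>_def by linarith
    have "deriv \<eta> x = \<rho>1 x - \<rho>2 x" for x
      unfolding \<eta>_def[abs_def] using DERIV_diff[OF P1(1) P2(1)] by (rule DERIV_imp_deriv)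
    then have "(LINT \<tau>|?M. (\<rho>1 \<tau> - \<rho>2 \<tau>) * a \<tau>) = - (LINT \<tau>|?M. \<eta> \<tau> * b \<tau>)"
      using weak_time_deriv_inner[OF Js w(1) \<eta>t y] by (simp add: a_def b_def)
    moreover have "(LINT \<tau>|?M. (\<rho>1 \<tau> - \<rho>2 \<tau>) * a \<tau>) = (LINT \<tau>|?M. a \<tau> * \<rho>1 \<tau>) - (LINT \<tau>|?M. a \<tau> * \<rho>2 \<tau>)"
      using locally_integrable_mult_test_function[OF Jo al P1(3)] locally_integrable_mult_test_function[OF Jo al P2(3)]
      by (simp add: right_diff_distrib mult.commute[of _ "a _"])
    moreover have "\<bar>LINT \<tau>|?M. \<eta> \<tau> * b \<tau>\<bar> \<le> D * Q"
    proof -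
      have bl: "locally_integrable ?J b"
        unfolding b_def by (rule Lp2_locally_integrable[OF Jo L2L2_inner_Lp2[OF Js w(2) y]])
      have ib: "integrable ?M (\<lambda>\<tau>. b \<tau> * \<eta> \<tau>)" by (rule locally_integrable_mult_test_function[OF Jo bl \<eta>t])
      have vX: "AE \<tau> in ?M. v \<tau> \<in> Lp 2 \<Omega>" using w(2) by (simp add: bochner_Lq_def strongly_measurable_def)
      have "\<bar>LINT \<tau>|?M. \<eta> \<tau> * b \<tau>\<bar> \<le> (LINT \<tau>|?M. D * (indicator ?I \<tau> * Lp_norm 2 \<Omega> (v \<tau>)))"
      proof (rule integral_abs_bound[THEN order_trans], rule integral_mono_AE)
        show "integrable ?M (\<lambda>\<tau>. \<bar>\<eta> \<tau> * b \<tau>\<bar>)" using ib by (simp add: mult.commute integrable_abs)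
        show "integrable ?M (\<lambda>\<tau>. D * (indicator ?I \<tau> * Lp_norm 2 \<Omega> (v \<tau>)))" using i1 by (rule integrable_mult_right)
        show "AE \<tau> in ?M. \<bar>\<eta> \<tau> * b \<tau>\<bar> \<le> D * (indicator ?I \<tau> * Lp_norm 2 \<Omega> (v \<tau>))"
          using vX
        proof eventually_elim
          case (elim \<tau>)
          show ?case
          proof (cases "\<tau> \<in> ?I")
            case True
            have "\<bar>\<eta> \<tau> * b \<tau>\<bar> \<le> 1 * (Lp_norm 2 \<Omega> (v \<tau>) * D)"
              unfolding abs_mult b_def D_def by (intro mult_mono \<eta>1 L2_Cauchy_Schwarz elim y) auto
            then show ?thesis using True by (simp add: mult.commute)
          qed (simp add: out)
        qed
      qed
      also have "\<dots> \<le> D * Q" using intg D0 by (simp add: mult_left_mono)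
      finally show ?thesis .
    qed
    ultimately show ?thesis using P1(8) P2(8) unfolding D2 by linarith
  qed
  have "D\<^sup>2 \<le> D * Q"
  proof (rule field_le_epsilon)
    fix e :: real assume "e > 0" then show "D\<^sup>2 \<le> D * Q + e" using main[of "e / 2"] by simp
  qed
  then have "D \<le> Q" using D0 q0 t by (cases "D = 0") (auto simp: power2_eq_square Q_def)
  then have "D\<^sup>2 \<le> Q\<^sup>2" using D0 by (rule power_mono)
  also have "Q\<^sup>2 = (t' - s) * q" unfolding Q_def using q0 t by simp
  finally show ?thesis by (simp add: D_def q_def y_def[abs_def])
qed

section \<open>The energy functional\<close>

abbreviation pow_nl :: "real \<Rightarrow> real \<Rightarrow> real" where
  "pow_nl p a \<equiv> \<bar>a\<bar> powr (p - 2) * a"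

lemma abs_pow_nl: "\<bar>pow_nl p a\<bar> = \<bar>a\<bar> powr (p - 1)"
proof (cases "a = 0")
  case False
  then have "\<bar>a\<bar> powr (p - 2) * \<bar>a\<bar> powr 1 = \<bar>a\<bar> powr (p - 1)"
    by (subst powr_add[symmetric]) simp
  then show ?thesis by (simp add: abs_mult)
qed simp

lemma pow_nl_mult_self: "pow_nl p a * a = \<bar>a\<bar> powr p"
proof (cases "a = 0")
  case False
  then have "\<bar>a\<bar> powr (p - 2) * \<bar>a\<bar> powr 2 = \<bar>a\<bar> powr p"
    by (subst powr_add[symmetric]) simp
  then show ?thesis using False by (simp add: power2_eq_square mult.assoc)
qed simp

text \<open>Young's inequality for the exponents p / (p - 1) and p. The exact weights are kept
  because with them it becomes the tangent inequality for |a|^p / p.\<close>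

lemma pow_nl_Young:
  assumes "2 \<le> p"
  shows "\<bar>pow_nl p a * b\<bar> \<le> (1 - 1 / p) * \<bar>a\<bar> powr p + \<bar>b\<bar> powr p / p"
proof (cases "a = 0 \<or> b = 0")
  case True
  then show ?thesis using assms by auto
next
  case False
  have "(\<bar>a\<bar> powr p) powr (1 - 1 / p) * (\<bar>b\<bar> powr p) powr (1 / p) \<le> (1 - 1 / p) * \<bar>a\<bar> powr p + 1 / p * \<bar>b\<bar> powr p"
    using assms False by (intro Youngs_inequality_0) auto
  moreover have "(\<bar>a\<bar> powr p) powr (1 - 1 / p) = \<bar>a\<bar> powr (p - 1)"
    using assms by (simp add: powr_powr right_diff_distrib)
  moreover have "(\<bar>b\<bar> powr p) powr (1 / p) = \<bar>b\<bar>" using assms False by (simp add: powr_powr)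
  moreover have "\<bar>pow_nl p a * b\<bar> = \<bar>a\<bar> powr (p - 1) * \<bar>b\<bar>"
    by (subst abs_mult, subst abs_pow_nl) (rule refl)
  ultimately show ?thesis by simp
qed

lemma pow_nl_Young':
  assumes "2 \<le> p"
  shows "\<bar>pow_nl p a * b\<bar> \<le> \<bar>a\<bar> powr p + \<bar>b\<bar> powr p"
proof -
  have "(1 - 1 / p) * \<bar>a\<bar> powr p \<le> 1 * \<bar>a\<bar> powr p" using assms by (intro mult_right_mono) auto
  moreover have "\<bar>b\<bar> powr p / p \<le> \<bar>b\<bar> powr p" using assms by (simp add: divide_le_eq mult_left_mono mult_le_cancel_left1)
  ultimately show ?thesis using pow_nl_Young[OF assms, of a b] by linarith
qed

text \<open>As the nonlinearity times a is |a|^p, this convexity statement is Young's inequality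
  rearranged; no derivative has to be computed.\<close>

lemma pow_nl_tangent:
  assumes "2 \<le> p"
  shows "\<bar>a\<bar> powr p / p + pow_nl p a * (b - a) \<le> \<bar>b\<bar> powr p / p"
proof -
  have "pow_nl p a * (b - a) = pow_nl p a * b - \<bar>a\<bar> powr p"
    unfolding right_diff_distrib pow_nl_mult_self ..
  moreover have "pow_nl p a * b \<le> (1 - 1 / p) * \<bar>a\<bar> powr p + \<bar>b\<bar> powr p / p"
    using pow_nl_Young[OF assms, of a b] by linarith
  ultimately show ?thesis by (simp add: left_diff_distrib)
qed

lemma powr_superadditive:
  fixes x y q :: real
  assumes "1 \<le> q" "0 \<le> x" "0 \<le> y"
  shows "x powr q + y powr q \<le> (x + y) powr q"
proof (cases "x + y = 0")
  case True
  then show ?thesis using assms by (simp add: add_nonneg_eq_0_iff)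
next
  case False
  have e: "z powr q = z * z powr (q - 1)" if "0 \<le> z" for z :: real
    using that powr_add[of z 1 "q - 1"] by (cases "z = 0") auto
  have "x * x powr (q - 1) + y * y powr (q - 1) \<le> x * (x + y) powr (q - 1) + y * (x + y) powr (q - 1)"
    using assms by (intro add_mono mult_left_mono powr_mono2) auto
  then show ?thesis using e[of x] e[of y] e[of "x + y"] assms by (simp add: distrib_right)
qed

text \<open>After ordering the arguments and dividing by their difference, only (p - 1)-th powers
  remain. For equal signs superadditivity gives the constant 1. For opposite signs the sum of two
  powers is compared with the power of the sum, which costs the factor 2^(p - 1) and hence produces
  2^(1 - p).\<close>

lemma pow_nl_strongly_monotone:
  assumes p: "2 \<le> p"
  shows "2 powr (1 - p) * \<bar>a - b\<bar> powr p \<le> (pow_nl p a - pow_nl p b) * (a - b)"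
proof -
  let ?q = "p - 1"
  have pos: "pow_nl p x = x powr ?q" if "0 \<le> x" for x
    using abs_pow_nl[of x p] that by simp
  have c: "2 powr (1 - p) \<le> 1" using p powr_mono[of "1 - p" 0 2] by simp
  have fin: "2 powr (1 - p) * \<bar>x - y\<bar> powr p \<le> (pow_nl p x - pow_nl p y) * (x - y)"
    if "2 powr (1 - p) * (x - y) powr ?q \<le> pow_nl p x - pow_nl p y" "y \<le> x" for x y
  proof -
    have "\<bar>x - y\<bar> powr p = (x - y) powr ?q * (x - y)"
      using that(2) powr_add[of "x - y" "?q" 1] by (cases "x = y") auto
    then show ?thesis using mult_right_mono[OF that(1), of "x - y"] that(2) by (simp add: mult.assoc)
  qed
  have pp: "2 powr (1 - p) * \<bar>x - y\<bar> powr p \<le> (pow_nl p x - pow_nl p y) * (x - y)"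
    if "0 \<le> y" "y \<le> x" for x y
  proof (rule fin)
    have "2 powr (1 - p) * (x - y) powr ?q \<le> 1 * (x - y) powr ?q" using c by (intro mult_right_mono) auto
    also have "\<dots> \<le> pow_nl p x - pow_nl p y"
      using powr_superadditive[of ?q "x - y" y] p that pos[of x] pos[of y] by simp
    finally show "2 powr (1 - p) * (x - y) powr ?q \<le> pow_nl p x - pow_nl p y" .
  qed fact
  have pm: "2 powr (1 - p) * \<bar>x - y\<bar> powr p \<le> (pow_nl p x - pow_nl p y) * (x - y)"
    if "y \<le> 0" "0 \<le> x" for x y
  proof (rule fin)
    have "\<bar>x + (- y)\<bar> powr ?q \<le> 2 powr ?q * (\<bar>x\<bar> powr ?q + \<bar>- y\<bar> powr ?q)"
      using p by (intro abs_add_powr_le) auto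
    moreover have "pow_nl p x = \<bar>x\<bar> powr ?q" "pow_nl p y = - (\<bar>- y\<bar> powr ?q)"
      using that pos[of x] pos[of "- y"] by auto
    ultimately have "(x - y) powr ?q \<le> 2 powr ?q * (pow_nl p x - pow_nl p y)"
      using that by (simp only: diff_minus_eq_add) simp
    then have "2 powr (1 - p) * (x - y) powr ?q \<le> 2 powr (1 - p) * (2 powr ?q * (pow_nl p x - pow_nl p y))"
      by (intro mult_left_mono) auto
    also have "\<dots> = pow_nl p x - pow_nl p y" by (simp add: mult.assoc[symmetric] powr_add[symmetric])
    finally show "2 powr (1 - p) * (x - y) powr ?q \<le> pow_nl p x - pow_nl p y" .
  qed (use that in simp)
  have le: "2 powr (1 - p) * \<bar>x - y\<bar> powr p \<le> (pow_nl p x - pow_nl p y) * (x - y)" if "y \<le> x" for x y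
  proof -
    consider "0 \<le> y" | "y \<le> 0" "0 \<le> x" | "x \<le> 0" by linarith
    then show ?thesis
    proof cases
      case 3
      then show ?thesis using pp[of "- x" "- y"] that by (simp add: abs_minus_commute algebra_simps)
    qed (use pp pm that in auto)
  qed
  show ?thesis
  proof (cases "b \<le> a")
    case False
    then show ?thesis using le[of a b] by (simp add: abs_minus_commute algebra_simps)
  qed (rule le)
qed

text \<open>For p = 2 the factor with exponent p - 2 is discontinuous at 0, because
  \<open>0 powr 0 = 0\<close>. At a = 0 the limit is therefore taken through the absolute value,
  whose exponent p - 1 is positive.\<close>

lemma pow_nl_tendsto:
  assumes p: "2 \<le> p" and f: "(f \<longlongrightarrow> a) F"
  shows "((\<lambda>n. pow_nl p (f n)) \<longlongrightarrow> pow_nl p a) F"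
proof (cases "a = 0")
  case False
  then show ?thesis using f by (intro tendsto_intros) auto
next
  case True
  have "((\<lambda>n. \<bar>f n\<bar> powr (p - 1)) \<longlongrightarrow> \<bar>a\<bar> powr (p - 1)) F"
    using p by (intro tendsto_powr2 tendsto_intros f) auto
  then have "((\<lambda>n. \<bar>pow_nl p (f n)\<bar>) \<longlongrightarrow> 0) F"
    unfolding abs_pow_nl using True by simp
  then show ?thesis using True by (simp add: tendsto_rabs_zero_iff)
qed

section \<open>The energy and its derivative\<close>

definition energy :: "real \<Rightarrow> 'a::euclidean_space set \<Rightarrow> ('a \<Rightarrow> real) \<Rightarrow> real" where
  "energy p \<Omega> w = (grad_norm \<Omega> w)\<^sup>2 / 2 + Lp_norm p \<Omega> w powr p / p"

text \<open>Formally the directional derivative of the energy. What is used of it is the tangent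
  inequality, strong monotonicity and continuity along lines, so differentiability of the energy
  need not be established.\<close>

definition energy_deriv :: "real \<Rightarrow> 'a::euclidean_space set \<Rightarrow> ('a \<Rightarrow> real) \<Rightarrow> ('a \<Rightarrow> real) \<Rightarrow> real" where
  "energy_deriv p \<Omega> w \<phi> = grad_inner \<Omega> w \<phi> + L2_inner \<Omega> (\<lambda>x. pow_nl p (w x)) \<phi>"

lemma S_fun_nonneg: "0 \<le> S_fun p \<Omega> w"
  by (simp add: S_fun_def)

text \<open>This converts a bound on the energy into one on the Lagrange multiplier; p \<ge> 2
  compensates for the weight 1/2 of the gradient term.\<close>

lemma S_fun_le_energy: "2 \<le> p \<Longrightarrow> S_fun p \<Omega> w \<le> p * energy p \<Omega> w"
proof -
  assume p: "2 \<le> p"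
  then have "2 * ((grad_norm \<Omega> w)\<^sup>2 / 2) \<le> p * ((grad_norm \<Omega> w)\<^sup>2 / 2)" by (intro mult_right_mono) auto
  then show ?thesis using p by (simp add: S_fun_def energy_def distrib_left)
qed

lemma S_fun_le_one_plus:
  assumes "S_fun p \<Omega> w \<le> M" shows "grad_norm \<Omega> w \<le> M + 1"
proof -
  have "(grad_norm \<Omega> w)\<^sup>2 \<le> M" using assms powr_ge_zero[of "Lp_norm p \<Omega> w" p] unfolding S_fun_def by linarith
  moreover have "2 * grad_norm \<Omega> w \<le> (grad_norm \<Omega> w)\<^sup>2 + 1"
    using sum_squares_bound[of "grad_norm \<Omega> w" 1] by simp
  ultimately show ?thesis using grad_norm_nonneg[of \<Omega> w] by linarith
qed

context
  fixes \<Omega> :: "'a::euclidean_space set" and p :: real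
  assumes \<Omega>: "open \<Omega>" "bounded \<Omega>" and p: "2 \<le> p"
begin

lemma p_pos: "0 < p" "1 \<le> p" using p by auto

lemma LpH01_add: "f \<in> LpH01 p \<Omega> \<Longrightarrow> g \<in> LpH01 p \<Omega> \<Longrightarrow> (\<lambda>x. f x + g x) \<in> LpH01 p \<Omega>"
  and LpH01_cmult: "f \<in> LpH01 p \<Omega> \<Longrightarrow> (\<lambda>x. c * f x) \<in> LpH01 p \<Omega>"
  and LpH01_diff: "f \<in> LpH01 p \<Omega> \<Longrightarrow> g \<in> LpH01 p \<Omega> \<Longrightarrow> (\<lambda>x. f x - g x) \<in> LpH01 p \<Omega>"
  unfolding LpH01_def using p_pos(1) \<Omega>(1)
  by (auto intro: Lp_add H01_add Lp_cmult H01_cmult Lp_diff H01_diff)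

lemma LpH01_H1: "f \<in> LpH01 p \<Omega> \<Longrightarrow> f \<in> H1 \<Omega>"
  using H01_H1[OF \<Omega>(1)] by (simp add: LpH01_def)

lemma LpH01_Lp: "f \<in> LpH01 p \<Omega> \<Longrightarrow> f \<in> Lp p \<Omega>"
  by (simp add: LpH01_def)

lemma LpH01_Lp2: "f \<in> LpH01 p \<Omega> \<Longrightarrow> f \<in> Lp 2 \<Omega>"
  using H1_Lp2[OF \<Omega>(1) LpH01_H1] .

lemma pow_nl_measurable:
  "f \<in> borel_measurable (lebesgue_on \<Omega>) \<Longrightarrow> (\<lambda>x. pow_nl p (f x)) \<in> borel_measurable (lebesgue_on \<Omega>)"
  by measurable

lemma pow_nl_integrable:
  assumes f: "f \<in> Lp p \<Omega>" and g: "g \<in> Lp p \<Omega>"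
  shows "integrable (lebesgue_on \<Omega>) (\<lambda>x. pow_nl p (f x) * g x)"
proof (rule Bochner_Integration.integrable_bound)
  show "integrable (lebesgue_on \<Omega>) (\<lambda>x. \<bar>f x\<bar> powr p + \<bar>g x\<bar> powr p)"
    using f g by (auto simp: Lp_integrable)
  show "(\<lambda>x. pow_nl p (f x) * g x) \<in> borel_measurable (lebesgue_on \<Omega>)"
    using pow_nl_measurable[OF Lp_measurable[OF f]] Lp_measurable[OF g] by measurable
  show "AE x in lebesgue_on \<Omega>. norm (pow_nl p (f x) * g x) \<le> norm (\<bar>f x\<bar> powr p + \<bar>g x\<bar> powr p)"
    using pow_nl_Young'[OF p] by (intro AE_I2) (simp add: abs_of_nonneg add_nonneg_nonneg)
qed

text \<open>The quadratic part is Cauchy-Schwarz followed by 2ab \<le> a^2 + b^2; the power part is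
  the scalar tangent inequality, integrated.\<close>

lemma energy_tangent:
  assumes f: "f \<in> LpH01 p \<Omega>" and g: "g \<in> LpH01 p \<Omega>"
  shows "energy p \<Omega> f + energy_deriv p \<Omega> f (\<lambda>x. g x - f x) \<le> energy p \<Omega> g"
proof -
  have h: "f \<in> H1 \<Omega>" "g \<in> H1 \<Omega>" using f g by (auto intro: LpH01_H1)
  have l: "f \<in> Lp p \<Omega>" "g \<in> Lp p \<Omega>" "(\<lambda>x. g x - f x) \<in> Lp p \<Omega>"
    using f g p_pos by (auto intro: LpH01_Lp Lp_diff)
  have "grad_inner \<Omega> f (\<lambda>x. g x - f x) = grad_inner \<Omega> g f - (grad_norm \<Omega> f)\<^sup>2"
    using h by (simp add: grad_inner_commute[OF \<Omega>(1), of f "\<lambda>x. g x - f x"] grad_inner_diff_left[OF \<Omega>(1)] grad_norm_sq[OF \<Omega>(1)])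
  moreover have "grad_inner \<Omega> g f \<le> grad_norm \<Omega> g * grad_norm \<Omega> f"
    using grad_Cauchy_Schwarz[OF \<Omega>(1) h(2,1)] by linarith
  moreover have "2 * (grad_norm \<Omega> g * grad_norm \<Omega> f) \<le> (grad_norm \<Omega> g)\<^sup>2 + (grad_norm \<Omega> f)\<^sup>2"
    using sum_squares_bound[of "grad_norm \<Omega> g" "grad_norm \<Omega> f"] by simp
  ultimately have 1: "(grad_norm \<Omega> f)\<^sup>2 / 2 + grad_inner \<Omega> f (\<lambda>x. g x - f x) \<le> (grad_norm \<Omega> g)\<^sup>2 / 2"
    by simp
  have "(LINT x|lebesgue_on \<Omega>. \<bar>f x\<bar> powr p / p + pow_nl p (f x) * (g x - f x)) \<le> (LINT x|lebesgue_on \<Omega>. \<bar>g x\<bar> powr p / p)"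
    using l pow_nl_integrable[OF l(1,3)] pow_nl_tangent[OF p] by (intro integral_mono) (auto simp: Lp_integrable)
  then have 2: "Lp_norm p \<Omega> f powr p / p + L2_inner \<Omega> (\<lambda>x. pow_nl p (f x)) (\<lambda>x. g x - f x) \<le> Lp_norm p \<Omega> g powr p / p"
    using l pow_nl_integrable[OF l(1,3)] p_pos by (simp add: Lp_integrable Lp_norm_powr L2_inner_def)
  show ?thesis using 1 2 by (simp add: energy_def energy_deriv_def)
qed

lemma energy_deriv_monotone:
  assumes f: "f \<in> LpH01 p \<Omega>" and g: "g \<in> LpH01 p \<Omega>"
  defines "d \<equiv> \<lambda>x. f x - g x"
  shows "(grad_norm \<Omega> d)\<^sup>2 + 2 powr (1 - p) * Lp_norm p \<Omega> d powr p \<le> energy_deriv p \<Omega> f d - energy_deriv p \<Omega> g d"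
proof -
  have h: "f \<in> H1 \<Omega>" "g \<in> H1 \<Omega>" "d \<in> H1 \<Omega>" using f g LpH01_diff[OF f g] by (auto simp: d_def intro: LpH01_H1)
  have l: "f \<in> Lp p \<Omega>" "g \<in> Lp p \<Omega>" "d \<in> Lp p \<Omega>" using f g LpH01_diff[OF f g] by (auto simp: d_def intro: LpH01_Lp)
  have 1: "(grad_norm \<Omega> d)\<^sup>2 = grad_inner \<Omega> f d - grad_inner \<Omega> g d"
    unfolding grad_norm_sq[OF \<Omega>(1) h(3)]
    using grad_inner_diff_left[OF \<Omega>(1) h(1,2,3)] by (simp add: d_def)
  have "(LINT x|lebesgue_on \<Omega>. 2 powr (1 - p) * \<bar>d x\<bar> powr p) \<le>
      (LINT x|lebesgue_on \<Omega>. pow_nl p (f x) * d x - pow_nl p (g x) * d x)"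
    using pow_nl_integrable[OF l(1,3)] pow_nl_integrable[OF l(2,3)] l(3) pow_nl_strongly_monotone[OF p]
    by (intro integral_mono) (auto simp: Lp_integrable d_def left_diff_distrib)
  then show ?thesis
    using 1 pow_nl_integrable[OF l(1,3)] pow_nl_integrable[OF l(2,3)] l(3) p_pos
    by (simp add: energy_deriv_def L2_inner_def Lp_integrable Lp_norm_powr)
qed

lemma energy_deriv_cmult:
  assumes "f \<in> LpH01 p \<Omega>" "g \<in> LpH01 p \<Omega>"
  shows "energy_deriv p \<Omega> f (\<lambda>x. c * g x) = c * energy_deriv p \<Omega> f g"
  using assms LpH01_H1
  by (simp add: energy_deriv_def grad_inner_commute[OF \<Omega>(1), of f] grad_inner_cmult_left[OF \<Omega>(1)]
      L2_inner_commute[of \<Omega> "\<lambda>x. pow_nl p (f x)"] L2_inner_cmult_left distrib_left)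

lemma Lp_norm_tendsto:
  assumes "1 \<le> q" "\<forall>\<^sub>F n in F. f n \<in> Lp q \<Omega>" "g \<in> Lp q \<Omega>" and l: "((\<lambda>n. Lp_norm q \<Omega> (\<lambda>x. f n x - g x)) \<longlongrightarrow> 0) F"
  shows "((\<lambda>n. Lp_norm q \<Omega> (f n)) \<longlongrightarrow> Lp_norm q \<Omega> g) F"
proof (rule LIM_zero_cancel, rule Lim_null_comparison[OF _ l])
  show "\<forall>\<^sub>F n in F. norm (Lp_norm q \<Omega> (f n) - Lp_norm q \<Omega> g) \<le> Lp_norm q \<Omega> (\<lambda>x. f n x - g x)"
    using assms(2) by eventually_elim (use Lp_norm_abs_diff_le[OF assms(1) _ assms(3)] in auto)
qed

lemma grad_norm_tendsto:
  assumes "\<forall>\<^sub>F n in F. f n \<in> H1 \<Omega>" "g \<in> H1 \<Omega>" and l: "((\<lambda>n. grad_norm \<Omega> (\<lambda>x. f n x - g x)) \<longlongrightarrow> 0) F"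
  shows "((\<lambda>n. grad_norm \<Omega> (f n)) \<longlongrightarrow> grad_norm \<Omega> g) F"
proof (rule LIM_zero_cancel, rule Lim_null_comparison[OF _ l])
  show "\<forall>\<^sub>F n in F. norm (grad_norm \<Omega> (f n) - grad_norm \<Omega> g) \<le> grad_norm \<Omega> (\<lambda>x. f n x - g x)"
    using assms(1) by eventually_elim (use grad_norm_abs_diff_le[OF \<Omega>(1) _ assms(2)] in auto)
qed

lemma S_fun_energy_tendsto:
  assumes ev: "\<forall>\<^sub>F n in F. f n \<in> LpH01 p \<Omega>" and g: "g \<in> LpH01 p \<Omega>"
    and l: "((\<lambda>n. LpH01_norm p \<Omega> (\<lambda>x. f n x - g x)) \<longlongrightarrow> 0) F"
  shows "((\<lambda>n. S_fun p \<Omega> (f n)) \<longlongrightarrow> S_fun p \<Omega> g) F" "((\<lambda>n. energy p \<Omega> (f n)) \<longlongrightarrow> energy p \<Omega> g) F"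
proof -
  have lp: "((\<lambda>n. Lp_norm p \<Omega> (\<lambda>x. f n x - g x)) \<longlongrightarrow> 0) F"
    by (rule Lim_null_comparison[OF _ l]) (simp add: LpH01_norm_def)
  have lg: "((\<lambda>n. grad_norm \<Omega> (\<lambda>x. f n x - g x)) \<longlongrightarrow> 0) F"
    by (rule Lim_null_comparison[OF _ l]) (simp add: LpH01_norm_def)
  have 1: "((\<lambda>n. Lp_norm p \<Omega> (f n)) \<longlongrightarrow> Lp_norm p \<Omega> g) F"
    using ev g p_pos by (intro Lp_norm_tendsto lp) (auto elim: eventually_mono intro: LpH01_Lp)
  have 2: "((\<lambda>n. grad_norm \<Omega> (f n)) \<longlongrightarrow> grad_norm \<Omega> g) F"
    using ev g by (intro grad_norm_tendsto lg) (auto elim: eventually_mono intro: LpH01_H1)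
  have 3: "((\<lambda>n. Lp_norm p \<Omega> (f n) powr p) \<longlongrightarrow> Lp_norm p \<Omega> g powr p) F"
    using p_pos by (intro tendsto_powr2 1 tendsto_const) auto
  show "((\<lambda>n. S_fun p \<Omega> (f n)) \<longlongrightarrow> S_fun p \<Omega> g) F" unfolding S_fun_def by (intro tendsto_intros 2 3)
  show "((\<lambda>n. energy p \<Omega> (f n)) \<longlongrightarrow> energy p \<Omega> g) F" unfolding energy_def using p_pos by (intro tendsto_intros 2 3) auto
qed

text \<open>Minty's argument: a one-sided bound on the energy increments identifies the derivative.\<close>

lemma energy_deriv_eq_if_energy_ge:
  assumes g: "g \<in> LpH01 p \<Omega>"
    and ge: "\<And>\<phi>. \<phi> \<in> LpH01 p \<Omega> \<Longrightarrow> energy p \<Omega> g + c * L2_inner \<Omega> g \<phi> \<le> energy p \<Omega> (\<lambda>x. g x + \<phi> x)"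
    and \<phi>: "\<phi> \<in> LpH01 p \<Omega>"
  shows "energy_deriv p \<Omega> g \<phi> = c * L2_inner \<Omega> g \<phi>"
proof -
  have le: "c * L2_inner \<Omega> g \<phi> \<le> energy_deriv p \<Omega> g \<phi>" if \<phi>: "\<phi> \<in> LpH01 p \<Omega>" for \<phi>
  proof -
    define e where "e n = inverse (real (Suc n))" for n
    have e: "0 < e n" "e n \<le> 1" for n by (auto simp: e_def inverse_le_1_iff)
    have e0: "e \<longlonglongrightarrow> 0" unfolding e_def by (rule LIMSEQ_inverse_real_of_nat)
    have l: "g \<in> Lp p \<Omega>" "\<phi> \<in> Lp p \<Omega>" using g \<phi> by (auto intro: LpH01_Lp)
    have h: "g \<in> H1 \<Omega>" "\<phi> \<in> H1 \<Omega>" using g \<phi> by (auto intro: LpH01_H1)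
    have ge_mem: "(\<lambda>x. g x + e n * \<phi> x) \<in> LpH01 p \<Omega>" for n using g \<phi> by (intro LpH01_add LpH01_cmult)
    \<comment> \<open>The hypothesis is used for the increment e n \<phi>, and the tangent
      inequality at the perturbed point g + e n \<phi> rather than at g, looking back to g. Dividing
      by \<open>e n\<close> leaves a lower bound for the derivative at the perturbed point, which
      then moves to g.\<close>
    have bd: "c * L2_inner \<Omega> g \<phi> \<le> energy_deriv p \<Omega> (\<lambda>x. g x + e n * \<phi> x) \<phi>" for n
    proof -
      have "energy p \<Omega> g + c * (e n * L2_inner \<Omega> g \<phi>) \<le> energy p \<Omega> (\<lambda>x. g x + e n * \<phi> x)"
        using ge[OF LpH01_cmult[OF \<phi>, of "e n"]] L2_inner_cmult_left[of \<Omega> "e n" \<phi> g]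
        by (simp add: L2_inner_commute[of \<Omega> g])
      moreover have "energy p \<Omega> (\<lambda>x. g x + e n * \<phi> x) - e n * energy_deriv p \<Omega> (\<lambda>x. g x + e n * \<phi> x) \<phi> \<le> energy p \<Omega> g"
        using energy_tangent[OF ge_mem[of n] g] energy_deriv_cmult[OF ge_mem[of n] \<phi>, of "- e n"] by simp
      ultimately have "e n * (c * L2_inner \<Omega> g \<phi>) \<le> e n * energy_deriv p \<Omega> (\<lambda>x. g x + e n * \<phi> x) \<phi>"
        by (simp add: algebra_simps)
      then show ?thesis using e(1)[of n] by simp
    qed
    have "(\<lambda>n. grad_inner \<Omega> g \<phi> + e n * grad_inner \<Omega> \<phi> \<phi>) \<longlonglongrightarrow> grad_inner \<Omega> g \<phi> + 0 * grad_inner \<Omega> \<phi> \<phi>"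
      by (intro tendsto_intros e0)
    moreover have "(\<lambda>n. L2_inner \<Omega> (\<lambda>x. pow_nl p (g x + e n * \<phi> x)) \<phi>) \<longlonglongrightarrow> L2_inner \<Omega> (\<lambda>x. pow_nl p (g x)) \<phi>"
      unfolding L2_inner_def
    \<comment> \<open>The bound is Young's inequality followed by the estimate for the power of a
      sum, with e n \<le> 1 removing the dependence on n.\<close>
    proof (rule integral_dominated_convergence[where w = "\<lambda>x. 2 powr p * (\<bar>g x\<bar> powr p + \<bar>\<phi> x\<bar> powr p) + \<bar>\<phi> x\<bar> powr p"])
      note [measurable] = Lp_measurable[OF l(1)] Lp_measurable[OF l(2)]
      show "(\<lambda>x. pow_nl p (g x) * \<phi> x) \<in> borel_measurable (lebesgue_on \<Omega>)" by measurable
      show "(\<lambda>x. pow_nl p (g x + e n * \<phi> x) * \<phi> x) \<in> borel_measurable (lebesgue_on \<Omega>)" for n by measurable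
      show "integrable (lebesgue_on \<Omega>) (\<lambda>x. 2 powr p * (\<bar>g x\<bar> powr p + \<bar>\<phi> x\<bar> powr p) + \<bar>\<phi> x\<bar> powr p)"
        using l by (auto simp: Lp_integrable)
      have "(\<lambda>n. pow_nl p (g x + e n * \<phi> x) * \<phi> x) \<longlonglongrightarrow> pow_nl p (g x + 0 * \<phi> x) * \<phi> x" for x
        by (intro tendsto_mult[OF pow_nl_tendsto[OF p] tendsto_const] tendsto_intros e0)
      then show "AE x in lebesgue_on \<Omega>. (\<lambda>n. pow_nl p (g x + e n * \<phi> x) * \<phi> x) \<longlonglongrightarrow> pow_nl p (g x) * \<phi> x"
        by simp
      fix n
      have "\<bar>pow_nl p (g x + e n * \<phi> x) * \<phi> x\<bar> \<le> 2 powr p * (\<bar>g x\<bar> powr p + \<bar>\<phi> x\<bar> powr p) + \<bar>\<phi> x\<bar> powr p" for x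
      proof -
        have "\<bar>e n * \<phi> x\<bar> \<le> 1 * \<bar>\<phi> x\<bar>" unfolding abs_mult using e[of n] by (intro mult_right_mono) auto
        then have "\<bar>e n * \<phi> x\<bar> powr p \<le> \<bar>\<phi> x\<bar> powr p" using p_pos by (intro powr_mono2) auto
        then have "2 powr p * (\<bar>g x\<bar> powr p + \<bar>e n * \<phi> x\<bar> powr p) \<le> 2 powr p * (\<bar>g x\<bar> powr p + \<bar>\<phi> x\<bar> powr p)"
          by (intro mult_left_mono) auto
        then show ?thesis
          using pow_nl_Young'[OF p, of "g x + e n * \<phi> x" "\<phi> x"] abs_add_powr_le[OF p_pos(1), of "g x" "e n * \<phi> x"] by linarith
      qed
      then show "AE x in lebesgue_on \<Omega>. norm (pow_nl p (g x + e n * \<phi> x) * \<phi> x) \<le>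
          2 powr p * (\<bar>g x\<bar> powr p + \<bar>\<phi> x\<bar> powr p) + \<bar>\<phi> x\<bar> powr p" by simp
    qed
    ultimately have "(\<lambda>n. (grad_inner \<Omega> g \<phi> + e n * grad_inner \<Omega> \<phi> \<phi>) + L2_inner \<Omega> (\<lambda>x. pow_nl p (g x + e n * \<phi> x)) \<phi>)
        \<longlonglongrightarrow> (grad_inner \<Omega> g \<phi> + 0 * grad_inner \<Omega> \<phi> \<phi>) + L2_inner \<Omega> (\<lambda>x. pow_nl p (g x)) \<phi>"
      by (rule tendsto_add)
    moreover have "grad_inner \<Omega> g \<phi> + e n * grad_inner \<Omega> \<phi> \<phi> + L2_inner \<Omega> (\<lambda>x. pow_nl p (g x + e n * \<phi> x)) \<phi> =
        energy_deriv p \<Omega> (\<lambda>x. g x + e n * \<phi> x) \<phi>" for n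
      using h by (simp add: energy_deriv_def grad_inner_add_left[OF \<Omega>(1)] grad_inner_cmult_left[OF \<Omega>(1)] H1_cmult[OF \<Omega>(1)])
    ultimately have "(\<lambda>n. energy_deriv p \<Omega> (\<lambda>x. g x + e n * \<phi> x) \<phi>) \<longlonglongrightarrow> energy_deriv p \<Omega> g \<phi>"
      by (simp add: energy_deriv_def)
    then show ?thesis by (rule LIMSEQ_le_const) (use bd in auto)
  qed
  \<comment> \<open>Both sides are linear in \<phi>, so the inequality for the opposite direction is
    the reverse inequality.\<close>
  have "c * L2_inner \<Omega> g (\<lambda>x. -1 * \<phi> x) \<le> energy_deriv p \<Omega> g (\<lambda>x. -1 * \<phi> x)"
    by (rule le[OF LpH01_cmult[OF \<phi>]])
  then have "- (c * L2_inner \<Omega> g \<phi>) \<le> - energy_deriv p \<Omega> g \<phi>"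
    unfolding energy_deriv_cmult[OF g \<phi>] L2_inner_commute[of \<Omega> g "\<lambda>x. -1 * \<phi> x"] L2_inner_cmult_left
    by (simp add: L2_inner_commute)
  with le[OF \<phi>] show ?thesis by simp
qed

end

section \<open>Compactness of almost critical sequences\<close>

text \<open>A Palais-Smale property of the energy on the sphere, with \<open>S_fun\<close> as
  Lagrange multiplier and r as residual. The difference of two equations controls the gradient norm
  and the L^p norm of the difference by its L2 norm, so compactness in L2 suffices for every
  p.\<close>

lemma almost_critical_sequence_compact:
  fixes \<Omega> :: "'a::euclidean_space set" and p :: real
  assumes \<Omega>: "open \<Omega>" "bounded \<Omega>" and p: "2 \<le> p"
    and w: "\<And>n::nat. w n \<in> LpH01 p \<Omega> \<inter> L2_sphere \<Omega>" and r: "\<And>n. r n \<in> Lp 2 \<Omega>"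
    and r0: "(\<lambda>n. Lp_norm 2 \<Omega> (r n)) \<longlonglongrightarrow> 0" and M: "\<And>n. S_fun p \<Omega> (w n) \<le> M"
    and eq: "\<And>n \<phi>. \<phi> \<in> LpH01 p \<Omega> \<Longrightarrow>
      energy_deriv p \<Omega> (w n) \<phi> = S_fun p \<Omega> (w n) * L2_inner \<Omega> (w n) \<phi> - L2_inner \<Omega> (r n) \<phi>"
  obtains k g where "strict_mono (k :: nat \<Rightarrow> nat)" "g \<in> LpH01 p \<Omega> \<inter> L2_sphere \<Omega>"
    "(\<lambda>n. LpH01_norm p \<Omega> (\<lambda>x. w (k n) x - g x)) \<longlonglongrightarrow> 0"
    "(\<lambda>n. S_fun p \<Omega> (w (k n))) \<longlonglongrightarrow> S_fun p \<Omega> g" "solves_stationary p \<Omega> g"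
proof -
  note p0 = p_pos[OF \<Omega> p]
  have wL: "w n \<in> LpH01 p \<Omega>" and wS: "Lp_norm 2 \<Omega> (w n) = 1" for n using w[of n] by (auto simp: L2_sphere_def)
  have w2: "w n \<in> Lp 2 \<Omega>" for n using LpH01_Lp2[OF \<Omega> p wL] .
  have M0: "0 \<le> M" using order_trans[OF S_fun_nonneg M] .
  have b1: "Lp_norm 2 \<Omega> (w n) \<le> M + 1" for n using wS M0 by simp
  have b2: "grad_norm \<Omega> (w n) \<le> M + 1" for n using S_fun_le_one_plus[OF M] .
  have wH: "w n \<in> H01 \<Omega>" for n using wL by (simp add: LpH01_def)
  obtain k where k: "strict_mono (k :: nat \<Rightarrow> nat)"
    "\<And>e. 0 < e \<Longrightarrow> \<exists>N. \<forall>m\<ge>N. \<forall>n\<ge>N. Lp_norm 2 \<Omega> (\<lambda>x. w (k m) x - w (k n) x) \<le> e"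
    by (rule Rellich_H01[OF \<Omega>(1,2), of w, OF wH b1 b2]) blast
  define v where "v n = w (k n)" for n
  define q where "q n = r (k n)" for n
  have vL: "v n \<in> LpH01 p \<Omega>" and v2: "v n \<in> Lp 2 \<Omega>" and q2: "q n \<in> Lp 2 \<Omega>" for n
    using wL w2 r by (auto simp: v_def q_def)
  have v1: "Lp_norm 2 \<Omega> (v n) = 1" for n using wS by (simp add: v_def)
  have q0: "(\<lambda>n. Lp_norm 2 \<Omega> (q n)) \<longlonglongrightarrow> 0"
    using LIMSEQ_subseq_LIMSEQ[OF r0 k(1)] by (simp add: q_def comp_def)
  have veq: "energy_deriv p \<Omega> (v n) \<phi> = S_fun p \<Omega> (v n) * L2_inner \<Omega> (v n) \<phi> - L2_inner \<Omega> (q n) \<phi>"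
    if "\<phi> \<in> LpH01 p \<Omega>" for n \<phi> using eq[OF that] by (simp add: v_def q_def)
  obtain R where R: "R > 0" "\<And>n. Lp_norm 2 \<Omega> (q n) \<le> R"
    using convergent_imp_Bseq[OF convergentI[OF q0]] by (auto simp: Bseq_def)
  \<comment> \<open>Two multiplier terms contribute at most M each, since the solutions have L2 norm
    1, and two residuals at most R each. The factor 2 in front of R only provides room to spare for
    neither term: both counts are exactly two.\<close>
  define K where "K = 2 * M + 2 * R"
  have K0: "K > 0" using M0 R by (simp add: K_def)
  define c where "c = 2 powr (1 - p)"
  have c0: "c > 0" by (simp add: c_def)
  have key: "(grad_norm \<Omega> (\<lambda>x. v m x - v n x))\<^sup>2 + c * Lp_norm p \<Omega> (\<lambda>x. v m x - v n x) powr p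
      \<le> K * Lp_norm 2 \<Omega> (\<lambda>x. v m x - v n x)" for m n
  proof -
    let ?d = "\<lambda>x. v m x - v n x"
    let ?N = "Lp_norm 2 \<Omega> ?d"
    have d: "?d \<in> LpH01 p \<Omega>" "?d \<in> Lp 2 \<Omega>" using LpH01_diff[OF \<Omega> p vL vL] LpH01_Lp2[OF \<Omega> p] by auto
    have b: "\<bar>L2_inner \<Omega> (v i) ?d\<bar> \<le> ?N" for i using L2_Cauchy_Schwarz[OF v2[of i] d(2)] v1 by simp
    have s: "\<bar>S_fun p \<Omega> (v i) * L2_inner \<Omega> (v i) ?d\<bar> \<le> M * ?N" for i
      unfolding abs_mult using M[of "k i"] M0 S_fun_nonneg[of p \<Omega> "v i"] by (intro mult_mono b) (auto simp: v_def)
    have t: "\<bar>L2_inner \<Omega> (q i) ?d\<bar> \<le> R * ?N" for i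
      using L2_Cauchy_Schwarz[OF q2[of i] d(2)] mult_right_mono[OF R(2)[of i], of ?N] by simp
    show ?thesis
      using energy_deriv_monotone[OF \<Omega> p vL[of m] vL[of n]] veq[OF d(1), of m] veq[OF d(1), of n]
        s[of m] s[of n] t[of m] t[of n] by (simp add: K_def c_def algebra_simps)
  qed
  have L2c: "\<exists>N. \<forall>m\<ge>N. \<forall>n\<ge>N. Lp_norm 2 \<Omega> (\<lambda>x. v m x - v n x) \<le> e" if "e > 0" for e
    using k(2)[OF that] by (simp add: v_def)
  have gradc: "\<exists>N. \<forall>m\<ge>N. \<forall>n\<ge>N. grad_norm \<Omega> (\<lambda>x. v m x - v n x) \<le> e" if e: "e > 0" for e
  proof -
    have "e\<^sup>2 / K > 0" using e K0 by simp
    from L2c[OF this] obtain N where N: "\<And>m n. m \<ge> N \<Longrightarrow> n \<ge> N \<Longrightarrow> Lp_norm 2 \<Omega> (\<lambda>x. v m x - v n x) \<le> e\<^sup>2 / K" by blast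
    show ?thesis
    proof (intro exI[of _ N] allI impI)
      fix m n assume "N \<le> m" "N \<le> n"
      then have "K * Lp_norm 2 \<Omega> (\<lambda>x. v m x - v n x) \<le> e\<^sup>2"
        using N[of m n] K0 by (simp add: field_simps)
      moreover have "0 \<le> c * Lp_norm p \<Omega> (\<lambda>x. v m x - v n x) powr p" using c0 by simp
      ultimately have "(grad_norm \<Omega> (\<lambda>x. v m x - v n x))\<^sup>2 \<le> e\<^sup>2" using key[of m n] by linarith
      then show "grad_norm \<Omega> (\<lambda>x. v m x - v n x) \<le> e" by (rule power2_le_imp_le) (use e in simp)
    qed
  qed
  have Lpc: "\<exists>N. \<forall>m\<ge>N. \<forall>n\<ge>N. Lp_norm p \<Omega> (\<lambda>x. v m x - v n x) \<le> e" if e: "e > 0" for e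
  proof -
    have "c * e powr p / K > 0" using e K0 c0 by simp
    from L2c[OF this] obtain N where N: "\<And>m n. m \<ge> N \<Longrightarrow> n \<ge> N \<Longrightarrow> Lp_norm 2 \<Omega> (\<lambda>x. v m x - v n x) \<le> c * e powr p / K" by blast
    show ?thesis
    proof (intro exI[of _ N] allI impI)
      fix m n assume "N \<le> m" "N \<le> n"
      then have "K * Lp_norm 2 \<Omega> (\<lambda>x. v m x - v n x) \<le> c * e powr p"
        using N[of m n] K0 by (simp add: field_simps)
      moreover have "0 \<le> (grad_norm \<Omega> (\<lambda>x. v m x - v n x))\<^sup>2" by simp
      ultimately have "c * Lp_norm p \<Omega> (\<lambda>x. v m x - v n x) powr p \<le> c * e powr p" using key[of m n] by linarith
      then show "Lp_norm p \<Omega> (\<lambda>x. v m x - v n x) \<le> e"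
        using c0 e p0(1) by (simp add: Lp_norm_le_iff Lp_norm_powr)
    qed
  qed
  \<comment> \<open>The limit is constructed in L^p. Boundedness of \<Omega> makes it an L2 limit
    too, which is the form that completeness of \<open>H01\<close> expects, so that both norms share
    one limit.\<close>
  obtain g where g: "g \<in> Lp p \<Omega>" "(\<lambda>n. Lp_norm p \<Omega> (\<lambda>x. v n x - g x)) \<longlonglongrightarrow> 0"
    by (rule Lp_complete[where f = v, OF p0(2) LpH01_Lp[OF \<Omega> p vL] Lpc]) auto
  have g2: "g \<in> Lp 2 \<Omega>" using Lp_subset_Lp2[OF p \<Omega> g(1)] .
  have l2: "(\<lambda>n. Lp_norm 2 \<Omega> (\<lambda>x. v n x - g x)) \<longlonglongrightarrow> 0"
    by (rule Lp_tendsto_imp_Lp2_tendsto[OF p \<Omega> Lp_diff[OF p0(1) LpH01_Lp[OF \<Omega> p vL] g(1)] g(2)])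
  have vH: "v n \<in> H01 \<Omega>" for n using vL by (simp add: LpH01_def)
  note gH = H01_complete[OF \<Omega>(1) vH g2 l2 gradc]
  have gL: "g \<in> LpH01 p \<Omega>" using g(1) gH(1) by (simp add: LpH01_def)
  have lim: "(\<lambda>n. LpH01_norm p \<Omega> (\<lambda>x. v n x - g x)) \<longlonglongrightarrow> 0"
    unfolding LpH01_norm_def using tendsto_max[OF g(2) gH(2)] by simp
  have "(\<lambda>n. Lp_norm 2 \<Omega> (v n)) \<longlonglongrightarrow> Lp_norm 2 \<Omega> g"
    using v2 by (intro Lp_norm_tendsto[OF \<Omega> p] g2 l2) auto
  then have "Lp_norm 2 \<Omega> g = 1" unfolding v1 by (simp add: LIMSEQ_const_iff)
  then have gS: "g \<in> LpH01 p \<Omega> \<inter> L2_sphere \<Omega>" using gL g2 by (simp add: L2_sphere_def)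
  note lims = S_fun_energy_tendsto[OF \<Omega> p always_eventually[OF allI[OF vL]] gL lim]
  have stat: "energy_deriv p \<Omega> g \<phi> = S_fun p \<Omega> g * L2_inner \<Omega> g \<phi>" if \<phi>: "\<phi> \<in> LpH01 p \<Omega>" for \<phi>
  proof (rule energy_deriv_eq_if_energy_ge[OF \<Omega> p gL _ \<phi>])
    fix \<phi> assume \<phi>: "\<phi> \<in> LpH01 p \<Omega>"
    have \<phi>2: "\<phi> \<in> Lp 2 \<Omega>" using LpH01_Lp2[OF \<Omega> p \<phi>] .
    have sum: "(\<lambda>x. v n x + \<phi> x) \<in> LpH01 p \<Omega>" "(\<lambda>x. g x + \<phi> x) \<in> LpH01 p \<Omega>" for n
      using vL gL \<phi> by (auto intro: LpH01_add[OF \<Omega> p])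
    \<comment> \<open>The tangent inequality, combined with the equation, contains the nonlinearity
      only through \<open>energy\<close> and \<open>S_fun\<close>, both continuous in the norm. The
      passage to the limit thus needs no convergence of |v n|^(p - 2) v n.\<close>
    have le: "energy p \<Omega> (v n) + (S_fun p \<Omega> (v n) * L2_inner \<Omega> (v n) \<phi> - L2_inner \<Omega> (q n) \<phi>) \<le>
        energy p \<Omega> (\<lambda>x. v n x + \<phi> x)" for n
      using energy_tangent[OF \<Omega> p vL[of n] sum(1)[of n]] veq[OF \<phi>, of n] by simp
    have 1: "(\<lambda>n. L2_inner \<Omega> (v n) \<phi>) \<longlonglongrightarrow> L2_inner \<Omega> g \<phi>" by (rule L2_inner_tendsto[OF v2 g2 \<phi>2 l2])
    have 2: "(\<lambda>n. L2_inner \<Omega> (q n) \<phi>) \<longlonglongrightarrow> 0"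
    proof -
      have "(\<lambda>n. L2_inner \<Omega> (q n) \<phi>) \<longlonglongrightarrow> L2_inner \<Omega> (\<lambda>x. 0) \<phi>"
        by (rule L2_inner_tendsto[OF q2 Lp_zero \<phi>2]) (simp add: q0)
      then show ?thesis by (simp add: L2_inner_def)
    qed
    have "(\<lambda>n. energy p \<Omega> (v n) + (S_fun p \<Omega> (v n) * L2_inner \<Omega> (v n) \<phi> - L2_inner \<Omega> (q n) \<phi>)) \<longlonglongrightarrow>
        energy p \<Omega> g + (S_fun p \<Omega> g * L2_inner \<Omega> g \<phi> - 0)"
      by (intro tendsto_intros lims 1 2)
    moreover have "(\<lambda>n. energy p \<Omega> (\<lambda>x. v n x + \<phi> x)) \<longlonglongrightarrow> energy p \<Omega> (\<lambda>x. g x + \<phi> x)"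
      by (rule S_fun_energy_tendsto(2)[OF \<Omega> p always_eventually[OF allI[OF sum(1)]] sum(2)]) (simp add: lim)
    ultimately show "energy p \<Omega> g + S_fun p \<Omega> g * L2_inner \<Omega> g \<phi> \<le> energy p \<Omega> (\<lambda>x. g x + \<phi> x)"
      using LIMSEQ_le le by fastforce
  qed
  have "solves_stationary p \<Omega> g"
    unfolding solves_stationary_def dual_laplacian_def
  proof
    fix \<phi> assume "\<phi> \<in> LpH01 p \<Omega>"
    from stat[OF this] show "- grad_inner \<Omega> g \<phi> - L2_inner \<Omega> (\<lambda>x. pow_nl p (g x)) \<phi> + S_fun p \<Omega> g * L2_inner \<Omega> g \<phi> = 0"
      unfolding energy_deriv_def by linarith
  qed
  then show thesis using that[OF k(1) gS] lim lims(1) by (simp add: v_def)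
qed

section \<open>Boundedness of the energy along the flow\<close>

text \<open>If all good points violated the bound, integration over (a, b] would give (A + e)(b - a)
  \<le> (b - a) A, where A is the integral of h. The slack e > 0 makes this a contradiction.\<close>

lemma AE_pick:
  fixes h :: "real \<Rightarrow> real"
  assumes ae: "AE t in lebesgue_on {0<..}. P t" and h: "integrable (lebesgue_on {0<..}) h"
    and ab: "0 \<le> a" "a < b" and e: "0 < e"
  obtains t where "a < t" "t < b" "P t" "(b - a) * h t \<le> (LINT \<tau>|lebesgue_on {0<..}. indicator {a<..b} \<tau> * h \<tau>) + e"
proof (rule ccontr)
  let ?M = "lebesgue_on {0<..} :: real measure" and ?I = "{a<..b}"
  define A where "A = (LINT \<tau>|?M. indicator ?I \<tau> * h \<tau>)"
  assume "\<not> thesis"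
  with that have no: "A + e < (b - a) * h t" if "a < t" "t < b" "P t" for t
    using that unfolding A_def by (meson not_le)
  have I: "?I \<in> sets ?M" "emeasure ?M ?I = ennreal (b - a)" "measure ?M ?I = b - a"
    using measure_lebesgue_on_Ioc[of a b] ab by auto
  \<comment> \<open>The integral is over a half-open cell, but the point has to lie strictly inside;
    the right endpoint is a null set.\<close>
  have "AE t in lebesgue. t \<noteq> b" by (rule AE_completion[OF AE_lborel_singleton])
  then have nb: "AE t in ?M. t \<noteq> b" by (auto simp: AE_restrict_space_iff)
  have ii: "integrable ?M (\<lambda>t. indicator ?I t * h t)" using integrable_mult_indicator[OF I(1) h] by simp
  have i1: "integrable ?M (indicator ?I :: real \<Rightarrow> real)" using I by (intro integrable_real_indicator) auto
  have "(LINT t|?M. (A + e) * indicator ?I t) \<le> (LINT t|?M. (b - a) * (indicator ?I t * h t))"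
  proof (rule integral_mono_AE)
    show "AE t in ?M. (A + e) * indicator ?I t \<le> (b - a) * (indicator ?I t * h t)"
      using ae nb
    proof eventually_elim
      case (elim t)
      show ?case
      proof (cases "t \<in> ?I")
        case True
        then have "A + e < (b - a) * h t" using elim by (intro no) auto
        then show ?thesis using True by simp
      qed simp
    qed
  qed (use ii i1 in auto)
  also have "\<dots> = (b - a) * A" by (simp add: A_def)
  also have "(LINT t|?M. (A + e) * indicator ?I t) = (A + e) * (b - a)"
  proof -
    have "?I \<inter> {0<..} = ?I" using ab by auto
    then show ?thesis using I by simp
  qed
  finally have "e * (b - a) \<le> 0" by (simp add: algebra_simps)
  then show False using e ab by (simp add: mult_le_0_iff)
qed

text \<open>
  The energy inequality holds only for almost every \<open>t\<close>, so a partition of \<open>[1, T]\<close> is used with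
  one good point in each cell at which \<open>g\<^sup>2\<close> is at most about its mean over the cell.
\<close>

lemma bounded_by_dissipation:
  fixes f g S :: "real \<Rightarrow> real"
  assumes good: "AE t in lebesgue_on {0<..}. P t" and gi: "integrable (lebesgue_on {0<..}) (\<lambda>t. (g t)\<^sup>2)"
    and f: "continuous_on {0..} f" and S: "continuous_on {0..} S"
    and S0: "\<And>t. 0 \<le> S t"
    and step: "\<And>s t t'. P t \<Longrightarrow> 0 < s \<Longrightarrow> s < t \<Longrightarrow> t < t' \<Longrightarrow>
      \<exists>D. f t - f s \<le> S t / 2 * D\<^sup>2 + g t * D \<and>
          D\<^sup>2 \<le> (t' - s) * (LINT \<tau>|lebesgue_on {0<..}. indicator {s<..t'} \<tau> * (g \<tau>)\<^sup>2)"
  obtains C where "\<And>T. 0 \<le> T \<Longrightarrow> f T \<le> C"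
proof -
  let ?M = "lebesgue_on {0<..} :: real measure"
  define I where "I = (LINT \<tau>|?M. (g \<tau>)\<^sup>2)"
  \<comment> \<open>The dissipation accumulated up to x. Its increments measure the cells and
    telescope, and it never exceeds the total I.\<close>
  define \<Phi> where "\<Phi> x = (LINT \<tau>|?M. indicator {0<..x} \<tau> * (g \<tau>)\<^sup>2)" for x
  have ii: "integrable ?M (\<lambda>\<tau>. indicator {x<..y} \<tau> * (g \<tau>)\<^sup>2)" if "0 \<le> x" "x \<le> y" for x y
    using integrable_mult_indicator[OF measure_lebesgue_on_Ioc(1)[OF that] gi] by simp
  have \<Phi>d: "(LINT \<tau>|?M. indicator {x<..y} \<tau> * (g \<tau>)\<^sup>2) = \<Phi> y - \<Phi> x" if "0 \<le> x" "x \<le> y" for x y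
  proof -
    have "(LINT \<tau>|?M. indicator {x<..y} \<tau> * (g \<tau>)\<^sup>2) =
        (LINT \<tau>|?M. indicator {0<..y} \<tau> * (g \<tau>)\<^sup>2 - indicator {0<..x} \<tau> * (g \<tau>)\<^sup>2)"
      using that by (intro Bochner_Integration.integral_cong) (auto simp: indicator_def)
    then show ?thesis using ii[of 0 y] ii[of 0 x] that by (simp add: \<Phi>_def)
  qed
  have \<Phi>mono: "\<Phi> x \<le> \<Phi> y" if "0 \<le> x" "x \<le> y" for x y
  proof -
    have "0 \<le> (LINT \<tau>|?M. indicator {x<..y} \<tau> * (g \<tau>)\<^sup>2)" by (intro integral_nonneg_AE) auto
    then show ?thesis using \<Phi>d[OF that] by simp
  qed
  have \<Phi>I: "\<Phi> x \<le> I" if "0 \<le> x" for x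
    unfolding \<Phi>_def I_def using ii[of 0 x] that gi by (intro integral_mono) (auto simp: indicator_def)
  have \<Phi>0: "0 \<le> \<Phi> x" for x unfolding \<Phi>_def by (intro integral_nonneg_AE) auto
  have bdd: "\<exists>B. \<forall>t\<in>{0..T}. h t \<le> B" if "continuous_on {0..} h" for h :: "real \<Rightarrow> real" and T
  proof -
    have "bounded (h ` {0..T})"
      using continuous_on_subset[OF that, of "{0..T}"] by (intro compact_imp_bounded compact_continuous_image) auto
    then obtain B where "\<forall>y\<in>h ` {0..T}. norm y \<le> B" by (auto simp: bounded_iff)
    then have "\<forall>t\<in>{0..T}. h t \<le> B" by (metis abs_le_D1 imageI real_norm_def)
    then show ?thesis ..
  qed
  obtain M0 where M0: "\<forall>t\<in>{0..2}. f t \<le> M0" using bdd[OF f, of 2] by blast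
  have I0: "0 \<le> I" using \<Phi>I[of 0] \<Phi>0[of 0] by simp
  \<comment> \<open>K, d and the number of cells depend on T but drop out of the bound: 6 I is the
    telescoped dissipation, and the 2 consists of the accumulated slack and of the last step from a
    good point to T.\<close>
  have big: "f T \<le> M0 + 6 * I + 2" if T: "2 \<le> T" for T
  proof -
    obtain K where K: "\<forall>t\<in>{0..T}. S t \<le> K" using bdd[OF S, of T] by blast
    have K0: "0 \<le> K" using bspec[OF K, of 0] S0[of 0] T by simp
    obtain d where d: "d > 0" "\<And>t. t \<in> {0..} \<Longrightarrow> dist t T < d \<Longrightarrow> dist (f t) (f T) < 1"
      using f T unfolding continuous_on_iff by (metis atLeast_iff dual_order.trans zero_le_numeral zero_less_one)
    \<comment> \<open>A single inequality makes the mesh width \<delta> smaller than d and 1 and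
      keeps \<delta> K below 1, also when K = 0.\<close>
    obtain n :: nat where n: "(T - 1) * (1 / d + 1 + K) < real n" using reals_Archimedean2 by blast
    have pos: "0 < (T - 1) * (1 / d + 1 + K)" using T d K0 by (intro mult_pos_pos) (auto simp: add_pos_nonneg)
    then have n0: "real n > 0" using n by linarith
    define \<delta> where "\<delta> = (T - 1) / real n"
    have \<delta>0: "\<delta> > 0" using T n0 by (simp add: \<delta>_def)
    have "\<delta> * (1 / d + 1 + K) < 1" using n n0 by (simp add: \<delta>_def)
    then have sm: "\<delta> * (1 / d) + \<delta> + \<delta> * K < 1" by (simp add: algebra_simps)
    have dd: "0 \<le> \<delta> * (1 / d)" "0 \<le> \<delta> * K" using \<delta>0 d(1) K0 by auto
    have \<delta>: "\<delta> < d" "\<delta> \<le> 1" "\<delta> * K \<le> 1"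
    proof -
      have "\<delta> * (1 / d) < 1" using sm dd \<delta>0 by linarith
      then show "\<delta> < d" using d(1) by simp
    qed (use sm dd \<delta>0 in linarith)+
    \<comment> \<open>With the start at 1 and \<delta> \<le> 1 the first good point lies in [0, 2],
      where f is bounded by \<open>M0\<close> independently of T.\<close>
    define x where "x i = 1 + real i * \<delta>" for i
    have x: "1 \<le> x i" "x (Suc i) = x i + \<delta>" for i using \<delta>0 by (auto simp: x_def algebra_simps)
    have xT: "x i \<le> T" if "i \<le> n" for i
    proof -
      have "real i * \<delta> \<le> real n * \<delta>" using that \<delta>0 by (intro mult_right_mono) auto
      then show ?thesis using n0 by (simp add: x_def \<delta>_def)
    qed
    \<comment> \<open>The slack allowed in each cell; over all n cells it adds up to at most
      1.\<close>
    define c where "c = 1 / real n"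
    have c0: "0 < c" using n0 by (simp add: c_def)
    have "\<exists>t. x i < t \<and> t < x (Suc i) \<and> P t \<and> \<delta> * (g t)\<^sup>2 \<le> \<Phi> (x (Suc i)) - \<Phi> (x i) + c" for i
    proof -
      have a: "0 \<le> x i" "x i < x (Suc i)" "0 < c" using x[of i] \<delta>0 c0 by auto
      obtain t where "x i < t" "t < x (Suc i)" "P t"
        "(x (Suc i) - x i) * (g t)\<^sup>2 \<le> (LINT \<tau>|?M. indicator {x i<..x (Suc i)} \<tau> * (g \<tau>)\<^sup>2) + c"
        using AE_pick[OF good gi a] by blast
      then show ?thesis using \<Phi>d[OF a(1) less_imp_le[OF a(2)]] x(2)[of i] by auto
    qed
    then obtain t where t: "\<And>i. x i < t i" "\<And>i. t i < x (Suc i)" "\<And>i. P (t i)"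
      "\<And>i. \<delta> * (g (t i))\<^sup>2 \<le> \<Phi> (x (Suc i)) - \<Phi> (x i) + c" by metis
    \<comment> \<open>Consecutive good points lie in adjacent cells, so one step uses the
      dissipation of two cells. The sum of two consecutive values of \<Phi> is what telescopes under
      this overlap.\<close>
    have ind: "f (t i) \<le> M0 + 3 * (\<Phi> (x (Suc i)) + \<Phi> (x i)) + real i * c" if "i < n" for i
      using that
    proof (induction i)
      case 0
      have "t 0 \<in> {0..2}" using t(1,2)[of 0] \<delta> by (simp add: x_def)
      then show ?case using M0 \<Phi>0[of "x (Suc 0)"] \<Phi>0[of "x 0"] by force
    next
      case (Suc i)
      define B where "B = \<Phi> (x (Suc (Suc i))) - \<Phi> (x i)"
      have o: "x i < t i" "t i < x (Suc i)" "x (Suc i) < t (Suc i)" "t (Suc i) < x (Suc (Suc i))" "1 \<le> x i"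
        using t(1,2)[of i] t(1,2)[of "Suc i"] x(1)[of i] by auto
      have l: "x (Suc (Suc i)) - t i \<le> 2 * \<delta>" using o x(2)[of i] x(2)[of "Suc i"] by linarith
      obtain D where D: "f (t (Suc i)) - f (t i) \<le> S (t (Suc i)) / 2 * D\<^sup>2 + g (t (Suc i)) * D"
        "D\<^sup>2 \<le> (x (Suc (Suc i)) - t i) * (LINT \<tau>|?M. indicator {t i<..x (Suc (Suc i))} \<tau> * (g \<tau>)\<^sup>2)"
        using step[OF t(3)[of "Suc i"], of "t i" "x (Suc (Suc i))"] o by auto
      have "(LINT \<tau>|?M. indicator {t i<..x (Suc (Suc i))} \<tau> * (g \<tau>)\<^sup>2) = \<Phi> (x (Suc (Suc i))) - \<Phi> (t i)"
        using o by (intro \<Phi>d) auto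
      also have "\<dots> \<le> B" unfolding B_def using \<Phi>mono[of "x i" "t i"] o by simp
      finally have iB: "(LINT \<tau>|?M. indicator {t i<..x (Suc (Suc i))} \<tau> * (g \<tau>)\<^sup>2) \<le> B" .
      have B0: "0 \<le> B" unfolding B_def using \<Phi>mono[of "x i" "x (Suc (Suc i))"] o by simp
      have DB: "D\<^sup>2 \<le> 2 * \<delta> * B"
        using D(2) mult_mono[OF l iB] \<delta>0 by (smt (verit) integral_nonneg_AE AE_I2 mult_nonneg_nonneg indicator_pos_le zero_le_power2)
      have St: "S (t (Suc i)) \<le> K"
        using K o xT[of "Suc (Suc i)"] Suc.prems by auto
      have "S (t (Suc i)) / 2 * D\<^sup>2 \<le> K / 2 * (2 * \<delta> * B)"
        using St S0 K0 DB by (intro mult_mono) auto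
      also have "\<dots> = (\<delta> * K) * B" by simp
      also have "\<dots> \<le> 1 * B" using \<delta>(3) B0 by (intro mult_right_mono)
      finally have 1: "S (t (Suc i)) / 2 * D\<^sup>2 \<le> B" by simp
      \<comment> \<open>The product is split with weight \<delta>: the choice of the good point
        bounds \<delta> g^2 by the dissipation of its cell plus c, and D^2 is at most 2 \<delta> B.
        After division by \<delta> only B and the slack remain.\<close>
      have "2 * (\<delta> * g (t (Suc i))) * D \<le> (\<delta> * g (t (Suc i)))\<^sup>2 + D\<^sup>2" by (rule sum_squares_bound)
      also have "\<dots> = \<delta> * (\<delta> * (g (t (Suc i)))\<^sup>2) + D\<^sup>2" by (simp add: power2_eq_square)
      also have "\<dots> \<le> \<delta> * (\<Phi> (x (Suc (Suc i))) - \<Phi> (x (Suc i)) + c) + 2 * \<delta> * B"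
        using t(4)[of "Suc i"] \<delta>0 DB by (intro add_mono mult_left_mono) auto
      also have "\<dots> \<le> \<delta> * (B + c) + 2 * \<delta> * B"
        unfolding B_def using \<Phi>mono[of "x i" "x (Suc i)"] o \<delta>0 by (intro add_mono mult_left_mono) auto
      finally have "\<delta> * (2 * (g (t (Suc i)) * D)) \<le> \<delta> * (3 * B + c)" by (simp add: algebra_simps)
      then have 2: "2 * (g (t (Suc i)) * D) \<le> 3 * B + c" using \<delta>0 by simp
      have "f (t (Suc i)) - f (t i) \<le> 3 * B + c"
        using D(1) 1 2 B0 c0 by linarith
      moreover have "f (t i) \<le> M0 + 3 * (\<Phi> (x (Suc i)) + \<Phi> (x i)) + real i * c"
        using Suc by simp
      ultimately have "f (t (Suc i)) \<le> M0 + 3 * (\<Phi> (x (Suc (Suc i))) + \<Phi> (x (Suc i))) + (real i * c + c)"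
        unfolding B_def by argo
      also have "real i * c + c = real (Suc i) * c" by (simp add: distrib_right)
      finally show ?case .
    qed
    obtain m where m: "n = Suc m" using n0 by (cases n) auto
    have xn: "x (Suc m) = T" using n0 by (simp add: x_def \<delta>_def m[symmetric])
    have "dist (t m) T < d" using t(1,2)[of m] x(2)[of m] xn \<delta>(1) by (auto simp: dist_real_def)
    then have "dist (f (t m)) (f T) < 1" using t(1)[of m] x(1)[of m] by (intro d(2)) auto
    then have "f T \<le> f (t m) + 1" by (auto simp: dist_real_def)
    moreover have "f (t m) \<le> M0 + 3 * (\<Phi> (x (Suc m)) + \<Phi> (x m)) + real m * c" using ind[of m] m by simp
    moreover have "\<Phi> (x (Suc m)) \<le> I" "\<Phi> (x m) \<le> I" using x(1)[of m] x(1)[of "Suc m"] by (auto intro!: \<Phi>I)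
    moreover have "real m * c \<le> 1" using n0 m by (simp add: c_def)
    ultimately show ?thesis by argo
  qed
  show thesis
  proof (rule that[of "M0 + 6 * I + 2"])
    fix T :: real assume "0 \<le> T"
    then show "f T \<le> M0 + 6 * I + 2" using big[of T] M0 I0 by (cases "2 \<le> T") force+
  qed
qed

section \<open>Convergence along a sequence of times\<close>

text \<open>The equation at a single time, with r in the role of the time derivative and the spatial
  terms expressed by the energy. Including r in L2 lets one almost everywhere statement carry all
  that is needed at a good time.\<close>

definition tested_equation ::
  "real \<Rightarrow> 'a::euclidean_space set \<Rightarrow> ('a \<Rightarrow> real) \<Rightarrow> ('a \<Rightarrow> real) \<Rightarrow> bool" where
  "tested_equation p \<Omega> w r \<longleftrightarrow> r \<in> Lp 2 \<Omega> \<and>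
     (\<forall>\<phi>\<in>LpH01 p \<Omega>. energy_deriv p \<Omega> w \<phi> = S_fun p \<Omega> w * L2_inner \<Omega> w \<phi> - L2_inner \<Omega> r \<phi>)"

lemma tested_equationI:
  assumes \<Omega>: "open \<Omega>" "bounded \<Omega>" and p: "2 \<le> p"
    and w: "w \<in> LpH01 p \<Omega>" "w \<in> DA \<Omega>" and r: "r \<in> Lp 2 \<Omega>"
    and eq: "AE x in lebesgue_on \<Omega>. r x = G_op p \<Omega> w x" and G: "G_op p \<Omega> w \<in> Lp 2 \<Omega>"
  shows "tested_equation p \<Omega> w r"
  unfolding tested_equation_def
proof (intro conjI ballI r)
  fix \<phi> assume \<phi>: "\<phi> \<in> LpH01 p \<Omega>"
  have \<phi>2: "\<phi> \<in> Lp 2 \<Omega>" and w2: "w \<in> Lp 2 \<Omega>" using LpH01_Lp2[OF \<Omega> p] \<phi> w by auto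
  have l2: "laplacian \<Omega> w \<in> Lp 2 \<Omega>" by (rule laplacian_Lp2[OF \<Omega>(1) w(2)])
  have nl: "integrable (lebesgue_on \<Omega>) (\<lambda>x. pow_nl p (w x) * \<phi> x)"
    using pow_nl_integrable[OF \<Omega> p LpH01_Lp[OF \<Omega> p w(1)] LpH01_Lp[OF \<Omega> p \<phi>]] .
  have "L2_inner \<Omega> r \<phi> = L2_inner \<Omega> (G_op p \<Omega> w) \<phi>"
    by (rule L2_inner_cong_AE[OF \<Omega>(1) r G \<phi>2 eq])
  also have "\<dots> = (LINT x|lebesgue_on \<Omega>. laplacian \<Omega> w x * \<phi> x - pow_nl p (w x) * \<phi> x + S_fun p \<Omega> w * (w x * \<phi> x))"
    unfolding L2_inner_def G_op_def by (simp add: algebra_simps)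
  also have "\<dots> = L2_inner \<Omega> (laplacian \<Omega> w) \<phi> - L2_inner \<Omega> (\<lambda>x. pow_nl p (w x)) \<phi> + S_fun p \<Omega> w * L2_inner \<Omega> w \<phi>"
    using nl Lp2_integrable_mult[OF l2 \<phi>2] Lp2_integrable_mult[OF w2 \<phi>2] by (simp add: L2_inner_def)
  also have "L2_inner \<Omega> (laplacian \<Omega> w) \<phi> = - grad_inner \<Omega> w \<phi>"
    using \<phi> by (intro laplacian_inner[OF \<Omega>(1) w(2)]) (simp add: LpH01_def)
  finally show "energy_deriv p \<Omega> w \<phi> = S_fun p \<Omega> w * L2_inner \<Omega> w \<phi> - L2_inner \<Omega> r \<phi>"
    by (simp add: energy_deriv_def)
qed

text \<open>The definition of a strong solution supplies its own derivative for each T. Uniqueness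
  identifies it with \<open>ut\<close> on (0, T), and orthogonality to all test functions identifies
  it with the right-hand side of the equation.\<close>

lemma strong_solution_tested_equation:
  assumes \<Omega>: "open \<Omega>" "bounded \<Omega>" and p: "2 \<le> p" and T: "0 < T"
    and u: "strong_solution_on p \<Omega> u0 T u"
    and w: "has_weak_time_deriv \<Omega> {0<..} u ut" "ut \<in> L2L2 {0<..} \<Omega>"
  shows "AE t in lebesgue_on {0<..<T}. tested_equation p \<Omega> (u t) (ut t)"
proof -
  obtain v where v: "has_weak_time_deriv \<Omega> {0<..<T} u v" "v \<in> L2L2 {0<..<T} \<Omega>"
    "(\<lambda>t. G_op p \<Omega> (u t)) \<in> L2L2 {0<..<T} \<Omega>"
    "\<And>\<phi>. \<phi> \<in> L2L2 {0<..<T} \<Omega> \<Longrightarrow>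
       (LINT t|lebesgue_on {0<..<T}. L2_inner \<Omega> (\<lambda>x. v t x - G_op p \<Omega> (u t) x) (\<phi> t)) = 0"
    using u unfolding strong_solution_on_def by blast
  have D: "AE t in lebesgue_on {0<..<T}. u t \<in> DA \<Omega>"
    using u by (auto simp: strong_solution_on_def bochner_Lq_def strongly_measurable_def)
  have L: "u t \<in> LpH01 p \<Omega>" if "t \<in> {0..T}" for t
    using u that by (auto simp: strong_solution_on_def continuous_into_def)
  have 1: "AE t in lebesgue_on {0<..<T}. v t \<in> Lp 2 \<Omega> \<and> ut t \<in> Lp 2 \<Omega> \<and> (AE x in lebesgue_on \<Omega>. v t x = ut t x)"
    by (rule weak_time_deriv_unique[OF _ _ _ v(1,2) w]) auto
  have 2: "AE t in lebesgue_on {0<..<T}. v t \<in> Lp 2 \<Omega> \<and> G_op p \<Omega> (u t) \<in> Lp 2 \<Omega> \<and>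
      (AE x in lebesgue_on \<Omega>. v t x = G_op p \<Omega> (u t) x)"
    by (rule AE_eq_if_orthogonal[OF _ _ v(2,3,4)]) auto
  show ?thesis
    using D 1 2 AE_space
  proof eventually_elim
    case (elim t)
    have "t \<in> {0..T}" using elim(4) by (auto simp: space_restrict_space)
    moreover have "AE x in lebesgue_on \<Omega>. ut t x = G_op p \<Omega> (u t) x"
      using elim(2,3) by (auto elim: eventually_elim2)
    ultimately show ?case using elim L by (intro tested_equationI[OF \<Omega> p]) auto
  qed
qed

theorem proposition1p9:
  fixes \<Omega> :: "'a::euclidean_space set"
    and p :: real
    and u0 :: "'a \<Rightarrow> real"
    and u ut :: "real \<Rightarrow> 'a \<Rightarrow> real"
  assumes "2 \<le> p"
    and "bounded_smooth_domain \<Omega>"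
    and "u0 \<in> LpH01 p \<Omega> \<inter> L2_sphere \<Omega>"
    and "continuous_into (LpH01 p \<Omega> \<inter> L2_sphere \<Omega>) (LpH01_norm p \<Omega>) {0..} u"
    and "unique_strong_solution p \<Omega> u0 u"
    and "has_weak_time_deriv \<Omega> {0<..} u ut"
    and "ut \<in> L2L2 {0<..} \<Omega>"
  shows "\<exists>(\<tau> :: nat \<Rightarrow> real) u_inf.
           (\<forall>n. 0 \<le> \<tau> n) \<and> filterlim \<tau> at_top sequentially \<and>
           u_inf \<in> LpH01 p \<Omega> \<inter> L2_sphere \<Omega> \<and>
           (\<lambda>n. LpH01_norm p \<Omega> (\<lambda>x. u (\<tau> n) x - u_inf x)) \<longlonglongrightarrow> 0 \<and>
           (\<lambda>n. S_fun p \<Omega> (u (\<tau> n))) \<longlonglongrightarrow> S_fun p \<Omega> u_inf \<and>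
           solves_stationary p \<Omega> u_inf"
proof -
  note p = assms(1)
  have \<Omega>: "open \<Omega>" "bounded \<Omega>" using assms(2) by (auto simp: bounded_smooth_domain_def)
  let ?M = "lebesgue_on {0<..} :: real measure"
  define g where "g t = Lp_norm 2 \<Omega> (ut t)" for t
  define P where "P t \<longleftrightarrow> tested_equation p \<Omega> (u t) (ut t)" for t
  have uX: "u t \<in> LpH01 p \<Omega> \<inter> L2_sphere \<Omega>" if "0 \<le> t" for t
    using assms(4) that by (auto simp: continuous_into_def)
  have uL: "u t \<in> LpH01 p \<Omega>" and u1: "Lp_norm 2 \<Omega> (u t) = 1" if "0 \<le> t" for t
    using uX[OF that] by (auto simp: L2_sphere_def)
  have u2: "u t \<in> Lp 2 \<Omega>" if "0 \<le> t" for t using LpH01_Lp2[OF \<Omega> p uL[OF that]] .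
  have lim: "((\<lambda>s. LpH01_norm p \<Omega> (\<lambda>x. u s x - u t x)) \<longlongrightarrow> 0) (at t within {0..})" if "0 \<le> t" for t
    using assms(4) that by (auto simp: continuous_into_def)
  have ev: "\<forall>\<^sub>F s in at t within {0..}. u s \<in> LpH01 p \<Omega>" for t
    by (auto simp: eventually_at_filter uL)
  have fc: "continuous_on {0..} (\<lambda>t. energy p \<Omega> (u t))" and Sc: "continuous_on {0..} (\<lambda>t. S_fun p \<Omega> (u t))"
    using S_fun_energy_tendsto[OF \<Omega> p ev uL lim] by (auto simp: continuous_on_def)
  have lim2: "((\<lambda>s. Lp_norm 2 \<Omega> (\<lambda>x. u s x - u t x)) \<longlongrightarrow> 0) (at t)" if t: "0 < t" for t
  proof -
    have "((\<lambda>s. Lp_norm 2 \<Omega> (\<lambda>x. u s x - u t x)) \<longlongrightarrow> 0) (at t within {0..})"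
      \<comment> \<open>The passage from L^p to L2 is available for sequences, hence the sequential
        form of the limit.\<close>
      unfolding tendsto_at_iff_sequentially comp_def
    proof (intro allI impI)
      fix X :: "nat \<Rightarrow> real" assume X: "\<forall>i. X i \<in> {0..} - {t}" "X \<longlonglongrightarrow> t"
      have "(\<lambda>n. LpH01_norm p \<Omega> (\<lambda>x. u (X n) x - u t x)) \<longlonglongrightarrow> 0"
        using lim[of t] t X unfolding tendsto_at_iff_sequentially comp_def by auto
      then have l: "(\<lambda>n. Lp_norm p \<Omega> (\<lambda>x. u (X n) x - u t x)) \<longlonglongrightarrow> 0"
        by (rule Lim_null_comparison[rotated]) (simp add: LpH01_norm_def)
      have "(\<lambda>x. u (X n) x - u t x) \<in> Lp p \<Omega>" for n
        using LpH01_Lp[OF \<Omega> p uL, of "X n"] LpH01_Lp[OF \<Omega> p uL, of t] X t p by (intro Lp_diff) auto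
      then show "(\<lambda>n. Lp_norm 2 \<Omega> (\<lambda>x. u (X n) x - u t x)) \<longlonglongrightarrow> 0"
        using l by (rule Lp_tendsto_imp_Lp2_tendsto[OF p \<Omega>])
    qed
    moreover have "at t within {0..} = at t" using t by (intro at_within_interior) simp
    ultimately show ?thesis by simp
  qed
  have good: "AE t in ?M. P t"
  proof -
    \<comment> \<open>The exceptional null set depends on T, so only integer values of T are used;
      their countable union is still null.\<close>
    have "AE t in lebesgue. t \<in> {0<..<real (Suc n)} \<longrightarrow> P t" for n
    proof -
      have "strong_solution_on p \<Omega> u0 (real (Suc n)) u"
        using assms(5) by (simp add: unique_strong_solution_def strong_solution_def)
      from strong_solution_tested_equation[OF \<Omega> p _ this assms(6,7)]
      show ?thesis by (simp add: P_def AE_restrict_space_iff)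
    qed
    then have "AE t in lebesgue. \<forall>n. t \<in> {0<..<real (Suc n)} \<longrightarrow> P t" unfolding AE_all_countable ..
    then have "AE t in lebesgue. t \<in> {0<..} \<longrightarrow> P t"
    proof eventually_elim
      case (elim t)
      obtain n where "t < real n" using reals_Archimedean2 by blast
      then have "t < real (Suc n)" by simp
      with elim show ?case by auto
    qed
    then show ?thesis by (simp add: AE_restrict_space_iff)
  qed
  have gi: "integrable ?M (\<lambda>t. (g t)\<^sup>2)" unfolding g_def by (rule L2L2_norm_integrable(1)[OF assms(7)])
  obtain C where C: "\<And>T. 0 \<le> T \<Longrightarrow> energy p \<Omega> (u T) \<le> C"
  proof (rule bounded_by_dissipation[OF good gi fc Sc S_fun_nonneg])
    fix s t t' assume P: "P t" and t: "0 < s" "s < t" "t < t'"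
    define D where "D = Lp_norm 2 \<Omega> (\<lambda>x. u t x - u s x)"
    have L: "u s \<in> LpH01 p \<Omega>" "u t \<in> LpH01 p \<Omega>" and l2: "u s \<in> Lp 2 \<Omega>" "u t \<in> Lp 2 \<Omega>"
      using t by (auto intro: uL u2)
    have d: "(\<lambda>x. u t x - u s x) \<in> LpH01 p \<Omega>" by (rule LpH01_diff[OF \<Omega> p L(2,1)])
    have d2: "(\<lambda>x. u t x - u s x) \<in> Lp 2 \<Omega>" using LpH01_Lp2[OF \<Omega> p d] .
    have r: "ut t \<in> Lp 2 \<Omega>" and eq: "energy_deriv p \<Omega> (u t) (\<lambda>x. u t x - u s x) =
        S_fun p \<Omega> (u t) * L2_inner \<Omega> (u t) (\<lambda>x. u t x - u s x) - L2_inner \<Omega> (ut t) (\<lambda>x. u t x - u s x)"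
      using P d by (auto simp: P_def tested_equation_def)
    have n1: "L2_inner \<Omega> (u s) (u s) = 1" "L2_inner \<Omega> (u t) (u t) = 1"
      using u1[of s] u1[of t] t by (simp_all add: Lp2_norm_sq[symmetric])
    have "L2_inner \<Omega> (u t) (\<lambda>x. u t x - u s x) = 1 - L2_inner \<Omega> (u s) (u t)"
      using L2_inner_diff_left[OF l2(2,1,2)] n1 by (simp add: L2_inner_commute[of \<Omega> "u t" "\<lambda>x. u t x - u s x"])
    moreover have "L2_inner \<Omega> (u s) (\<lambda>x. u t x - u s x) = L2_inner \<Omega> (u s) (u t) - 1"
      using L2_inner_diff_left[OF l2(2,1,1)] n1
      by (simp add: L2_inner_commute[of \<Omega> "u s" "\<lambda>x. u t x - u s x"] L2_inner_commute[of \<Omega> "u s" "u t"])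
    moreover have "D\<^sup>2 = L2_inner \<Omega> (u t) (\<lambda>x. u t x - u s x) - L2_inner \<Omega> (u s) (\<lambda>x. u t x - u s x)"
      unfolding D_def Lp2_norm_sq by (rule L2_inner_diff_left[OF l2(2,1) d2])
    ultimately have half: "L2_inner \<Omega> (u t) (\<lambda>x. u t x - u s x) = D\<^sup>2 / 2" by simp
    \<comment> \<open>The tangent at the later state looks back to the earlier one. This direction
      gives an upper bound for the energy increment and uses the equation at the good time t
      only.\<close>
    have "energy_deriv p \<Omega> (u t) (\<lambda>x. u s x - u t x) = - energy_deriv p \<Omega> (u t) (\<lambda>x. u t x - u s x)"
      using energy_deriv_cmult[OF \<Omega> p L(2) d, of "-1"] by simp
    then have "energy p \<Omega> (u t) - energy p \<Omega> (u s) \<le> S_fun p \<Omega> (u t) * (D\<^sup>2 / 2) - L2_inner \<Omega> (ut t) (\<lambda>x. u t x - u s x)"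
      using energy_tangent[OF \<Omega> p L(2,1)] eq half by simp
    also have "\<dots> \<le> S_fun p \<Omega> (u t) / 2 * D\<^sup>2 + g t * D"
      using L2_Cauchy_Schwarz[OF r d2] by (simp add: g_def D_def)
    finally have "energy p \<Omega> (u t) - energy p \<Omega> (u s) \<le> S_fun p \<Omega> (u t) / 2 * D\<^sup>2 + g t * D" .
    moreover have "D\<^sup>2 \<le> (t' - s) * (LINT \<tau>|?M. indicator {s<..t'} \<tau> * (g \<tau>)\<^sup>2)"
      unfolding D_def g_def by (rule time_modulus[OF assms(6,7) u2 lim2 t]) auto
    ultimately show "\<exists>D. energy p \<Omega> (u t) - energy p \<Omega> (u s) \<le> S_fun p \<Omega> (u t) / 2 * D\<^sup>2 + g t * D \<and>
        D\<^sup>2 \<le> (t' - s) * (LINT \<tau>|?M. indicator {s<..t'} \<tau> * (g \<tau>)\<^sup>2)" by blast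
  qed blast
  \<comment> \<open>The dissipation in the n-th unit interval. It tends to 0 by dominated
    convergence, since a fixed time lies outside these intervals for all large n.\<close>
  define a where "a n = (LINT \<tau>|?M. indicator {real n<..real (Suc n)} \<tau> * (g \<tau>)\<^sup>2)" for n :: nat
  have a0: "a \<longlonglongrightarrow> 0"
  proof -
    have "a \<longlonglongrightarrow> (LINT \<tau>|?M. 0)"
      unfolding a_def
    proof (rule integral_dominated_convergence[OF _ _ gi])
      show "(\<lambda>\<tau>. indicator {real n<..real (Suc n)} \<tau> * (g \<tau>)\<^sup>2) \<in> borel_measurable ?M" for n
        using borel_measurable_integrable[OF gi] measure_lebesgue_on_Ioc(1)[of "real n" "real (Suc n)"] by measurable
      show "AE \<tau> in ?M. (\<lambda>n. indicator {real n<..real (Suc n)} \<tau> * (g \<tau>)\<^sup>2) \<longlonglongrightarrow> 0"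
      proof (rule AE_I2, rule tendsto_eventually)
        fix \<tau> :: real
        obtain N where "\<tau> < real N" using reals_Archimedean2 by blast
        then show "\<forall>\<^sub>F n in sequentially. indicator {real n<..real (Suc n)} \<tau> * (g \<tau>)\<^sup>2 = 0"
          unfolding eventually_sequentially by (intro exI[of _ N]) (auto simp: indicator_def)
      qed
    qed (auto simp: indicator_def)
    then show ?thesis by simp
  qed
  \<comment> \<open>On an interval of length 1 the integral is a mean, so some good time beyond n
    has a squared derivative norm at most the mean plus the vanishing slack 1 / (n + 1).\<close>
  have "\<exists>t. real n < t \<and> P t \<and> (g t)\<^sup>2 \<le> a n + inverse (real (Suc n))" for n
  proof -
    obtain t where "real n < t" "t < real (Suc n)" "P t"
      "(real (Suc n) - real n) * (g t)\<^sup>2 \<le> a n + inverse (real (Suc n))"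
      unfolding a_def by (rule AE_pick[OF good gi, of "real n" "real (Suc n)" "inverse (real (Suc n))"]) auto
    then show ?thesis by (intro exI[of _ t]) simp
  qed
  then obtain \<sigma> where \<sigma>: "\<And>n. real n < \<sigma> n" "\<And>n. P (\<sigma> n)" "\<And>n. (g (\<sigma> n))\<^sup>2 \<le> a n + inverse (real (Suc n))" by metis
  have \<sigma>0: "0 \<le> \<sigma> n" for n using \<sigma>(1)[of n] by (meson less_imp_le of_nat_0_le_iff order_trans)
  have "(\<lambda>n. (g (\<sigma> n))\<^sup>2) \<longlonglongrightarrow> 0"
  proof (rule Lim_null_comparison)
    show "\<forall>\<^sub>F n in sequentially. norm ((g (\<sigma> n))\<^sup>2) \<le> a n + inverse (real (Suc n))" using \<sigma>(3) by simp
    show "(\<lambda>n. a n + inverse (real (Suc n))) \<longlonglongrightarrow> 0"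
      using tendsto_add[OF a0 LIMSEQ_inverse_real_of_nat] by simp
  qed
  then have "(\<lambda>n. sqrt ((g (\<sigma> n))\<^sup>2)) \<longlonglongrightarrow> sqrt 0" by (rule tendsto_real_sqrt)
  then have r0: "(\<lambda>n. Lp_norm 2 \<Omega> (ut (\<sigma> n))) \<longlonglongrightarrow> 0" by (simp add: g_def)
  \<comment> \<open>The uniform energy bound enters here: it bounds the multipliers along the chosen
    times, which the compactness argument requires.\<close>
  have SC: "S_fun p \<Omega> (u (\<sigma> n)) \<le> p * C" for n
    using S_fun_le_energy[OF p, of \<Omega> "u (\<sigma> n)"] mult_left_mono[OF C[OF \<sigma>0[of n]], of p] p by linarith
  have r: "ut (\<sigma> n) \<in> Lp 2 \<Omega>" and eq: "\<phi> \<in> LpH01 p \<Omega> \<Longrightarrow> energy_deriv p \<Omega> (u (\<sigma> n)) \<phi> =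
      S_fun p \<Omega> (u (\<sigma> n)) * L2_inner \<Omega> (u (\<sigma> n)) \<phi> - L2_inner \<Omega> (ut (\<sigma> n)) \<phi>" for n \<phi>
    using \<sigma>(2)[of n] by (auto simp: P_def tested_equation_def)
  obtain k u_inf where k: "strict_mono (k :: nat \<Rightarrow> nat)" "u_inf \<in> LpH01 p \<Omega> \<inter> L2_sphere \<Omega>"
    "(\<lambda>n. LpH01_norm p \<Omega> (\<lambda>x. u (\<sigma> (k n)) x - u_inf x)) \<longlonglongrightarrow> 0"
    "(\<lambda>n. S_fun p \<Omega> (u (\<sigma> (k n)))) \<longlonglongrightarrow> S_fun p \<Omega> u_inf" "solves_stationary p \<Omega> u_inf"
    by (rule almost_critical_sequence_compact[OF \<Omega> p uX[OF \<sigma>0] r r0 SC eq])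
  have "filterlim \<sigma> at_top sequentially"
    by (rule filterlim_at_top_mono[OF filterlim_real_sequentially]) (simp add: \<sigma>(1) less_imp_le)
  then have "filterlim (\<lambda>n. \<sigma> (k n)) at_top sequentially"
    by (rule filterlim_compose) (rule filterlim_subseq[OF k(1)])
  then show ?thesis using k \<sigma>0 by (intro exI[of _ "\<lambda>n. \<sigma> (k n)"] exI[of _ u_inf]) auto
qed

end
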